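(* Let $g:\omega\to\omega$ be a total function which is computably $e$-independent, i.e. for every $i\in\omega$, $g^{[i]} \nleq_e \bigoplus_{j\neq i} g^{[j]}$. Let $\mathcal{Z}=\{i^{\frown}\varphi : i\in\omega,\ \varphi\in\mathcal{P},\ g^{[i]}\le_e \varphi\}$ and let $\mathbf{Z}=[\mathcal{Z}]_D$ be its Dyment degree. Then $\operatorname{Th}\big([\mathbf{0}_D,\mathbf{Z}]_{\mathscr{M}_D}\big)=\mathrm{IPC}$, where $\mathscr{M}_D$ is the Dyment lattice.
   Context: $\omega$ is the set of natural numbers; $\mathcal{P}$ is the set of all partial functions from $\omega$ to $\omega$; $\langle\cdot,\cdot\rangle$ is a standard computable pairing function. An enumeration operator ($e$-operator) is a map $\Phi:2^\omega\to 2^\omega$ given by a c.e. set $W$ via $\Phi(A)=\{x:(\exists u)[\langle x,u\rangle\in W\ \&\ D_u\subseteq A]\}$, $D_u$ being the finite set with canonical index $u$; $(\Phi_e)_{e\in\omega}$ is the standard indexing. $A\le_e B$ iff $A=\Phi(B)$ for some $e$-operator $\Phi$. For partial functions, $\varphi\le_e\psi$ iff $\operatorname{graph}(\varphi)\le_e\operatorname{graph}(\psi)$. An $e$-operator $\Phi$ induces a partial map on $\mathcal{P}$: $\Phi(\psi)$ is defined ($\psi\in\operatorname{domain}(\Phi)$) iff $\Phi(\operatorname{graph}(\psi))$ is the graph of a partial function, and then $\Phi(\psi)$ is that partial function. For $\varphi\in\mathcal{P}$: $\varphi^{[i]}(x)=\varphi(\langle i,x\rangle)$; $\bigoplus_{i\in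 I}\varphi^{[i]}$ is the partial function with $(\bigoplus_{i\in I}\varphi^{[i]})(\langle j,x\rangle)=\varphi^{[j]}(x)$ if $j\in I$, and $=0$ if $j\notin I$; $i^{\frown}\varphi$ is the partial function with $i^{\frown}\varphi(0)=i$ and $i^{\frown}\varphi(x+1)=\varphi(x)$. A $D$-mass problem is a subset of $\mathcal{P}$. For $D$-mass problems, $\mathcal{A}\le_D\mathcal{B}$ iff there is an $e$-operator $\Phi$ with $\mathcal{B}\subseteq\operatorname{domain}(\Phi)$ and $\Phi(\psi)\in\mathcal{A}$ for all $\psi\in\mathcal{B}$. The Dyment degree $[\mathcal{A}]_D$ is the class of $\mathcal{A}$ under the induced equivalence $\equiv_D$. The Dyment lattice $\mathscr{M}_D$ is the set of Dyment degrees ordered by $\le_D$; it is a Brouwer algebra with least element $\mathbf{0}_D$ (the degree of any $D$-mass problem containing a partial computable function) and greatest element $\mathbf{1}_D=[\emptyset]_D$. A Brouwer algebra is a lattice with $0\neq 1$ (least and greatest elements) such that for all $a,b$ the set $\{c: a\lor c\ge b\}$ has a least element, denoted $a\to b$. For $a\ne 0$, the interval $[0,a]_{\mathscr{L}}$ of a Brouwer algebra $\mathscr{L}$ is again a Brouwer algebra, with greatest element $a$. A propositional formula is an identity of a Brouwer algebra if every assignment of elements to its atoms evaluates it to $0$, where the connectives $\lor,\wedge,\to$ are interpreted by meet, join, and $\to$ respectively, and $\neg a$ by $a\to 1$ (with $1$ the greatest element of the algebra). $\operatorname{Th}(\mathscr{L})$ is the set of identities of $\mathscr{L}$. $\mathrm{IPC}$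 is the set of theorems of the intuitionistic propositional calculus. *)

theory Defs
  imports Main "HOL-Library.Nat_Bijection" "HOL-Algebra.Lattice"
begin

section \<open>Computability\<close>

datatype recf =
    Zero
  | Succ
  | Proj nat
  | Comp recf "recf list"
  | PrimRec recf recf
  | Mu recf

text \<open>
  Big-step semantics of the partial recursive functions: \<open>computes f xs y\<close> says that the
  program \<open>f\<close> halts on the argument tuple \<open>xs\<close> with output \<open>y\<close>. Programs carry no arity;
  restricted to tuples of any fixed length, a program computes a partial recursive function.
\<close>

inductive computes :: "recf \<Rightarrow> nat list \<Rightarrow> nat \<Rightarrow> bool" where
  zero: "computes Zero xs 0"
| succ: "computes Succ [x] (Suc x)"
| proj: "i < length xs \<Longrightarrow> computes (Proj i) xs (xs ! i)"
| comp: "list_all2 (\<lambda>h y. computes h xs y) hs ys \<Longrightarrow> computes f ys z \<Longrightarrow>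
    computes (Comp f hs) xs z"
| primrec_0: "computes f xs y \<Longrightarrow> computes (PrimRec f h) (0 # xs) y"
| primrec_Suc: "computes (PrimRec f h) (n # xs) y \<Longrightarrow> computes h (n # y # xs) z \<Longrightarrow>
    computes (PrimRec f h) (Suc n # xs) z"
| mu: "computes f (n # xs) 0 \<Longrightarrow> (\<forall>m<n. \<exists>y. computes f (m # xs) (Suc y)) \<Longrightarrow>
    computes (Mu f) xs n"

type_synonym pfun = "nat \<Rightarrow> nat option"

definition partial_computable :: "pfun \<Rightarrow> bool" where
  "partial_computable \<phi> \<longleftrightarrow> (\<exists>f. \<forall>x y. \<phi> x = Some y \<longleftrightarrow> computes f [x] y)"

definition ce :: "nat set \<Rightarrow> bool" where
  "ce W \<longleftrightarrow> (\<exists>\<phi>. partial_computable \<phi> \<and> W = dom \<phi>)"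

section \<open>Enumeration reducibility\<close>

text \<open>
  The computable pairing function is \<^const>\<open>prod_encode\<close> (the Cantor pairing), and the finite
  set with canonical index \<open>u\<close> is \<^term>\<open>set_decode u\<close> (the positions of the binary digits 1
  of \<open>u\<close>).
\<close>

definition e_operator :: "(nat set \<Rightarrow> nat set) \<Rightarrow> bool" where
  "e_operator \<Phi> \<longleftrightarrow>
     (\<exists>W. ce W \<and> (\<forall>A. \<Phi> A = {x. \<exists>u. prod_encode (x, u) \<in> W \<and> set_decode u \<subseteq> A}))"

definition e_reducible :: "nat set \<Rightarrow> nat set \<Rightarrow> bool" where
  "e_reducible A B \<longleftrightarrow> (\<exists>\<Phi>. e_operator \<Phi> \<and> A = \<Phi> B)"

definition code_graph :: "pfun \<Rightarrow> nat set" where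
  "code_graph \<phi> = prod_encode ` Map.graph \<phi>"

definition pfun_e_le :: "pfun \<Rightarrow> pfun \<Rightarrow> bool" (infix \<open>\<le>\<^sub>e\<close> 50) where
  "\<phi> \<le>\<^sub>e \<psi> \<longleftrightarrow> e_reducible (code_graph \<phi>) (code_graph \<psi>)"

text \<open>The partial map on partial functions induced by an operator; \<^const>\<open>None\<close> is undefined.\<close>

definition induced_map :: "(nat set \<Rightarrow> nat set) \<Rightarrow> (pfun \<Rightarrow> pfun option)" where
  "induced_map \<Phi> \<psi> =
     (if \<exists>\<phi>. \<Phi> (code_graph \<psi>) = code_graph \<phi>
      then Some (THE \<phi>. \<Phi> (code_graph \<psi>) = code_graph \<phi>)
      else None)"

definition column :: "pfun \<Rightarrow> nat \<Rightarrow> pfun" where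
  "column \<phi> i = (\<lambda>x. \<phi> (prod_encode (i, x)))"

definition column_sum :: "nat set \<Rightarrow> (nat \<Rightarrow> pfun) \<Rightarrow> pfun" where
  "column_sum I F =
     (\<lambda>n. case prod_decode n of (j, x) \<Rightarrow> if j \<in> I then F j x else Some 0)"

definition prepend :: "nat \<Rightarrow> pfun \<Rightarrow> pfun" where
  "prepend i \<phi> = (\<lambda>n. case n of 0 \<Rightarrow> Some i | Suc x \<Rightarrow> \<phi> x)"

definition computably_e_independent :: "pfun \<Rightarrow> bool" where
  "computably_e_independent \<phi> \<longleftrightarrow>
     (\<forall>i. \<not> column \<phi> i \<le>\<^sub>e column_sum {j. j \<noteq> i} (column \<phi>))"

section \<open>The Dyment lattice\<close>

type_synonym mass_problem = "pfun set"

definition D_le :: "mass_problem \<Rightarrow> mass_problem \<Rightarrow> bool" (infix \<open>\<le>\<^sub>D\<close> 50) where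
  "\<A> \<le>\<^sub>D \<B> \<longleftrightarrow>
     (\<exists>\<Phi>. e_operator \<Phi> \<and> \<B> \<subseteq> dom (induced_map \<Phi>) \<and>
          (\<forall>\<psi>\<in>\<B>. the (induced_map \<Phi> \<psi>) \<in> \<A>))"

definition D_equiv :: "mass_problem rel" where
  "D_equiv = {(\<A>, \<B>). \<A> \<le>\<^sub>D \<B> \<and> \<B> \<le>\<^sub>D \<A>}"

definition D_degree :: "mass_problem \<Rightarrow> mass_problem set" where
  "D_degree \<A> = D_equiv `` {\<A>}"

definition dyment_lattice :: "mass_problem set gorder" where
  "dyment_lattice =
     \<lparr>carrier = UNIV // D_equiv, eq = (=),
      le = (\<lambda>a b. \<exists>\<A>\<in>a. \<exists>\<B>\<in>b. \<A> \<le>\<^sub>D \<B>)\<rparr>"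

text \<open>
  Any mass problem containing a partial computable function has least degree; the set of all
  partial computable functions serves as representative.
\<close>

definition zero_D :: "mass_problem set" where
  "zero_D = D_degree {\<phi>. partial_computable \<phi>}"

section \<open>Brouwer algebras\<close>

locale brouwer_algebra = bounded_lattice L for L (structure) +
  assumes bottom_neq_top: "\<bottom> \<noteq> \<top>"
    and arrow_exists: "a \<in> carrier L \<Longrightarrow> b \<in> carrier L \<Longrightarrow>
      \<exists>c. least L c {c \<in> carrier L. b \<sqsubseteq> a \<squnion> c}"

definition arrow :: "('a, 'b) gorder_scheme \<Rightarrow> 'a \<Rightarrow> 'a \<Rightarrow> 'a" where
  "arrow L a b = (SOME c. least L c {c \<in> carrier L. b \<sqsubseteq>\<^bsub>L\<^esub> a \<squnion>\<^bsub>L\<^esub> c})"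

text \<open>
  The interval from \<open>a\<close> to \<open>b\<close> as an ordered structure of its own. Lattice operations, bounds
  and \<^const>\<open>arrow\<close> of the interval are determined by the order restricted to it.
\<close>

definition interval :: "'a gorder \<Rightarrow> 'a \<Rightarrow> 'a \<Rightarrow> 'a gorder" where
  "interval L a b = L\<lparr>carrier := \<lbrace>a..b\<rbrace>\<^bsub>L\<^esub>\<rparr>"

section \<open>Propositional formulas\<close>

datatype form =
    Atom nat
  | Or form form
  | And form form
  | Imp form form
  | Neg form

text \<open>
  Truth is the least element, so disjunction is interpreted by meet and conjunction by join.
\<close>

primrec form_val :: "('a, 'b) gorder_scheme \<Rightarrow> (nat \<Rightarrow> 'a) \<Rightarrow> form \<Rightarrow> 'a" where
  "form_val L v (Atom n) = v n"
| "form_val L v (Or p q) = form_val L v p \<sqinter>\<^bsub>L\<^esub> form_val L v q"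
| "form_val L v (And p q) = form_val L v p \<squnion>\<^bsub>L\<^esub> form_val L v q"
| "form_val L v (Imp p q) = arrow L (form_val L v p) (form_val L v q)"
| "form_val L v (Neg p) = arrow L (form_val L v p) \<top>\<^bsub>L\<^esub>"

definition Th :: "('a, 'b) gorder_scheme \<Rightarrow> form set" where
  "Th L = {p. \<forall>v. (\<forall>n. v n \<in> carrier L) \<longrightarrow> form_val L v p = \<bottom>\<^bsub>L\<^esub>}"

inductive_set IPC :: "form set" where
  K: "Imp p (Imp q p) \<in> IPC"
| S: "Imp (Imp p (Imp q r)) (Imp (Imp p q) (Imp p r)) \<in> IPC"
| and_elim1: "Imp (And p q) p \<in> IPC"
| and_elim2: "Imp (And p q) q \<in> IPC"
| and_intro: "Imp p (Imp q (And p q)) \<in> IPC"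
| or_intro1: "Imp p (Or p q) \<in> IPC"
| or_intro2: "Imp q (Or p q) \<in> IPC"
| or_elim: "Imp (Imp p r) (Imp (Imp q r) (Imp (Or p q) r)) \<in> IPC"
| neg_intro: "Imp (Imp p q) (Imp (Imp p (Neg q)) (Neg p)) \<in> IPC"
| neg_elim: "Imp (Neg p) (Imp p q) \<in> IPC"
| mp: "Imp p q \<in> IPC \<Longrightarrow> p \<in> IPC \<Longrightarrow> q \<in> IPC"

end

(*
  Soundness is the usual algebra of Brouwer lattices. For completeness, a formula outside IPC has a
  finite rooted Kripke countermodel, and passing to the nerve of its frame gives a countermodel on
  all subsets of a finite set of vertices, ordered by inclusion, in which some sets explode (force
  everything). To realise it below Z, each vertex v gets an e-degree f_v computing all columns of g
  except those in a finite set D_v, such that f_v together with any missing column computes all of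
  g. A subset C of the vertices corresponds to the problem of computing some f_v with v not in C (or
  all of g); C explodes iff all these f_v compute one common column, that is, iff the problem is as
  hard as Z in a uniform way. Relative to the problem of computing some f_v, these problems form a
  Boolean algebra under join and implication, and they behave like irreducible elements with respect
  to tagged unions, so tagged unions of them interpret formulas as the Kripke model does. The f_v
  come from a finite extension argument with purely positive coding.
*)

theory Submission
  imports Defs "HOL-Library.Countable_Set"
begin

section \<open>Computable functions\<close>

text \<open>The obstacle is uniformity: a reduction to a tagged union must write one definite tag at
  argument 0 without knowing which degree it faces. Partial functions resolve this: the functions
  \<open>set_pfun B\<close> are pairwise compatible, so the tag cannot depend on \<open>B\<close>,
  and implications between tagged unions reduce to implications between their classes. The shape of
  the frame comes from conjunction. Intersecting the problems of two sets of vertices unites the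
  sets, so worlds must be closed under union; hence all subsets of a finite set occur, and unions of
  incompatible worlds have to explode. An exploding set must yield a problem as hard as Z, so it is
  given a column computed by exactly the vertices outside it. Subsets of \<open>{..<N}\<close> have
  canonical indices below \<open>2 ^ N\<close>, which is why that many columns are spent on them.
  Every further column gets a private vertex missing it; otherwise all vertices would share this
  column and even the empty set would explode. So there are infinitely many vertices, of which only
  the first \<open>N\<close> occur in worlds.\<close>

lemma computes_functional: "computes f xs y \<Longrightarrow> computes f xs z \<Longrightarrow> y = z"
proof (induction arbitrary: z rule: computes.induct)
  case (comp xs hs ys f z')
  from comp.prems obtain ys' where ys': "list_all2 (\<lambda>h y. computes h xs y) hs ys'" "computes f ys' z"
    by cases auto
  have "ys = ys'"
  proof (rule nth_equalityI)
    show "length ys = length ys'"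
      using comp.IH(1) ys'(1) by (auto dest!: list_all2_lengthD)
    show "ys ! i = ys' ! i" if "i < length ys" for i
      using comp.IH(1) ys'(1) that by (auto simp: list_all2_conv_all_nth)
  qed
  with ys' comp.IH(2) show ?case by blast
next
  case (primrec_Suc f h n xs y z')
  from primrec_Suc.prems show ?case
    by cases (use primrec_Suc.IH in blast)
next
  case (mu f n xs)
  from mu.prems have z: "computes f (z # xs) 0" "\<forall>m<z. \<exists>y. computes f (m # xs) (Suc y)"
    by (cases; auto)+
  have "\<not> z < n"
    using mu.IH(2) z(1) by (metis nat.distinct(1))
  moreover have "\<not> n < z"
    using z(2) mu.IH(1) by blast
  ultimately show ?case by simp
next
  case (primrec_0 f xs y h)
  from primrec_0.prems show ?case
    by cases (use primrec_0.IH in blast)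
qed (erule computes.cases; simp)+

text \<open>Programs carry no arity, so a tuple length has to be fixed before a program can be
  called total.\<close>

definition total_prog :: "nat \<Rightarrow> recf \<Rightarrow> (nat list \<Rightarrow> nat) \<Rightarrow> bool" where
  "total_prog k p F \<longleftrightarrow> (\<forall>xs. length xs = k \<longrightarrow> computes p xs (F xs))"

definition computable :: "(nat \<Rightarrow> nat) \<Rightarrow> bool" where
  "computable f \<longleftrightarrow> (\<exists>p. total_prog 1 p (\<lambda>xs. f (xs ! 0)))"

definition computable2 :: "(nat \<Rightarrow> nat \<Rightarrow> nat) \<Rightarrow> bool" where
  "computable2 f \<longleftrightarrow> (\<exists>p. total_prog 2 p (\<lambda>xs. f (xs ! 0) (xs ! 1)))"

lemma total_prog_Zero: "total_prog k Zero (\<lambda>xs. 0)"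
  by (simp add: total_prog_def computes.zero)

lemma total_prog_Succ: "total_prog 1 Succ (\<lambda>xs. Suc (xs ! 0))"
  by (auto simp: total_prog_def length_Suc_conv intro: computes.succ)

lemma total_prog_Proj: "i < k \<Longrightarrow> total_prog k (Proj i) (\<lambda>xs. xs ! i)"
  by (auto simp: total_prog_def intro: computes.proj)

lemma total_prog_Comp1:
  assumes "total_prog 1 f F" "total_prog k h H"
  shows "total_prog k (Comp f [h]) (\<lambda>xs. F [H xs])"
  using assms by (auto simp: total_prog_def intro!: computes.comp[where ys = "[_]"])

lemma total_prog_Comp2:
  assumes "total_prog 2 f F" "total_prog k h H" "total_prog k h' H'"
  shows "total_prog k (Comp f [h, h']) (\<lambda>xs. F [H xs, H' xs])"
  using assms by (auto simp: total_prog_def intro!: computes.comp[where ys = "[_, _]"])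

lemma total_prog_cong:
  "total_prog k p F \<Longrightarrow> (\<And>xs. length xs = k \<Longrightarrow> F xs = G xs) \<Longrightarrow> total_prog k p G"
  by (simp add: total_prog_def)

text \<open>The lengths \<open>m\<close> and \<open>l\<close> are variables tied by equations so
  that the rule can be instantiated with numerals.\<close>

lemma total_prog_PrimRec:
  assumes "total_prog k f F" "total_prog m h H" "m = k + 2" "l = k + 1"
  shows "total_prog l (PrimRec f h)
    (\<lambda>xs. rec_nat (F (tl xs)) (\<lambda>n y. H (n # y # tl xs)) (hd xs))"
proof -
  have "computes (PrimRec f h) (n # xs) (rec_nat (F xs) (\<lambda>n y. H (n # y # xs)) n)"
    if "length xs = k" for n xs
  proof (induction n)
    case 0
    then show ?case using assms(1) that by (auto simp: total_prog_def intro: computes.primrec_0)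
  next
    case (Suc n)
    then show ?case using assms(2,3) that by (auto simp: total_prog_def intro: computes.primrec_Suc)
  qed
  then show ?thesis using assms(4) by (auto simp: total_prog_def length_Suc_conv)
qed

lemma total_prog_Mu:
  assumes "total_prog (Suc k) f F" "\<And>xs. length xs = k \<Longrightarrow> F (G xs # xs) = 0"
    "\<And>xs n. length xs = k \<Longrightarrow> n < G xs \<Longrightarrow> F (n # xs) \<noteq> 0"
  shows "total_prog k (Mu f) G"
  unfolding total_prog_def
proof (intro allI impI)
  fix xs :: "nat list" assume k: "length xs = k"
  show "computes (Mu f) xs (G xs)"
  proof (rule computes.mu)
    show "computes f (G xs # xs) 0"
      using assms(1,2) k by (metis length_Cons total_prog_def)
    show "\<forall>m<G xs. \<exists>y. computes f (m # xs) (Suc y)"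
      using assms(1,3) k by (metis length_Cons not0_implies_Suc total_prog_def)
  qed
qed

lemma computableI: "total_prog 1 p F \<Longrightarrow> (\<And>x. F [x] = f x) \<Longrightarrow> computable f"
  unfolding computable_def by (rule exI[of _ p], erule total_prog_cong) (auto simp: length_Suc_conv)

lemma computable2I: "total_prog 2 p F \<Longrightarrow> (\<And>x y. F [x, y] = f x y) \<Longrightarrow> computable2 f"
  unfolding computable2_def by (rule exI[of _ p], erule total_prog_cong)
    (auto simp: length_Suc_conv numeral_2_eq_2)

lemma computable_id: "computable (\<lambda>x. x)"
  by (rule computableI[OF total_prog_Proj[of 0]]) auto

lemma computable_comp: "computable f \<Longrightarrow> computable g \<Longrightarrow> computable (\<lambda>x. f (g x))"
  unfolding computable_def using total_prog_Comp1 by fastforce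

lemma computable_comp2:
  "computable2 f \<Longrightarrow> computable g \<Longrightarrow> computable h \<Longrightarrow> computable (\<lambda>x. f (g x) (h x))"
  unfolding computable_def computable2_def using total_prog_Comp2 by fastforce

lemma computable_Suc: "computable f \<Longrightarrow> computable (\<lambda>x. Suc (f x))"
  by (rule computable_comp[of Suc]) (auto intro: computableI[OF total_prog_Succ])

lemma computable_const: "computable (\<lambda>x. c)"
  by (induction c) (auto intro: computable_Suc computableI[OF total_prog_Zero])

lemma computable2_add: "computable2 (+)"
proof (rule computable2I)
  show "total_prog 2 (PrimRec (Proj 0) (Comp Succ [Proj 1]))
    (\<lambda>xs. rec_nat (tl xs ! 0) (\<lambda>n y. Suc ([(n # y # tl xs) ! 1] ! 0)) (hd xs))"
    using total_prog_PrimRec[OF total_prog_Proj[of 0 1] total_prog_Comp1[OF total_prog_Succ total_prog_Proj[of 1 3]]]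
    by (simp add: numeral_2_eq_2)
  show "rec_nat (tl [x, y] ! 0) (\<lambda>n z. Suc ([(n # z # tl [x, y]) ! 1] ! 0)) (hd [x, y]) = x + y" for x y
    by (induction x) auto
qed

lemma computable_pred: "computable (\<lambda>x. x - 1)"
proof (rule computableI)
  show "total_prog 1 (PrimRec Zero (Proj 0)) (\<lambda>xs. rec_nat 0 (\<lambda>n y. (n # y # tl xs) ! 0) (hd xs))"
    using total_prog_PrimRec[OF total_prog_Zero total_prog_Proj[of 0 2]] by simp
  show "rec_nat 0 (\<lambda>n y. (n # y # tl [x]) ! 0) (hd [x]) = x - 1" for x
    by (cases x) auto
qed

lemma computable2_diff: "computable2 (-)"
proof -
  obtain p where p: "total_prog 1 p (\<lambda>xs. xs ! 0 - 1)"
    using computable_pred by (auto simp: computable_def)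
  define q where "q = PrimRec (Proj 0) (Comp p [Proj 1])"
  have "total_prog 2 q (\<lambda>xs. rec_nat (tl xs ! 0) (\<lambda>n y. [(n # y # tl xs) ! 1] ! 0 - 1) (hd xs))"
    unfolding q_def
    using total_prog_PrimRec[OF total_prog_Proj[of 0 1] total_prog_Comp1[OF p total_prog_Proj[of 1 3]]]
    by (simp add: numeral_2_eq_2)
  \<comment> \<open>\<open>PrimRec\<close> recurses on its first argument but subtraction on its
    second, so the arguments are swapped.\<close>
  from total_prog_Comp2[OF this total_prog_Proj[of 1 2] total_prog_Proj[of 0 2]]
  show ?thesis
  proof (rule computable2I, simp_all)
    show "rec_nat x (\<lambda>n y. y - Suc 0) y = x - y" for x y
      by (induction y) auto
  qed
qed

lemma computable_triangle: "computable triangle"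
proof -
  obtain p where p: "total_prog 2 p (\<lambda>xs. xs ! 0 + xs ! 1)"
    using computable2_add computable2_def by blast
  have "total_prog 1 (PrimRec Zero (Comp p [Comp Succ [Proj 0], Proj 1]))
    (\<lambda>xs. rec_nat 0 (\<lambda>n y. [Suc ([(n # y # tl xs) ! 0] ! 0), (n # y # tl xs) ! 1] ! 0 + 
      [Suc ([(n # y # tl xs) ! 0] ! 0), (n # y # tl xs) ! 1] ! 1) (hd xs))"
    using total_prog_PrimRec[OF total_prog_Zero[of 0] total_prog_Comp2[OF p
        total_prog_Comp1[OF total_prog_Succ total_prog_Proj[of 0 2]] total_prog_Proj[of 1 2]]]
    by simp
  then show ?thesis
  proof (rule computableI)
    show "rec_nat 0 (\<lambda>n y. [Suc ([(n # y # tl [x]) ! 0] ! 0), (n # y # tl [x]) ! 1] ! 0 + 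
      [Suc ([(n # y # tl [x]) ! 0] ! 0), (n # y # tl [x]) ! 1] ! 1) (hd [x]) = triangle x" for x
      by (induction x) auto
  qed
qed

lemma computable2_comp:
  assumes "computable2 f" "computable2 g" "computable2 h"
  shows "computable2 (\<lambda>x y. f (g x y) (h x y))"
  using assms unfolding computable2_def using total_prog_Comp2 by fastforce

lemma computable2_fst: "computable2 (\<lambda>x y. x)"
  by (rule computable2I[OF total_prog_Proj[of 0]]) auto

lemma computable2_snd: "computable2 (\<lambda>x y. y)"
  by (rule computable2I[OF total_prog_Proj[of 1]]) auto

lemma computable2_comp1: "computable f \<Longrightarrow> computable2 g \<Longrightarrow> computable2 (\<lambda>x y. f (g x y))"
  unfolding computable_def computable2_def using total_prog_Comp1 by fastforce

section \<open>The Cantor pairing and its projections\<close>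

definition pair :: "nat \<Rightarrow> nat \<Rightarrow> nat" where "pair x y = prod_encode (x, y)"
definition pi1 :: "nat \<Rightarrow> nat" where "pi1 z = fst (prod_decode z)"
definition pi2 :: "nat \<Rightarrow> nat" where "pi2 z = snd (prod_decode z)"

lemma pi1_pair [simp]: "pi1 (pair x y) = x"
  and pi2_pair [simp]: "pi2 (pair x y) = y"
  and pair_pi [simp]: "pair (pi1 z) (pi2 z) = z"
  by (simp_all add: pair_def pi1_def pi2_def)

lemma prod_decode_pair [simp]: "prod_decode (pair x y) = (x, y)"
  by (simp add: pair_def)

lemma pair_eq_iff [simp]: "pair x y = pair x' y' \<longleftrightarrow> x = x' \<and> y = y'"
  by (simp add: pair_def)

lemma computable2_pair: "computable2 pair"
proof -
  have "computable2 (\<lambda>x y. triangle (x + y) + x)"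
    by (intro computable2_comp[OF computable2_add] computable2_comp1[OF computable_triangle]
        computable2_add computable2_fst)
  then show ?thesis by (simp add: pair_def[abs_def] prod_encode_def)
qed

lemma triangle_mono: "x \<le> y \<Longrightarrow> triangle x \<le> triangle y"
  by (induction y) (auto simp: le_Suc_eq)

text \<open>The diagonal \<open>pi1 z + pi2 z\<close> is the least \<open>w\<close> with
  \<open>z < triangle (Suc w)\<close>, so \<open>Mu\<close> finds it; both projections then follow
  by subtraction.\<close>

lemma computable_pi: "computable pi1" "computable pi2"
proof -
  define G where "G = (\<lambda>xs::nat list. pi1 (xs ! 0) + pi2 (xs ! 0))"
  have "computable2 (\<lambda>w z. Suc z - triangle (Suc w))"
    by (intro computable2_comp[OF computable2_diff] computable2_comp1[OF computable_triangle]
        computable2_comp1[OF computable_Suc[OF computable_id]] computable2_fst computable2_snd)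
  then obtain p where p: "total_prog 2 p (\<lambda>xs. Suc (xs ! 1) - triangle (Suc (xs ! 0)))"
    unfolding computable2_def by blast
  have z: "z = triangle (pi1 z + pi2 z) + pi1 z" for z
    using pair_pi[of z] unfolding pair_def prod_encode_def by simp
  have "total_prog 1 (Mu p) G"
  proof (rule total_prog_Mu)
    show "total_prog (Suc 1) p (\<lambda>xs. Suc (xs ! 1) - triangle (Suc (xs ! 0)))"
      using p by (simp add: numeral_2_eq_2)
    fix xs :: "nat list" assume "length xs = 1"
    then obtain z where xs: "xs = [z]" by (auto simp: length_Suc_conv)
    show "Suc ((G xs # xs) ! 1) - triangle (Suc ((G xs # xs) ! 0)) = 0"
      using z[of z] by (simp add: xs G_def)
    show "Suc ((n # xs) ! 1) - triangle (Suc ((n # xs) ! 0)) \<noteq> 0" if "n < G xs" for n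
    proof -
      have "triangle (Suc n) \<le> triangle (pi1 z + pi2 z)"
        using that by (intro triangle_mono) (auto simp: G_def xs)
      then show ?thesis using z[of z] xs by simp
    qed
  qed
  then have s: "computable (\<lambda>z. pi1 z + pi2 z)"
    by (rule computableI) (simp add: G_def)
  have c1: "computable (\<lambda>z. z - triangle (pi1 z + pi2 z))"
    by (intro computable_comp2[OF computable2_diff] computable_id computable_comp[OF computable_triangle] s)
  then show "computable pi1"
  proof -
    have "pi1 = (\<lambda>z. z - triangle (pi1 z + pi2 z))" using z by (metis add_diff_cancel_left')
    then show ?thesis using c1 by simp
  qed
  then have "computable (\<lambda>z. (pi1 z + pi2 z) - pi1 z)"
    by (intro computable_comp2[OF computable2_diff] s)
  then show "computable pi2" by (simp add: eta_contract_eq)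
qed

lemma computable_pair: "computable f \<Longrightarrow> computable g \<Longrightarrow> computable (\<lambda>x. pair (f x) (g x))"
  by (rule computable_comp2[OF computable2_pair])

lemma computable_pi1: "computable f \<Longrightarrow> computable (\<lambda>x. pi1 (f x))"
  and computable_pi2: "computable f \<Longrightarrow> computable (\<lambda>x. pi2 (f x))"
  by (rule computable_comp[OF computable_pi(1)] computable_comp[OF computable_pi(2)], assumption)+

lemma computable_add: "computable f \<Longrightarrow> computable g \<Longrightarrow> computable (\<lambda>x. f x + g x)"
  and computable_diff: "computable f \<Longrightarrow> computable g \<Longrightarrow> computable (\<lambda>x. f x - g x)"
  by (rule computable_comp2[OF computable2_add] computable_comp2[OF computable2_diff], assumption+)+

lemma computable_prod_encode:
  "computable f \<Longrightarrow> computable g \<Longrightarrow> computable (\<lambda>x. prod_encode (f x, g x))"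
  using computable_pair[of f g] by (simp add: pair_def)

lemmas computable_intros = computable_pair computable_prod_encode computable_pi1 computable_pi2
  computable_Suc computable_add computable_diff computable_id computable_const

text \<open>Parameter, counter and accumulator are packed into one number, so that later closure
  proofs handle unary functions only.\<close>

lemma computable_rec:
  assumes "computable f" "computable g" "computable n"
  shows "computable (\<lambda>x. rec_nat (f x) (\<lambda>i y. g (pair x (pair i y))) (n x))"
proof -
  obtain pf where pf: "total_prog 1 pf (\<lambda>xs. f (xs ! 0))" using assms(1) computable_def by blast
  obtain pg where pg: "total_prog 1 pg (\<lambda>xs. g (xs ! 0))" using assms(2) computable_def by blast
  obtain pp where pp: "total_prog 2 pp (\<lambda>xs. pair (xs ! 0) (xs ! 1))"
    using computable2_pair computable2_def by blast
  have P: "total_prog 3 (Proj 0) (\<lambda>xs. xs ! 0)" "total_prog 3 (Proj 1) (\<lambda>xs. xs ! 1)"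
    "total_prog 3 (Proj 2) (\<lambda>xs. xs ! 2)"
    by (simp_all add: total_prog_Proj)
  have h: "total_prog 3 (Comp pg [Comp pp [Proj 2, Comp pp [Proj 0, Proj 1]]])
     (\<lambda>xs. g (pair (xs ! 2) (pair (xs ! 0) (xs ! 1))))"
    using total_prog_Comp1[OF pg total_prog_Comp2[OF pp P(3) total_prog_Comp2[OF pp P(1,2)]]] by simp
  have "computable2 (\<lambda>m x. rec_nat (f x) (\<lambda>i y. g (pair x (pair i y))) m)"
  proof (rule computable2I)
    show "total_prog 2 (PrimRec pf (Comp pg [Comp pp [Proj 2, Comp pp [Proj 0, Proj 1]]]))
      (\<lambda>xs. rec_nat (f (tl xs ! 0)) (\<lambda>i y. g (pair ((i # y # tl xs) ! 2) (pair ((i # y # tl xs) ! 0) ((i # y # tl xs) ! 1)))) (hd xs))"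
      using total_prog_PrimRec[OF pf h] by (simp add: numeral_2_eq_2)
  qed auto
  from computable_comp2[OF this assms(3) computable_id] show ?thesis .
qed

lemma computable_if0:
  assumes "computable f" "computable g" "computable h"
  shows "computable (\<lambda>x. if f x = 0 then g x else h x)"
proof -
  have "computable (\<lambda>x. rec_nat (g x) (\<lambda>i y. (\<lambda>z. h (pi1 z)) (pair x (pair i y))) (f x))"
    by (intro computable_rec assms computable_comp[OF assms(3)] computable_intros)
  moreover have "rec_nat (g x) (\<lambda>i y. h x) n = (if n = 0 then g x else h x)" for n x
    by (cases n) auto
  ultimately show ?thesis by simp
qed

section \<open>Decidable predicates\<close>

lemma if_not: "(if \<not> b then x else y) = (if b then y else x)"
  by simp

lemma if_if_0: "(if (if b then 0 else 1) = (0::nat) then x else y) = (if b then x else y)"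
  by simp

lemma if_conj: "(if b \<and> c then x else y) = (if b then if c then x else y else y)"
  by simp

text \<open>Truth is coded by 0, the value that \<open>computable_if0\<close> tests and
  \<open>Mu\<close> searches for.\<close>

definition dec :: "(nat \<Rightarrow> bool) \<Rightarrow> bool" where
  "dec P \<longleftrightarrow> computable (\<lambda>x. if P x then 0 else 1)"

lemma computable_If: "dec P \<Longrightarrow> computable g \<Longrightarrow> computable h \<Longrightarrow> computable (\<lambda>x. if P x then g x else h x)"
  using computable_if0[of "\<lambda>x. if P x then 0 else 1" g h] by (simp add: dec_def if_if_0)

lemma dec_eq0: "computable f \<Longrightarrow> dec (\<lambda>x. f x = 0)"
  unfolding dec_def by (intro computable_if0 computable_intros)

lemma dec_not: "dec P \<Longrightarrow> dec (\<lambda>x. \<not> P x)"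
  unfolding dec_def[of "\<lambda>x. \<not> P x"] if_not
  by (rule computable_If) (simp_all add: computable_const)

lemma dec_conj: "dec P \<Longrightarrow> dec Q \<Longrightarrow> dec (\<lambda>x. P x \<and> Q x)"
  unfolding dec_def[of "\<lambda>x. P x \<and> Q x"]
  using computable_If[of P "\<lambda>x. if Q x then 0 else 1" "\<lambda>x. 1"]
  by (simp add: computable_const dec_def if_conj)

lemma dec_disj: "dec P \<Longrightarrow> dec Q \<Longrightarrow> dec (\<lambda>x. P x \<or> Q x)"
  using dec_not[OF dec_conj[OF dec_not[of P] dec_not[of Q]]] by simp

lemma dec_imp: "dec P \<Longrightarrow> dec Q \<Longrightarrow> dec (\<lambda>x. P x \<longrightarrow> Q x)"
  using dec_disj[OF dec_not[of P], of Q] by simp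

lemma dec_le: "computable f \<Longrightarrow> computable g \<Longrightarrow> dec (\<lambda>x. f x \<le> g x)"
  using dec_eq0[OF computable_diff[of f g]] by simp

lemma dec_less: "computable f \<Longrightarrow> computable g \<Longrightarrow> dec (\<lambda>x. f x < g x)"
  using dec_le[OF computable_Suc[of f], of g] by (simp add: Suc_le_eq)

lemma dec_eq: "computable f \<Longrightarrow> computable g \<Longrightarrow> dec (\<lambda>x. f x = g x)"
  using dec_conj[OF dec_le[of f g] dec_le[of g f]] by (simp add: eq_iff)

lemma dec_comp: "dec P \<Longrightarrow> computable f \<Longrightarrow> dec (\<lambda>x. P (f x))"
  unfolding dec_def using computable_comp[of "\<lambda>x. if P x then 0 else 1" f] by simp

lemma dec_const: "dec (\<lambda>x. b)"
  by (simp add: dec_def computable_const)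

text \<open>Binary relations are handed over on coded pairs, so that nested quantifiers fall to
  repeated introduction. The search is a recursion whose accumulator drops from 1 to 0 at a witness
  and stays there.\<close>

lemma dec_bex:
  assumes "dec (\<lambda>z. P (pi1 z) (pi2 z))" "computable b"
  shows "dec (\<lambda>x. \<exists>y<b x. P x y)"
proof -
  have "computable (\<lambda>x. rec_nat 1 (\<lambda>i y.
      (\<lambda>z. if P (pi1 z) (pi1 (pi2 z)) then 0 else pi2 (pi2 z)) (pair x (pair i y))) (b x))"
    using dec_comp[OF assms(1), of "\<lambda>z. pair (pi1 z) (pi1 (pi2 z))"]
    by (intro computable_rec assms computable_If computable_intros) (simp_all add: computable_intros)
  moreover have "rec_nat (Suc 0) (\<lambda>i y. if P x i then 0 else y) n = (if \<exists>y<n. P x y then 0 else 1)" for n x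
    by (induction n) (auto simp: less_Suc_eq)
  ultimately show ?thesis by (simp add: dec_def cong: if_cong)
qed

lemma dec_ball:
  assumes "dec (\<lambda>z. P (pi1 z) (pi2 z))" "computable b"
  shows "dec (\<lambda>x. \<forall>y<b x. P x y)"
  using dec_not[OF dec_bex[OF dec_not[OF assms(1)] assms(2)]] by simp

lemmas dec_intros = dec_not dec_conj dec_disj dec_imp dec_eq dec_le dec_less dec_bex dec_ball dec_const

section \<open>Computably enumerable relations\<close>

text \<open>The working form of computable enumerability: projections of decidable relations have
  direct closure rules. \<open>ce_iff_sigma1\<close> identifies it with \<open>ce\<close>.\<close>

definition sigma1 :: "(nat \<Rightarrow> bool) \<Rightarrow> bool" where
  "sigma1 P \<longleftrightarrow> (\<exists>t. dec t \<and> (\<forall>x. P x \<longleftrightarrow> (\<exists>s. t (pair x s))))"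

lemma sigma1I: "dec t \<Longrightarrow> (\<And>x. P x \<longleftrightarrow> (\<exists>s. t (pair x s))) \<Longrightarrow> sigma1 P"
  unfolding sigma1_def by blast

lemma sigma1_dec: "dec P \<Longrightarrow> sigma1 P"
  by (rule sigma1I[of "\<lambda>z. P (pi1 z)"]) (auto intro!: dec_comp[of P] computable_intros)

lemma sigma1_comp: "sigma1 P \<Longrightarrow> computable f \<Longrightarrow> sigma1 (\<lambda>x. P (f x))"
  unfolding sigma1_def by (elim exE conjE, rule_tac x = "\<lambda>z. t (pair (f (pi1 z)) (pi2 z))" in exI)
    (auto intro!: computable_intros dec_comp[of _ "\<lambda>z. pair (f (pi1 z)) (pi2 z)"] intro: computable_comp)

lemma sigma1_conj: assumes "sigma1 P" "sigma1 Q" shows "sigma1 (\<lambda>x. P x \<and> Q x)"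
proof -
  obtain t u where t: "dec t" "\<And>x. P x \<longleftrightarrow> (\<exists>s. t (pair x s))"
    and u: "dec u" "\<And>x. Q x \<longleftrightarrow> (\<exists>s. u (pair x s))"
    using assms unfolding sigma1_def by blast
  show ?thesis
  proof (rule sigma1I)
    show "dec (\<lambda>z. t (pair (pi1 z) (pi1 (pi2 z))) \<and> u (pair (pi1 z) (pi2 (pi2 z))))"
      by (intro dec_conj dec_comp[OF t(1)] dec_comp[OF u(1)] computable_intros)
    show "P x \<and> Q x \<longleftrightarrow> (\<exists>s. t (pair (pi1 (pair x s)) (pi1 (pi2 (pair x s)))) \<and>
      u (pair (pi1 (pair x s)) (pi2 (pi2 (pair x s)))))" for x
      unfolding t(2) u(2) by simp (metis pi1_pair pi2_pair)
  qed
qed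

lemma sigma1_disj: assumes "sigma1 P" "sigma1 Q" shows "sigma1 (\<lambda>x. P x \<or> Q x)"
proof -
  obtain t u where t: "dec t" "\<And>x. P x \<longleftrightarrow> (\<exists>s. t (pair x s))"
    and u: "dec u" "\<And>x. Q x \<longleftrightarrow> (\<exists>s. u (pair x s))"
    using assms unfolding sigma1_def by blast
  show ?thesis
    by (rule sigma1I[of "\<lambda>z. t z \<or> u z"]) (auto simp: t u intro: dec_disj)
qed

lemma sigma1_ex: assumes "sigma1 (\<lambda>z. P (pi1 z) (pi2 z))" shows "sigma1 (\<lambda>x. \<exists>y. P x y)"
proof -
  obtain t where t: "dec t" "\<And>z. P (pi1 z) (pi2 z) \<longleftrightarrow> (\<exists>s. t (pair z s))"
    using assms unfolding sigma1_def by blast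
  have t': "P x y \<longleftrightarrow> (\<exists>s. t (pair (pair x y) s))" for x y
    using t(2)[of "pair x y"] by simp
  show ?thesis
  proof (rule sigma1I)
    show "dec (\<lambda>z. t (pair (pair (pi1 z) (pi1 (pi2 z))) (pi2 (pi2 z))))"
      by (intro dec_comp[OF t(1)] computable_intros)
    show "(\<exists>y. P x y) \<longleftrightarrow> (\<exists>s. t (pair (pair (pi1 (pair x s)) (pi1 (pi2 (pair x s)))) (pi2 (pi2 (pair x s)))))" for x
      unfolding t' by simp (metis pi1_pair pi2_pair)
  qed
qed

lemma sigma1_imp: "dec P \<Longrightarrow> sigma1 Q \<Longrightarrow> sigma1 (\<lambda>x. P x \<longrightarrow> Q x)"
  using sigma1_disj[OF sigma1_dec[OF dec_not[of P]], of Q] by simp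

text \<open>Finitely many witnesses below \<open>b x\<close> have a common bound, so no coding of sequences is needed.\<close>

lemma sigma1_ball:
  assumes "sigma1 (\<lambda>z. P (pi1 z) (pi2 z))" "computable b"
  shows "sigma1 (\<lambda>x. \<forall>y<b x. P x y)"
proof -
  obtain t where t: "dec t" "\<And>z. P (pi1 z) (pi2 z) \<longleftrightarrow> (\<exists>s. t (pair z s))"
    using assms unfolding sigma1_def by blast
  have t': "P x y \<longleftrightarrow> (\<exists>s. t (pair (pair x y) s))" for x y
    using t(2)[of "pair x y"] by simp
  show ?thesis
  proof (rule sigma1I)
    show "dec (\<lambda>z. \<forall>y<b (pi1 z). \<exists>s<pi2 z. t (pair (pair (pi1 z) y) s))"
      by (intro dec_ball dec_bex dec_comp[OF t(1)] computable_comp[OF assms(2)] computable_intros)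
    show "(\<forall>y<b x. P x y) \<longleftrightarrow> (\<exists>s. \<forall>y<b (pi1 (pair x s)). \<exists>s'<pi2 (pair x s). t (pair (pair (pi1 (pair x s)) y) s'))" for x
    proof
      assume "\<forall>y<b x. P x y"
      then obtain w where w: "\<And>y. y < b x \<Longrightarrow> t (pair (pair x y) (w y))"
        unfolding t' by metis
      have "w y < Suc (Max (w ` {..<b x}))" if "y < b x" for y
        using that by (simp add: less_Suc_eq_le)
      with w show "\<exists>s. \<forall>y<b (pi1 (pair x s)). \<exists>s'<pi2 (pair x s). t (pair (pair (pi1 (pair x s)) y) s')"
        by simp blast
    qed (auto simp: t')
  qed
qed

lemmas sigma1_intros = sigma1_conj sigma1_disj sigma1_ex sigma1_ball

section \<open>Coded lists, and enumerability of the graphs of programs\<close>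

definition drop_code :: "nat \<Rightarrow> nat \<Rightarrow> nat" where
  "drop_code l i = rec_nat l (\<lambda>_ y. pi2 (y - 1)) i"

text \<open>\<open>list_encode (x # xs)\<close> is the successor of a pair, so subtracting 1
  uncovers head and tail. Access by position lets the intermediate values of a
  \<open>PrimRec\<close> computation be stored in one number.\<close>

definition nth_code :: "nat \<Rightarrow> nat \<Rightarrow> nat" where
  "nth_code l i = pi1 (drop_code l i - 1)"

lemma computable_nth_code: "computable f \<Longrightarrow> computable g \<Longrightarrow> computable (\<lambda>x. nth_code (f x) (g x))"
  unfolding nth_code_def drop_code_def
  using computable_rec[of f "\<lambda>z. pi2 (pi2 (pi2 z) - 1)" g, simplified pi2_pair]
  by (intro computable_intros) (simp add: computable_intros del: One_nat_def)

lemma list_decode_Suc_pair [simp]: "list_decode (Suc (pair x c)) = x # list_decode c"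
  by simp

lemma drop_code_Suc: "drop_code (Suc (pair x c)) (Suc i) = drop_code c i"
  unfolding drop_code_def by (induction i) auto

lemma nth_code_list_encode: "i < length xs \<Longrightarrow> nth_code (list_encode xs) i = xs ! i"
proof (induction xs arbitrary: i)
  case (Cons x xs)
  then show ?case
    by (cases i) (auto simp: nth_code_def drop_code_Suc pair_def[symmetric], simp add: drop_code_def)
qed simp

lemma list_decode_eq_Cons_iff: "list_decode c = x # xs \<longleftrightarrow> (\<exists>d. c = Suc (pair x d) \<and> list_decode d = xs)"
  by (metis list_decode_Suc_pair list_encode_inverse list_decode_inverse list_encode.simps(2) pair_def)

lemma list_decode_eq_Nil_iff: "list_decode c = [] \<longleftrightarrow> c = 0"
  by (metis list_decode.simps(1) list_decode_inverse)

text \<open>Arguments come as a list code, so that one statement covers all arities and induction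
  over programs goes through. Each program is treated separately, without a universal
  machine.\<close>

definition enumerable_graph :: "recf \<Rightarrow> bool" where
  "enumerable_graph f \<longleftrightarrow> sigma1 (\<lambda>z. computes f (list_decode (pi1 z)) (pi2 z))"

lemma enumerable_graphD:
  "enumerable_graph f \<Longrightarrow> computable g \<Longrightarrow> computable h \<Longrightarrow> sigma1 (\<lambda>x. computes f (list_decode (g x)) (h x))"
  unfolding enumerable_graph_def using sigma1_comp[of _ "\<lambda>x. pair (g x) (h x)"]
  by (fastforce intro: computable_intros)

lemma enumerable_graph_Proj: "enumerable_graph (Proj i)"
proof -
  have "sigma1 (\<lambda>z. i < length (list_decode (pi1 z)) \<and> pi2 z = list_decode (pi1 z) ! i)"
  proof (induction i)
    case 0
    have "sigma1 (\<lambda>z. \<exists>d. pi1 z = Suc (pair (pi2 z) d))"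
      by (intro sigma1_intros sigma1_dec dec_intros computable_intros)
    moreover have "(\<exists>d. pi1 z = Suc (pair (pi2 z) d)) \<longleftrightarrow>
      0 < length (list_decode (pi1 z)) \<and> pi2 z = list_decode (pi1 z) ! 0" for z
      by (cases "list_decode (pi1 z)") (auto simp: list_decode_eq_Cons_iff list_decode_eq_Nil_iff)
    ultimately show ?case by simp
  next
    case (Suc i)
    have "sigma1 (\<lambda>z. \<exists>x d. pi1 z = Suc (pair x d) \<and>
      i < length (list_decode (pi1 (pair d (pi2 z)))) \<and> pi2 (pair d (pi2 z)) = list_decode (pi1 (pair d (pi2 z))) ! i)"
      by (intro sigma1_ex sigma1_conj[OF sigma1_dec sigma1_comp[OF Suc]] dec_intros computable_intros)
    moreover have "(\<exists>x d. pi1 z = Suc (pair x d) \<and> i < length (list_decode d) \<and> pi2 z = list_decode d ! i) \<longleftrightarrow>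
      Suc i < length (list_decode (pi1 z)) \<and> pi2 z = list_decode (pi1 z) ! Suc i" for z
      by (cases "list_decode (pi1 z)") (auto simp: list_decode_eq_Cons_iff list_decode_eq_Nil_iff)
    ultimately show ?case by simp
  qed
  moreover have "computes (Proj i) xs y \<longleftrightarrow> i < length xs \<and> y = xs ! i" for xs y
    by (auto elim: computes.cases intro: computes.proj)
  ultimately show ?thesis by (simp add: enumerable_graph_def)
qed

lemma enumerable_graph_Comp:
  assumes "enumerable_graph f" "\<And>h. h \<in> set hs \<Longrightarrow> enumerable_graph h"
  shows "enumerable_graph (Comp f hs)"
proof -
  have "sigma1 (\<lambda>z. list_all2 (\<lambda>h y. computes h (list_decode (pi1 z)) y) hs (list_decode (pi2 z)))"
    using assms(2)
  proof (induction hs)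
    case Nil
    then show ?case by (simp add: list_decode_eq_Nil_iff sigma1_dec dec_intros computable_intros)
  next
    case (Cons h hs)
    have "sigma1 (\<lambda>z. \<exists>v d. pi2 z = Suc (pair v d) \<and> computes h (list_decode (pi1 z)) v \<and>
      list_all2 (\<lambda>h y. computes h (list_decode (pi1 (pair (pi1 z) d))) y) hs (list_decode (pi2 (pair (pi1 z) d))))"
      using Cons.prems
      by (intro sigma1_ex sigma1_conj[OF sigma1_dec sigma1_conj[OF enumerable_graphD sigma1_comp[OF Cons.IH]]]
          dec_intros computable_intros) auto
    moreover have "(\<exists>v d. pi2 z = Suc (pair v d) \<and> computes h (list_decode (pi1 z)) v \<and>
      list_all2 (\<lambda>h y. computes h (list_decode (pi1 z)) y) hs (list_decode d)) \<longleftrightarrow>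
      list_all2 (\<lambda>h y. computes h (list_decode (pi1 z)) y) (h # hs) (list_decode (pi2 z))" for z
      by (auto simp: list_all2_Cons1 list_decode_eq_Cons_iff)
    ultimately show ?case by simp
  qed
  then have hs: "computable k \<Longrightarrow> sigma1 (\<lambda>x. list_all2 (\<lambda>h y. computes h (list_decode (pi1 (k x))) y) hs (list_decode (pi2 (k x))))"
    for k by (rule sigma1_comp)
  have "sigma1 (\<lambda>z. \<exists>ys. list_all2 (\<lambda>h y. computes h (list_decode (pi1 (pair (pi1 z) ys))) y) hs
      (list_decode (pi2 (pair (pi1 z) ys))) \<and> computes f (list_decode ys) (pi2 z))"
    by (intro sigma1_ex sigma1_conj[OF hs enumerable_graphD] assms(1) computable_intros)
  moreover have "(\<exists>ys. list_all2 (\<lambda>h y. computes h xs y) hs (list_decode ys) \<and> computes f (list_decode ys) y)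
    \<longleftrightarrow> computes (Comp f hs) xs y" for xs y
    by (auto intro: computes.comp elim!: computes.cases[of "Comp f hs"]) (metis list_encode_inverse)
  ultimately show ?thesis by (simp add: enumerable_graph_def)
qed

text \<open>Replaces the recursion by a sequence \<open>v\<close> of intermediate values: an
  existential and a bounded universal quantifier, both of which \<open>sigma1\<close>
  admits.\<close>

lemma computes_PrimRec_iff:
  "computes (PrimRec f h) xs y \<longleftrightarrow> (\<exists>n ys v. xs = n # ys \<and> computes f ys (v 0) \<and>
    (\<forall>i<n. computes h (i # v i # ys) (v (Suc i))) \<and> v n = y)"
proof
  show "\<exists>n ys v. xs = n # ys \<and> computes f ys (v 0) \<and>
    (\<forall>i<n. computes h (i # v i # ys) (v (Suc i))) \<and> v n = y" if "computes (PrimRec f h) xs y"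
    using that
  proof (induction "PrimRec f h" xs y rule: computes.induct)
    case (primrec_0 ys y)
    then show ?case by (intro exI[of _ 0] exI[of _ ys] exI[of _ "\<lambda>_. y"]) auto
  next
    case (primrec_Suc n xs y z)
    then obtain v where v: "computes f xs (v 0)" "\<And>i. i < n \<Longrightarrow> computes h (i # v i # xs) (v (Suc i))" "v n = y"
      by auto
    then show ?case
      using primrec_Suc.hyps(3)
      by (intro exI[of _ "Suc n"] exI[of _ xs] exI[of _ "v(Suc n := z)"]) (auto simp: less_Suc_eq)
  qed
next
  assume "\<exists>n ys v. xs = n # ys \<and> computes f ys (v 0) \<and>
    (\<forall>i<n. computes h (i # v i # ys) (v (Suc i))) \<and> v n = y"
  then obtain n ys v where v: "xs = n # ys" "computes f ys (v 0)"
    "\<forall>i<n. computes h (i # v i # ys) (v (Suc i))" "v n = y" by blast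
  have "i \<le> n \<Longrightarrow> computes (PrimRec f h) (i # ys) (v i)" for i
    by (induction i) (use v in \<open>auto intro: computes.primrec_0 computes.primrec_Suc\<close>)
  then show "computes (PrimRec f h) xs y" using v by auto
qed

lemma enumerable_graph_PrimRec:
  assumes "enumerable_graph f" "enumerable_graph h"
  shows "enumerable_graph (PrimRec f h)"
proof -
  have "sigma1 (\<lambda>z. \<exists>n d l. pi1 z = Suc (pair n d) \<and> computes f (list_decode d) (nth_code l 0) \<and>
    (\<forall>i<n. computes h (list_decode (Suc (pair i (Suc (pair (nth_code l i) d))))) (nth_code l (Suc i))) \<and>
    nth_code l n = pi2 z)"
    by (intro sigma1_intros sigma1_dec[OF dec_eq] enumerable_graphD assms computable_nth_code computable_intros)
  moreover have "(\<exists>n d l. pi1 z = Suc (pair n d) \<and> computes f (list_decode d) (nth_code l 0) \<and>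
    (\<forall>i<n. computes h (list_decode (Suc (pair i (Suc (pair (nth_code l i) d))))) (nth_code l (Suc i))) \<and>
    nth_code l n = pi2 z) \<longleftrightarrow> computes (PrimRec f h) (list_decode (pi1 z)) (pi2 z)" for z
  proof
    assume "computes (PrimRec f h) (list_decode (pi1 z)) (pi2 z)"
    then obtain n ys v where v: "list_decode (pi1 z) = n # ys" "computes f ys (v 0)"
      "\<forall>i<n. computes h (i # v i # ys) (v (Suc i))" "v n = pi2 z"
      unfolding computes_PrimRec_iff by blast
    define l where "l = list_encode (map v [0..<Suc n])"
    have l: "nth_code l i = v i" if "i \<le> n" for i
      using nth_code_list_encode[of i "map v [0..<Suc n]"] that
      by (simp add: l_def less_Suc_eq_le del: upt_Suc)
    obtain d where "pi1 z = Suc (pair n d)" "list_decode d = ys"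
      using v(1) by (auto simp: list_decode_eq_Cons_iff)
    then show "\<exists>n d l. pi1 z = Suc (pair n d) \<and> computes f (list_decode d) (nth_code l 0) \<and>
      (\<forall>i<n. computes h (list_decode (Suc (pair i (Suc (pair (nth_code l i) d))))) (nth_code l (Suc i))) \<and>
      nth_code l n = pi2 z"
      using v(2-) by (intro exI[of _ n] exI[of _ d] exI[of _ l]) (auto simp: l)
  qed (force simp: computes_PrimRec_iff)
  ultimately show ?thesis by (simp add: enumerable_graph_def)
qed

lemma enumerable_graph_Mu:
  assumes "enumerable_graph f"
  shows "enumerable_graph (Mu f)"
proof -
  have "sigma1 (\<lambda>z. computes f (list_decode (Suc (pair (pi2 z) (pi1 z)))) 0 \<and>
    (\<forall>m<pi2 z. \<exists>y. computes f (list_decode (Suc (pair m (pi1 z)))) (Suc y)))"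
    by (intro sigma1_intros enumerable_graphD assms computable_intros)
  moreover have "computes f (n # xs) 0 \<and> (\<forall>m<n. \<exists>y. computes f (m # xs) (Suc y)) \<longleftrightarrow> computes (Mu f) xs n" for xs n
    by (auto intro: computes.mu elim: computes.cases)
  ultimately show ?thesis by (simp add: enumerable_graph_def)
qed

lemma enumerable_graph: "enumerable_graph f"
proof (induction f)
  case Zero
  have "computes Zero xs y \<longleftrightarrow> y = 0" for xs y
    by (auto elim: computes.cases intro: computes.zero)
  then show ?case by (simp add: enumerable_graph_def sigma1_dec dec_intros computable_intros)
next
  case Succ
  have "sigma1 (\<lambda>z. \<exists>x. pi1 z = Suc (pair x 0) \<and> pi2 z = Suc x)"
    by (intro sigma1_ex sigma1_dec dec_intros computable_intros)
  moreover have "computes Succ xs y \<longleftrightarrow> (\<exists>x. xs = [x] \<and> y = Suc x)" for xs y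
    by (auto elim: computes.cases intro: computes.succ)
  ultimately show ?case
    by (simp add: enumerable_graph_def list_decode_eq_Cons_iff list_decode_eq_Nil_iff)
qed (auto intro: enumerable_graph_Proj enumerable_graph_Comp enumerable_graph_PrimRec enumerable_graph_Mu)

text \<open>One direction projects the enumerable graph of a program to its arguments; the other
  lets \<open>Mu\<close> search for the least witness.\<close>

lemma ce_iff_sigma1: "ce W \<longleftrightarrow> sigma1 (\<lambda>x. x \<in> W)"
proof
  assume "ce W"
  then obtain f where f: "\<And>x. x \<in> W \<longleftrightarrow> (\<exists>y. computes f [x] y)"
    unfolding ce_def partial_computable_def dom_def by fastforce
  have "sigma1 (\<lambda>x. \<exists>y. computes f (list_decode (Suc (pair x 0))) y)"
    by (intro sigma1_ex enumerable_graphD[OF enumerable_graph] computable_intros)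
  then show "sigma1 (\<lambda>x. x \<in> W)" by (simp add: f)
next
  assume "sigma1 (\<lambda>x. x \<in> W)"
  then obtain t where t: "dec t" "\<And>x. x \<in> W \<longleftrightarrow> (\<exists>s. t (pair x s))"
    unfolding sigma1_def by blast
  \<comment> \<open>The witness comes first because \<open>Mu\<close> puts its search variable in
    front of the arguments.\<close>
  have "computable2 (\<lambda>s x. if t (pair x s) then 0 else 1)"
    using computable2_comp1[OF t(1)[unfolded dec_def] computable2_comp[OF computable2_pair computable2_snd computable2_fst]] .
  then obtain p where "total_prog 2 p (\<lambda>xs. if t (pair (xs ! 1) (xs ! 0)) then 0 else 1)"
    unfolding computable2_def by blast
  then have p: "computes p [s, x] (if t (pair x s) then 0 else 1)" for s x
    unfolding total_prog_def by (auto dest: spec[of _ "[s, x]"])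
  have p0: "computes p [s, x] 0 \<longleftrightarrow> t (pair x s)" and p1: "(\<exists>y. computes p [s, x] (Suc y)) \<longleftrightarrow> \<not> t (pair x s)" for s x
    using p[of s x] computes_functional[OF p[of s x]] by (auto split: if_splits)
  define \<phi> where "\<phi> x = (if x \<in> W then Some (LEAST s. t (pair x s)) else None)" for x
  have "\<phi> x = Some y \<longleftrightarrow> computes (Mu p) [x] y" for x y
  proof -
    have "computes (Mu p) [x] y \<longleftrightarrow> t (pair x y) \<and> (\<forall>m<y. \<not> t (pair x m))"
      by (subst computes.simps) (simp add: p0 p1)
    also have "\<dots> \<longleftrightarrow> \<phi> x = Some y"
      unfolding \<phi>_def t(2)
      by (auto intro: LeastI dest: not_less_Least intro!: Least_equality) (meson not_le)
    finally show ?thesis by simp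
  qed
  then have "partial_computable \<phi>" unfolding partial_computable_def by blast
  moreover have "W = dom \<phi>" by (auto simp: \<phi>_def dom_def)
  ultimately show "ce W" unfolding ce_def by blast
qed

section \<open>Canonical indices of finite sets\<close>

lemma computable_div_mod_2: "computable (\<lambda>n. pair (n div 2) (n mod 2))"
proof -
  \<comment> \<open>The state holds quotient and parity of the counter; parity 1 rolls over into the
    next quotient.\<close>
  have "computable (\<lambda>n. rec_nat (pair 0 0) (\<lambda>i s. (\<lambda>z. if pi2 (pi2 (pi2 z)) = 0
      then pair (pi1 (pi2 (pi2 z))) 1 else pair (Suc (pi1 (pi2 (pi2 z)))) 0) (pair n (pair i s))) n)"
    by (intro computable_rec computable_if0 computable_intros)
  moreover have "rec_nat (pair 0 0) (\<lambda>i s. if pi2 s = 0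
      then pair (pi1 s) 1 else pair (Suc (pi1 s)) 0) n = pair (n div 2) (n mod 2)" for n
    by (induction n) (auto simp: mod_Suc div_Suc)
  ultimately show ?thesis by (simp del: One_nat_def cong: if_cong)
qed

lemma dec_set_decode:
  assumes "computable f" "computable g"
  shows "dec (\<lambda>x. f x \<in> set_decode (g x))"
proof -
  have "computable (\<lambda>z. pi1 (pair (z div 2) (z mod 2)))" "computable (\<lambda>z. pi2 (pair (z div 2) (z mod 2)))"
    by (rule computable_pi1[OF computable_div_mod_2] computable_pi2[OF computable_div_mod_2])+
  then have half: "computable (\<lambda>z. z div 2)" and mod: "computable (\<lambda>z. z mod 2)" by simp_all
  have "computable (\<lambda>x. rec_nat (g x) (\<lambda>i y. (\<lambda>z. pi2 (pi2 z) div 2) (pair x (pair i y))) (f x))"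
    by (intro computable_rec assms computable_comp[OF half] computable_intros)
  moreover have "rec_nat n (\<lambda>i y. y div 2) m = n div 2 ^ m" for n m :: nat
    by (induction m) (auto simp: div_mult2_eq[symmetric] mult.commute)
  ultimately have "computable (\<lambda>x. (g x div 2 ^ f x) mod 2)"
    using computable_comp[OF mod] by simp
  from dec_eq[OF this computable_const[of 1]] show ?thesis
    by (simp add: set_decode_def odd_iff_mod_2_eq_one)
qed

lemma dec_finite: "finite S \<Longrightarrow> computable f \<Longrightarrow> dec (\<lambda>x. f x \<in> S)"
  by (induction S rule: finite_induct) (simp_all add: dec_const dec_disj dec_eq computable_const)

text \<open>Turns quantifiers over a canonical finite set into numerical quantifiers bounded by its
  index.\<close>

lemma less_if_mem_set_decode: "y \<in> set_decode u \<Longrightarrow> y < u"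
proof (rule ccontr)
  assume "y \<in> set_decode u" "\<not> y < u"
  then have "u < 2 ^ y" by (meson less_exp not_le order_le_less_trans not_less)
  with \<open>y \<in> set_decode u\<close> show False by (simp add: set_decode_def)
qed

lemma dec_Ball_set_decode:
  assumes "dec (\<lambda>z. P (pi1 z) (pi2 z))" "computable f"
  shows "dec (\<lambda>x. \<forall>y\<in>set_decode (f x). P x y)"
proof -
  have "dec (\<lambda>x. \<forall>y<f x. y \<in> set_decode (f x) \<longrightarrow> P x y)"
    by (intro dec_ball dec_imp dec_set_decode assms computable_comp[OF assms(2)] computable_intros)
  moreover have "(\<forall>y<f x. y \<in> set_decode (f x) \<longrightarrow> P x y) \<longleftrightarrow> (\<forall>y\<in>set_decode (f x). P x y)" for x
    using less_if_mem_set_decode by blast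
  ultimately show ?thesis by simp
qed

lemma sigma1_Ball_set_decode:
  assumes "sigma1 (\<lambda>z. P (pi1 z) (pi2 z))" "computable f"
  shows "sigma1 (\<lambda>x. \<forall>y\<in>set_decode (f x). P x y)"
proof -
  have "sigma1 (\<lambda>x. \<forall>y<f x. y \<in> set_decode (f x) \<longrightarrow> P x y)"
    by (intro sigma1_ball sigma1_imp dec_set_decode assms computable_comp[OF assms(2)] computable_intros)
  moreover have "(\<forall>y<f x. y \<in> set_decode (f x) \<longrightarrow> P x y) \<longleftrightarrow> (\<forall>y\<in>set_decode (f x). P x y)" for x
    using less_if_mem_set_decode by blast
  ultimately show ?thesis by simp
qed

section \<open>Closure properties of enumeration operators\<close>

text \<open>Writing an operator as a predicate in oracle and input lets it be built with logical
  connectives, and the closure properties below become introduction rules.\<close>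

definition eop :: "(nat set \<Rightarrow> nat \<Rightarrow> bool) \<Rightarrow> bool" where
  "eop P \<longleftrightarrow> e_operator (\<lambda>A. {x. P A x})"

lemma finite_set_decode_ex: "finite A \<Longrightarrow> \<exists>u. set_decode u = A"
  using set_encode_inverse by blast

text \<open>Continuity reduces an operator to its values on canonical finite sets; all that remains
  is that these values be uniformly c.e.\<close>

lemma eop_iff:
  "eop P \<longleftrightarrow> (\<forall>A x. P A x \<longleftrightarrow> (\<exists>u. set_decode u \<subseteq> A \<and> P (set_decode u) x)) \<and>
    sigma1 (\<lambda>z. P (set_decode (pi2 z)) (pi1 z))"
proof
  assume "eop P"
  then obtain W where W: "ce W" "\<And>A x. P A x \<longleftrightarrow> (\<exists>u. pair x u \<in> W \<and> set_decode u \<subseteq> A)"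
    unfolding eop_def e_operator_def pair_def by (auto simp: set_eq_iff)
  have "sigma1 (\<lambda>z. \<exists>u. pair (pi1 z) u \<in> W \<and> (\<forall>y\<in>set_decode u. y \<in> set_decode (pi2 z)))"
    using W(1)[unfolded ce_iff_sigma1]
    by (intro sigma1_ex sigma1_conj sigma1_dec[OF dec_Ball_set_decode] dec_set_decode computable_intros)
      (erule sigma1_comp, intro computable_intros)
  then show "(\<forall>A x. P A x \<longleftrightarrow> (\<exists>u. set_decode u \<subseteq> A \<and> P (set_decode u) x)) \<and>
    sigma1 (\<lambda>z. P (set_decode (pi2 z)) (pi1 z))"
    unfolding W(2) by (auto simp: subset_eq)
next
  assume *: "(\<forall>A x. P A x \<longleftrightarrow> (\<exists>u. set_decode u \<subseteq> A \<and> P (set_decode u) x)) \<and>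
    sigma1 (\<lambda>z. P (set_decode (pi2 z)) (pi1 z))"
  then have P: "P A x \<longleftrightarrow> (\<exists>u. set_decode u \<subseteq> A \<and> P (set_decode u) x)" for A x by blast
  show "eop P"
    unfolding eop_def e_operator_def pair_def[symmetric]
  \<comment> \<open>The largest choice of axioms: all \<open>pair x u\<close> for which
    \<open>set_decode u\<close> already yields \<open>x\<close>.\<close>
  proof (intro exI[of _ "{z. P (set_decode (pi2 z)) (pi1 z)}"] conjI allI)
    show "ce {z. P (set_decode (pi2 z)) (pi1 z)}"
      unfolding ce_iff_sigma1 mem_Collect_eq using * by (rule conjunct2)
    show "{x. P A x} = {x. \<exists>u. pair x u \<in> {z. P (set_decode (pi2 z)) (pi1 z)} \<and> set_decode u \<subseteq> A}" for A
      by (subst P) auto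
  qed
qed

lemma eopI:
  assumes "sigma1 (\<lambda>z. P (set_decode (pi2 z)) (pi1 z))"
    "\<And>A B x. P A x \<Longrightarrow> A \<subseteq> B \<Longrightarrow> P B x"
    "\<And>A x. P A x \<Longrightarrow> \<exists>F\<subseteq>A. finite F \<and> P F x"
  shows "eop P"
  unfolding eop_iff
proof (intro conjI allI)
  fix A x
  show "P A x \<longleftrightarrow> (\<exists>u. set_decode u \<subseteq> A \<and> P (set_decode u) x)"
    using assms(2)[of _ x A] assms(3)[of A x] finite_set_decode_ex by blast
qed (rule assms(1))

lemma eop_sigma1_graph: "eop P \<Longrightarrow> sigma1 (\<lambda>z. P (set_decode (pi2 z)) (pi1 z))"
  unfolding eop_iff by (rule conjunct2)

lemma eop_continuous: "eop P \<Longrightarrow> P A x \<longleftrightarrow> (\<exists>u. set_decode u \<subseteq> A \<and> P (set_decode u) x)"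
  unfolding eop_iff by blast

lemma eop_mono: "eop P \<Longrightarrow> P A x \<Longrightarrow> A \<subseteq> B \<Longrightarrow> P B x"
  unfolding eop_iff by (meson order_trans)

lemma eop_finite: "eop P \<Longrightarrow> P A x \<Longrightarrow> \<exists>F\<subseteq>A. finite F \<and> P F x"
  unfolding eop_iff using finite_set_decode by metis

lemma eop_sigma1: "sigma1 P \<Longrightarrow> eop (\<lambda>A. P)"
  by (rule eopI) (auto intro!: sigma1_comp[of P pi1] computable_intros)

lemma eop_mem: "computable f \<Longrightarrow> eop (\<lambda>A x. f x \<in> A)"
proof (rule eopI)
  show "\<exists>F\<subseteq>A. finite F \<and> f x \<in> F" if "f x \<in> A" for A x
    using that by (intro exI[of _ "{f x}"]) auto
qed (auto intro!: sigma1_dec dec_set_decode computable_comp[of f] computable_intros)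

lemma eop_conj: assumes "eop P" "eop Q" shows "eop (\<lambda>A x. P A x \<and> Q A x)"
proof (rule eopI)
  fix A x assume "P A x \<and> Q A x"
  then obtain F G where "F \<subseteq> A" "finite F" "P F x" "G \<subseteq> A" "finite G" "Q G x"
    using eop_finite assms by meson
  then show "\<exists>F\<subseteq>A. finite F \<and> P F x \<and> Q F x"
    by (intro exI[of _ "F \<union> G"]) (auto intro: eop_mono assms)
qed (use assms in \<open>auto intro: sigma1_conj eop_sigma1_graph eop_mono\<close>)

lemma eop_disj: assumes "eop P" "eop Q" shows "eop (\<lambda>A x. P A x \<or> Q A x)"
proof (rule eopI)
  fix A x assume "P A x \<or> Q A x"
  then show "\<exists>F\<subseteq>A. finite F \<and> (P F x \<or> Q F x)"
    using eop_finite assms by meson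
qed (use assms in \<open>auto intro: sigma1_disj eop_sigma1_graph eop_mono\<close>)

lemma eop_ex: assumes "eop (\<lambda>A z. P A (pi1 z) (pi2 z))" shows "eop (\<lambda>A x. \<exists>y. P A x y)"
proof (rule eopI)
  have "sigma1 (\<lambda>z. P (set_decode (pi2 (pair (pair (pi1 (pi1 z)) (pi2 z)) (pi2 (pi1 z)))))
     (pi1 (pi1 (pair (pair (pi1 (pi1 z)) (pi2 z)) (pi2 (pi1 z)))))
     (pi2 (pi1 (pair (pair (pi1 (pi1 z)) (pi2 z)) (pi2 (pi1 z))))))"
    by (rule sigma1_comp[OF eop_sigma1_graph[OF assms]]) (intro computable_intros)
  then show "sigma1 (\<lambda>z. \<exists>y. P (set_decode (pi2 z)) (pi1 z) y)"
    by (intro sigma1_ex) simp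
  show "\<exists>y. P B x y" if "\<exists>y. P A x y" "A \<subseteq> B" for A B x
    using that eop_mono[OF assms, of A "pair x y" B for y] by auto
  show "\<exists>F\<subseteq>A. finite F \<and> (\<exists>y. P F x y)" if ex: "\<exists>y. P A x y" for A x
  proof -
    obtain y where "P A x y" using ex by blast
    then obtain F where "F \<subseteq> A" "finite F" "P F x y"
      using eop_finite[OF assms, of A "pair x y"] by auto
    then show ?thesis by blast
  qed
qed

lemma eop_comp: assumes "eop P" "computable f" shows "eop (\<lambda>A x. P A (f x))"
proof (rule eopI)
  have "sigma1 (\<lambda>z. P (set_decode (pi2 (pair (f (pi1 z)) (pi2 z)))) (pi1 (pair (f (pi1 z)) (pi2 z))))"
    by (rule sigma1_comp[OF eop_sigma1_graph[OF assms(1)]])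
      (intro computable_intros computable_comp[OF assms(2)])
  then show "sigma1 (\<lambda>z. P (set_decode (pi2 z)) (f (pi1 z)))" by simp
  show "P B (f x)" if "P A (f x)" "A \<subseteq> B" for A B x
    using that by (rule eop_mono[OF assms(1)])
  show "\<exists>F\<subseteq>A. finite F \<and> P F (f x)" if "P A (f x)" for A x
    using that by (rule eop_finite[OF assms(1)])
qed

text \<open>Finitely many computations have finite uses, and the union of these is a finite use for
  all of them.\<close>

lemma eop_Ball:
  assumes "eop (\<lambda>A z. P A (pi1 z) (pi2 z))" "computable f"
  shows "eop (\<lambda>A x. \<forall>y\<in>set_decode (f x). P A x y)"
proof (rule eopI)
  have "sigma1 (\<lambda>z. P (set_decode (pi2 (pair (pair (pi1 (pi1 z)) (pi2 z)) (pi2 (pi1 z)))))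
     (pi1 (pi1 (pair (pair (pi1 (pi1 z)) (pi2 z)) (pi2 (pi1 z)))))
     (pi2 (pi1 (pair (pair (pi1 (pi1 z)) (pi2 z)) (pi2 (pi1 z))))))"
    by (rule sigma1_comp[OF eop_sigma1_graph[OF assms(1)]]) (intro computable_intros)
  then show "sigma1 (\<lambda>z. \<forall>y\<in>set_decode (f (pi1 z)). P (set_decode (pi2 z)) (pi1 z) y)"
    by (intro sigma1_Ball_set_decode computable_comp[OF assms(2)] computable_intros) simp
  show "\<forall>y\<in>set_decode (f x). P B x y" if "\<forall>y\<in>set_decode (f x). P A x y" "A \<subseteq> B" for A B x
    using that eop_mono[OF assms(1), of A "pair x y" B for y] by auto
  show "\<exists>F\<subseteq>A. finite F \<and> (\<forall>y\<in>set_decode (f x). P F x y)" if "\<forall>y\<in>set_decode (f x). P A x y" for A x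
  proof -
    have "\<exists>F\<subseteq>A. finite F \<and> P F x y" if "y \<in> set_decode (f x)" for y
      using eop_finite[OF assms(1), of A "pair x y"] that \<open>\<forall>y\<in>set_decode (f x). P A x y\<close> by simp
    then obtain F where F: "\<And>y. y \<in> set_decode (f x) \<Longrightarrow> F y \<subseteq> A \<and> finite (F y) \<and> P (F y) x y"
      by metis
    show ?thesis
    proof (intro exI[of _ "\<Union>y\<in>set_decode (f x). F y"] conjI ballI)
      fix y assume "y \<in> set_decode (f x)"
      then show "P (\<Union>y\<in>set_decode (f x). F y) x y"
        using eop_mono[OF assms(1), of "F y" "pair x y"] F by auto
    qed (use F in auto)
  qed
qed

text \<open>The inner oracle may depend on the input \<open>x\<close> as well as on
  \<open>A\<close>, as happens when finite extensions are read off the input. By continuity a finite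
  part of it can be guessed and verified.\<close>

lemma eop_subst:
  assumes "eop P" "eop (\<lambda>A z. Q A (pi1 z) (pi2 z))"
  shows "eop (\<lambda>A x. P {y. Q A x y} x)"
proof -
  have "eop (\<lambda>A x. \<exists>u. P (set_decode u) x \<and> (\<forall>y\<in>set_decode u. Q A x y))"
    using eop_comp[OF assms(2), of "\<lambda>z. pair (pi1 (pi1 z)) (pi2 z)"]
      sigma1_comp[OF eop_sigma1_graph[OF assms(1)], of "\<lambda>z. pair (pi1 z) (pi2 z)"]
    by (intro eop_ex eop_conj eop_sigma1 eop_Ball computable_intros) (simp_all add: computable_intros)
  moreover have "(\<exists>u. P (set_decode u) x \<and> (\<forall>y\<in>set_decode u. Q A x y)) \<longleftrightarrow> P {y. Q A x y} x" for A x
    by (subst eop_continuous[OF assms(1), of "{y. Q A x y}"]) (auto simp: subset_eq)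
  ultimately show ?thesis by simp
qed

lemma eop_compose: "eop P \<Longrightarrow> eop Q \<Longrightarrow> eop (\<lambda>A. P {y. Q A y})"
  by (rule eop_subst) (auto intro!: eop_comp[of Q pi2] computable_pi2 computable_id)

lemma eop_dec: "dec P \<Longrightarrow> eop (\<lambda>A. P)"
  by (intro eop_sigma1 sigma1_dec)

lemmas eop_intros = eop_conj eop_disj eop_ex eop_mem

section \<open>Enumeration reducibility\<close>

notation e_reducible (infix \<open>\<preceq>\<close> 50)

lemma e_operator_iff_eop: "e_operator \<Phi> \<longleftrightarrow> eop (\<lambda>A x. x \<in> \<Phi> A)"
  by (simp add: eop_def)

lemma e_reducible_iff: "A \<preceq> B \<longleftrightarrow> (\<exists>P. eop P \<and> A = {x. P B x})"
proof
  show "\<exists>P. eop P \<and> A = {x. P B x}" if "A \<preceq> B"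
    using that unfolding e_reducible_def e_operator_iff_eop by (metis Collect_mem_eq)
qed (auto simp: e_reducible_def eop_def)

lemma e_reducibleI: "eop P \<Longrightarrow> (\<And>x. x \<in> A \<longleftrightarrow> P B x) \<Longrightarrow> A \<preceq> B"
  unfolding e_reducible_iff by blast

lemma e_reducible_eop: "A \<preceq> B \<Longrightarrow> eop P \<Longrightarrow> {x. P A x} \<preceq> B"
proof -
  assume "A \<preceq> B" "eop P"
  then obtain Q where "eop Q" "A = {x. Q B x}" unfolding e_reducible_iff by blast
  with \<open>eop P\<close> show ?thesis by (auto intro!: e_reducibleI[OF eop_compose[of P Q]])
qed

lemma e_reducible_refl [simp]: "A \<preceq> A"
  by (rule e_reducibleI[OF eop_mem]) (auto intro: computable_intros)

lemma e_reducible_trans [trans]: "A \<preceq> B \<Longrightarrow> B \<preceq> C \<Longrightarrow> A \<preceq> C"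
  unfolding e_reducible_iff[of A B] by (auto intro: e_reducible_eop)

lemma e_reducible_sigma1: "sigma1 (\<lambda>x. x \<in> A) \<Longrightarrow> A \<preceq> B"
  by (rule e_reducibleI[OF eop_sigma1]) auto

definition osum :: "nat set \<Rightarrow> nat set \<Rightarrow> nat set" (infixl \<open>\<oplus>\<^sub>e\<close> 65) where
  "A \<oplus>\<^sub>e B = pair 0 ` A \<union> pair 1 ` B"

lemma osum_iff [simp]: "pair 0 x \<in> A \<oplus>\<^sub>e B \<longleftrightarrow> x \<in> A" "pair (Suc 0) x \<in> A \<oplus>\<^sub>e B \<longleftrightarrow> x \<in> B"
  by (auto simp: osum_def)

lemma mem_osum_iff: "z \<in> A \<oplus>\<^sub>e B \<longleftrightarrow> (pi1 z = 0 \<and> pi2 z \<in> A \<or> pi1 z = 1 \<and> pi2 z \<in> B)"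
  unfolding osum_def by (auto simp: image_iff) (metis pair_pi)+

lemma osum_mono: "A \<subseteq> A' \<Longrightarrow> B \<subseteq> B' \<Longrightarrow> A \<oplus>\<^sub>e B \<subseteq> A' \<oplus>\<^sub>e B'"
  by (auto simp: osum_def)

lemma e_reducible_osum1: "A \<preceq> A \<oplus>\<^sub>e B"
  by (rule e_reducibleI[OF eop_mem, of "pair 0"]) (auto intro: computable_intros)

lemma e_reducible_osum2: "B \<preceq> A \<oplus>\<^sub>e B"
  by (rule e_reducibleI[OF eop_mem, of "pair 1"]) (auto intro: computable_intros)

lemma osum_least: assumes "A \<preceq> C" "B \<preceq> C" shows "A \<oplus>\<^sub>e B \<preceq> C"
proof -
  obtain P Q where P: "eop P" "A = {x. P C x}" and Q: "eop Q" "B = {x. Q C x}"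
    using assms unfolding e_reducible_iff by blast
  show ?thesis
  proof (rule e_reducibleI)
    show "eop (\<lambda>A z. pi1 z = 0 \<and> P A (pi2 z) \<or> pi1 z = 1 \<and> Q A (pi2 z))"
      by (intro eop_intros eop_dec dec_intros eop_comp[OF P(1)] eop_comp[OF Q(1)] computable_intros)
  qed (auto simp: mem_osum_iff P Q)
qed

lemma e_reducible_Int_dec: "dec (\<lambda>x. x \<in> S) \<Longrightarrow> A \<inter> S \<preceq> A"
  by (rule e_reducibleI[OF eop_conj[OF eop_mem eop_dec]]) (auto intro: computable_intros)

text \<open>Removing the finite, hence decidable, set \<open>F - A\<close> recovers
  \<open>A\<close>. Upward closed classes thus admit finite additions.\<close>

lemma e_reducible_Un_finite:
  assumes "finite F" shows "A \<preceq> A \<union> F"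
proof -
  have "dec (\<lambda>x. x \<in> - (F - A))"
    unfolding Compl_iff using assms by (intro dec_not dec_finite computable_id) auto
  moreover have "(A \<union> F) \<inter> - (F - A) = A" by auto
  ultimately show ?thesis using e_reducible_Int_dec by metis
qed

section \<open>Mass problems\<close>

lemma mem_code_graph: "z \<in> code_graph \<phi> \<longleftrightarrow> \<phi> (pi1 z) = Some (pi2 z)"
  unfolding code_graph_def Map.graph_def pi1_def pi2_def
  by (auto simp: image_iff) (metis prod.collapse prod_decode_inverse)

lemma code_graph_eqI: "(\<And>x y. pair x y \<in> A \<longleftrightarrow> \<phi> x = Some y) \<Longrightarrow> A = code_graph \<phi>"
  unfolding set_eq_iff mem_code_graph by (metis pair_pi)

lemma code_graph_inj: "code_graph \<phi> = code_graph \<psi> \<Longrightarrow> \<phi> = \<psi>"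
proof
  fix x assume "code_graph \<phi> = code_graph \<psi>"
  then have "\<phi> x = Some y \<longleftrightarrow> \<psi> x = Some y" for y
    using mem_code_graph[of "pair x y" \<phi>] mem_code_graph[of "pair x y" \<psi>] by simp
  then show "\<phi> x = \<psi> x" by (metis option.exhaust)
qed

text \<open>Graphs determine partial functions, so the definite description in
  \<open>induced_map\<close> can be eliminated.\<close>

lemma D_le_iff:
  "\<A> \<le>\<^sub>D \<B> \<longleftrightarrow> (\<exists>P. eop P \<and> (\<forall>\<psi>\<in>\<B>. \<exists>\<phi>\<in>\<A>. {x. P (code_graph \<psi>) x} = code_graph \<phi>))"
proof
  assume "\<A> \<le>\<^sub>D \<B>"
  then obtain \<Phi> where \<Phi>: "e_operator \<Phi>" "\<B> \<subseteq> dom (induced_map \<Phi>)" "\<And>\<psi>. \<psi> \<in> \<B> \<Longrightarrow> the (induced_map \<Phi> \<psi>) \<in> \<A>"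
    unfolding D_le_def by blast
  have "\<exists>\<phi>\<in>\<A>. \<Phi> (code_graph \<psi>) = code_graph \<phi>" if \<psi>: "\<psi> \<in> \<B>" for \<psi>
  proof -
    obtain \<phi> where "\<Phi> (code_graph \<psi>) = code_graph \<phi>"
      using subsetD[OF \<Phi>(2) \<psi>] by (auto simp: induced_map_def dom_def split: if_splits)
    moreover from this have "(THE \<phi>. \<Phi> (code_graph \<psi>) = code_graph \<phi>) = \<phi>"
      by (auto intro!: the_equality dest: code_graph_inj)
    ultimately have "induced_map \<Phi> \<psi> = Some \<phi>" unfolding induced_map_def by auto
    with \<Phi>(3)[OF \<psi>] \<open>\<Phi> (code_graph \<psi>) = code_graph \<phi>\<close> show ?thesis by auto
  qed
  then show "\<exists>P. eop P \<and> (\<forall>\<psi>\<in>\<B>. \<exists>\<phi>\<in>\<A>. {x. P (code_graph \<psi>) x} = code_graph \<phi>)"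
    using \<Phi>(1) unfolding e_operator_iff_eop by (intro exI[of _ "\<lambda>A x. x \<in> \<Phi> A"]) simp
next
  assume "\<exists>P. eop P \<and> (\<forall>\<psi>\<in>\<B>. \<exists>\<phi>\<in>\<A>. {x. P (code_graph \<psi>) x} = code_graph \<phi>)"
  then obtain P where P: "eop P" "\<And>\<psi>. \<psi> \<in> \<B> \<Longrightarrow> \<exists>\<phi>\<in>\<A>. {x. P (code_graph \<psi>) x} = code_graph \<phi>" by blast
  have "\<exists>\<phi>\<in>\<A>. induced_map (\<lambda>A. {x. P A x}) \<psi> = Some \<phi>" if \<psi>: "\<psi> \<in> \<B>" for \<psi>
  proof -
    obtain \<phi> where \<phi>: "\<phi> \<in> \<A>" "{x. P (code_graph \<psi>) x} = code_graph \<phi>" using P(2)[OF \<psi>] by blast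
    then have "(THE \<phi>. {x. P (code_graph \<psi>) x} = code_graph \<phi>) = \<phi>"
      by (auto intro!: the_equality dest: code_graph_inj)
    with \<phi> show ?thesis unfolding induced_map_def by auto
  qed
  then show "\<A> \<le>\<^sub>D \<B>"
    unfolding D_le_def using P(1)
    by (intro exI[of _ "\<lambda>A. {x. P A x}"]) (force simp: eop_def dom_def)
qed

lemma D_leI:
  assumes "eop P" "\<And>\<psi>. \<psi> \<in> \<B> \<Longrightarrow> \<exists>\<phi>\<in>\<A>. \<forall>x y. P (code_graph \<psi>) (pair x y) \<longleftrightarrow> \<phi> x = Some y"
  shows "\<A> \<le>\<^sub>D \<B>"
  unfolding D_le_iff using assms(1)
proof (intro exI[of _ P] conjI ballI)
  fix \<psi> assume "\<psi> \<in> \<B>"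
  then obtain \<phi> where "\<phi> \<in> \<A>" "\<forall>x y. P (code_graph \<psi>) (pair x y) \<longleftrightarrow> \<phi> x = Some y"
    using assms(2) by blast
  then show "\<exists>\<phi>\<in>\<A>. {x. P (code_graph \<psi>) x} = code_graph \<phi>"
    by (intro bexI[of _ \<phi>] code_graph_eqI) auto
qed

lemma D_leE:
  assumes "\<A> \<le>\<^sub>D \<B>"
  obtains P f where "eop P" "\<And>\<psi>. \<psi> \<in> \<B> \<Longrightarrow> f \<psi> \<in> \<A>" "\<And>\<psi>. \<psi> \<in> \<B> \<Longrightarrow> {x. P (code_graph \<psi>) x} = code_graph (f \<psi>)"
  using assms unfolding D_le_iff by metis

lemma eop_self: "eop (\<lambda>A x. x \<in> A)"
  by (intro eop_mem computable_intros)

lemma D_le_superset: "\<B> \<subseteq> \<A> \<Longrightarrow> \<A> \<le>\<^sub>D \<B>"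
  unfolding D_le_iff by (intro exI[of _ "\<lambda>A x. x \<in> A"] conjI eop_self) auto

lemma D_le_refl [simp]: "\<A> \<le>\<^sub>D \<A>"
  by (simp add: D_le_superset)

lemma D_le_trans [trans]: assumes "\<A> \<le>\<^sub>D \<B>" "\<B> \<le>\<^sub>D \<C>" shows "\<A> \<le>\<^sub>D \<C>"
proof -
  obtain P f where P: "eop P" "\<And>\<psi>. \<psi> \<in> \<B> \<Longrightarrow> f \<psi> \<in> \<A>" "\<And>\<psi>. \<psi> \<in> \<B> \<Longrightarrow> {x. P (code_graph \<psi>) x} = code_graph (f \<psi>)"
    using D_leE[OF assms(1)] by metis
  obtain Q h where Q: "eop Q" "\<And>\<psi>. \<psi> \<in> \<C> \<Longrightarrow> h \<psi> \<in> \<B>" "\<And>\<psi>. \<psi> \<in> \<C> \<Longrightarrow> {x. Q (code_graph \<psi>) x} = code_graph (h \<psi>)"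
    using D_leE[OF assms(2)] by metis
  show ?thesis
    unfolding D_le_iff
    by (intro exI[of _ "\<lambda>A. P {x. Q A x}"] conjI ballI eop_compose P Q)
      (use P Q in \<open>auto intro!: bexI[of _ "f (h _)"]\<close>)
qed

section \<open>Joins, meets and residuals of mass problems\<close>

definition pjoin :: "pfun \<Rightarrow> pfun \<Rightarrow> pfun" where
  "pjoin \<phi> \<psi> n = (if pi1 n = 0 then \<phi> (pi2 n) else if pi1 n = 1 then \<psi> (pi2 n) else None)"

text \<open>Operators act on graphs, so constructions on partial functions are mirrored by
  constructions on sets.\<close>

definition lpart :: "nat set \<Rightarrow> nat set" where
  "lpart A = {z. pair (pair 0 (pi1 z)) (pi2 z) \<in> A}"

definition rpart :: "nat set \<Rightarrow> nat set" where
  "rpart A = {z. pair (pair 1 (pi1 z)) (pi2 z) \<in> A}"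

definition graph_join :: "nat set \<Rightarrow> nat set \<Rightarrow> nat set" where
  "graph_join A B = {z. pi1 (pi1 z) = 0 \<and> pair (pi2 (pi1 z)) (pi2 z) \<in> A \<or>
    pi1 (pi1 z) = 1 \<and> pair (pi2 (pi1 z)) (pi2 z) \<in> B}"

lemma code_graph_pjoin: "code_graph (pjoin \<phi> \<psi>) = graph_join (code_graph \<phi>) (code_graph \<psi>)"
  by (auto simp: set_eq_iff mem_code_graph pjoin_def graph_join_def)

lemma lpart_graph_join [simp]: "lpart (graph_join A B) = A"
  and rpart_graph_join [simp]: "rpart (graph_join A B) = B"
  by (auto simp: lpart_def rpart_def graph_join_def)

lemma graph_join_mono: "A \<subseteq> A' \<Longrightarrow> B \<subseteq> B' \<Longrightarrow> graph_join A B \<subseteq> graph_join A' B'"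
  by (auto simp: graph_join_def)

lemma eop_lpart: "eop P \<Longrightarrow> eop (\<lambda>A. P (lpart A))"
  and eop_rpart: "eop P \<Longrightarrow> eop (\<lambda>A. P (rpart A))"
  unfolding lpart_def rpart_def by (erule eop_compose; intro eop_mem computable_intros)+

lemma eop_graph_join:
  "eop (\<lambda>A x. x \<in> F A) \<Longrightarrow> eop (\<lambda>A x. x \<in> H A) \<Longrightarrow> eop (\<lambda>A x. x \<in> graph_join (F A) (H A))"
  unfolding graph_join_def mem_Collect_eq
  using eop_comp[of "\<lambda>A x. x \<in> F A" "\<lambda>z. pair (pi2 (pi1 z)) (pi2 z)"]
    eop_comp[of "\<lambda>A x. x \<in> H A" "\<lambda>z. pair (pi2 (pi1 z)) (pi2 z)"]
  by (intro eop_conj eop_disj eop_dec dec_intros computable_intros) (simp_all add: computable_intros)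

lemma eop_compose_set: "eop P \<Longrightarrow> eop (\<lambda>A x. x \<in> F A) \<Longrightarrow> eop (\<lambda>A. P (F A))"
  using eop_compose[of P "\<lambda>A x. x \<in> F A"] by simp

definition Dsup :: "mass_problem \<Rightarrow> mass_problem \<Rightarrow> mass_problem" where
  "Dsup \<A> \<B> = {pjoin \<phi> \<psi> | \<phi> \<psi>. \<phi> \<in> \<A> \<and> \<psi> \<in> \<B>}"

definition Dinf :: "mass_problem \<Rightarrow> mass_problem \<Rightarrow> mass_problem" where
  "Dinf \<A> \<B> = prepend 0 ` \<A> \<union> prepend 1 ` \<B>"

lemma Dsup_ge1: "\<A> \<le>\<^sub>D Dsup \<A> \<B>"
  unfolding D_le_iff
  by (intro exI[of _ "\<lambda>A x. x \<in> lpart A"] conjI eop_lpart eop_self) (auto simp: Dsup_def code_graph_pjoin)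

lemma Dsup_ge2: "\<B> \<le>\<^sub>D Dsup \<A> \<B>"
  unfolding D_le_iff
  by (intro exI[of _ "\<lambda>A x. x \<in> rpart A"] conjI eop_rpart eop_self) (auto simp: Dsup_def code_graph_pjoin)

lemma Dsup_least: assumes "\<A> \<le>\<^sub>D \<C>" "\<B> \<le>\<^sub>D \<C>" shows "Dsup \<A> \<B> \<le>\<^sub>D \<C>"
proof -
  obtain P f where P: "eop P" "\<And>\<psi>. \<psi> \<in> \<C> \<Longrightarrow> f \<psi> \<in> \<A>" "\<And>\<psi>. \<psi> \<in> \<C> \<Longrightarrow> {x. P (code_graph \<psi>) x} = code_graph (f \<psi>)"
    using D_leE[OF assms(1)] by metis
  obtain Q h where Q: "eop Q" "\<And>\<psi>. \<psi> \<in> \<C> \<Longrightarrow> h \<psi> \<in> \<B>" "\<And>\<psi>. \<psi> \<in> \<C> \<Longrightarrow> {x. Q (code_graph \<psi>) x} = code_graph (h \<psi>)"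
    using D_leE[OF assms(2)] by metis
  have "{x. x \<in> graph_join {x. P (code_graph \<psi>) x} {x. Q (code_graph \<psi>) x}} = code_graph (pjoin (f \<psi>) (h \<psi>))"
    if "\<psi> \<in> \<C>" for \<psi>
    using P(3) Q(3) that by (simp add: code_graph_pjoin)
  moreover have "pjoin (f \<psi>) (h \<psi>) \<in> Dsup \<A> \<B>" if "\<psi> \<in> \<C>" for \<psi>
    using P(2) Q(2) that by (auto simp: Dsup_def)
  ultimately show ?thesis
    unfolding D_le_iff
    by (intro exI[of _ "\<lambda>A x. x \<in> graph_join {x. P A x} {x. Q A x}"] conjI eop_graph_join) (auto simp: P(1) Q(1))
qed

lemma Dsup_mono: "\<A> \<le>\<^sub>D \<A>' \<Longrightarrow> \<B> \<le>\<^sub>D \<B>' \<Longrightarrow> Dsup \<A> \<B> \<le>\<^sub>D Dsup \<A>' \<B>'"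
  by (meson D_le_trans Dsup_ge1 Dsup_ge2 Dsup_least)

lemma le_Dsup1: "\<C> \<le>\<^sub>D \<A> \<Longrightarrow> \<C> \<le>\<^sub>D Dsup \<A> \<B>"
  and le_Dsup2: "\<C> \<le>\<^sub>D \<B> \<Longrightarrow> \<C> \<le>\<^sub>D Dsup \<A> \<B>"
  using D_le_trans Dsup_ge1 Dsup_ge2 by blast+

lemma Dsup_commute: "Dsup \<A> \<B> \<le>\<^sub>D Dsup \<B> \<A>"
  by (rule Dsup_least[OF Dsup_ge2 Dsup_ge1])

definition graph_prepend :: "nat \<Rightarrow> nat set \<Rightarrow> nat set" where
  "graph_prepend i A = {z. pi1 z = 0 \<and> pi2 z = i \<or> 0 < pi1 z \<and> pair (pi1 z - 1) (pi2 z) \<in> A}"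

definition graph_tail :: "nat set \<Rightarrow> nat set" where
  "graph_tail A = {z. pair (Suc (pi1 z)) (pi2 z) \<in> A}"

lemma code_graph_prepend: "code_graph (prepend i \<phi>) = graph_prepend i (code_graph \<phi>)"
  by (auto simp: set_eq_iff mem_code_graph prepend_def graph_prepend_def split: nat.split)

lemma graph_tail_prepend [simp]: "graph_tail (graph_prepend i A) = A"
  and pair_0_graph_prepend [simp]: "pair 0 j \<in> graph_prepend i A \<longleftrightarrow> j = i"
  by (auto simp: graph_prepend_def graph_tail_def)

lemma eop_graph_tail: "eop P \<Longrightarrow> eop (\<lambda>A. P (graph_tail A))"
  unfolding graph_tail_def by (erule eop_compose; intro eop_mem computable_intros)

lemma prepend_D_le: "prepend i ` \<A> \<le>\<^sub>D \<A>"
  unfolding D_le_iff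
proof (intro exI[of _ "\<lambda>A x. x \<in> graph_prepend i A"] conjI)
  show "eop (\<lambda>A x. x \<in> graph_prepend i A)"
    unfolding graph_prepend_def mem_Collect_eq
    by (intro eop_conj eop_disj eop_mem eop_dec dec_intros computable_intros)
qed (auto simp: code_graph_prepend)

lemma Dinf_le1: "Dinf \<A> \<B> \<le>\<^sub>D \<A>" and Dinf_le2: "Dinf \<A> \<B> \<le>\<^sub>D \<B>"
  unfolding Dinf_def by (rule D_le_trans[OF D_le_superset prepend_D_le], blast)+

lemma Dinf_greatest: assumes "\<C> \<le>\<^sub>D \<A>" "\<C> \<le>\<^sub>D \<B>" shows "\<C> \<le>\<^sub>D Dinf \<A> \<B>"
proof -
  obtain P f where P: "eop P" "\<And>\<psi>. \<psi> \<in> \<A> \<Longrightarrow> f \<psi> \<in> \<C>" "\<And>\<psi>. \<psi> \<in> \<A> \<Longrightarrow> {x. P (code_graph \<psi>) x} = code_graph (f \<psi>)"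
    using D_leE[OF assms(1)] by metis
  obtain Q h where Q: "eop Q" "\<And>\<psi>. \<psi> \<in> \<B> \<Longrightarrow> h \<psi> \<in> \<C>" "\<And>\<psi>. \<psi> \<in> \<B> \<Longrightarrow> {x. Q (code_graph \<psi>) x} = code_graph (h \<psi>)"
    using D_leE[OF assms(2)] by metis
  show ?thesis
    unfolding D_le_iff
  \<comment> \<open>The operator waits for the value at argument 0 and then runs the reduction for
    that side on the tail.\<close>
  proof (intro exI[of _ "\<lambda>A x. pair 0 0 \<in> A \<and> P (graph_tail A) x \<or> pair 0 1 \<in> A \<and> Q (graph_tail A) x"] conjI ballI)
    show "eop (\<lambda>A x. pair 0 0 \<in> A \<and> P (graph_tail A) x \<or> pair 0 1 \<in> A \<and> Q (graph_tail A) x)"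
      by (intro eop_conj eop_disj eop_graph_tail P Q eop_mem computable_intros)
    fix \<chi> assume "\<chi> \<in> Dinf \<A> \<B>"
    then consider \<phi> where "\<phi> \<in> \<A>" "\<chi> = prepend 0 \<phi>" | \<phi> where "\<phi> \<in> \<B>" "\<chi> = prepend 1 \<phi>"
      unfolding Dinf_def by blast
    then show "\<exists>\<phi>\<in>\<C>. {x. pair 0 0 \<in> code_graph \<chi> \<and> P (graph_tail (code_graph \<chi>)) x \<or>
      pair 0 1 \<in> code_graph \<chi> \<and> Q (graph_tail (code_graph \<chi>)) x} = code_graph \<phi>"
      by cases (use P Q in \<open>auto simp: code_graph_prepend\<close>)
  qed
qed

text \<open>The set \<open>X\<close> as a partial function of the same enumeration degree.\<close>

definition set_pfun :: "nat set \<Rightarrow> pfun" where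
  "set_pfun X n = (if n \<in> X then Some 0 else None)"

lemma mem_code_graph_set_pfun: "z \<in> code_graph (set_pfun X) \<longleftrightarrow> pi1 z \<in> X \<and> pi2 z = 0"
  by (auto simp: mem_code_graph set_pfun_def)

definition enum_app :: "nat set \<Rightarrow> nat set \<Rightarrow> nat set" where
  "enum_app W A = {x. \<exists>u. pair x u \<in> W \<and> set_decode u \<subseteq> A}"

lemma eop_iff_enum_app: "eop P \<longleftrightarrow> (\<exists>W. ce W \<and> (\<forall>A. {x. P A x} = enum_app W A))"
  unfolding eop_def e_operator_def enum_app_def pair_def ..

text \<open>
  An operator is handed over as the partial function \<^term>\<open>set_pfun W\<close> of its c.e. set of axioms
  rather than by an index; evaluation is then uniform without a universal machine.
\<close>

definition Darr :: "mass_problem \<Rightarrow> mass_problem \<Rightarrow> mass_problem" where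
  "Darr \<A> \<B> = {pjoin (set_pfun W) \<phi> | W \<phi>. ce W \<and>
    (\<forall>\<psi>\<in>\<A>. \<exists>\<beta>\<in>\<B>. enum_app W (code_graph (pjoin \<psi> \<phi>)) = code_graph \<beta>)}"

lemma Darr_mp: "\<B> \<le>\<^sub>D Dsup \<A> (Darr \<A> \<B>)"
  unfolding D_le_iff
\<comment> \<open>Here \<open>lpart A\<close> is the solution of the antecedent,
  \<open>lpart (rpart A)\<close> lists the axioms and \<open>rpart (rpart A)\<close> is the side
  information. An axiom \<open>pair x u\<close> fires once \<open>set_decode u\<close> lies in the
  join of the first and the last.\<close>
proof (intro exI[of _ "\<lambda>A x. \<exists>u. pair (pair x u) 0 \<in> lpart (rpart A) \<and>
    (\<forall>y\<in>set_decode u. y \<in> graph_join (lpart A) (rpart (rpart A)))"] conjI ballI)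
  have "eop (\<lambda>A y. y \<in> graph_join (lpart A) (rpart (rpart A)))"
    by (intro eop_graph_join eop_lpart eop_rpart[of "\<lambda>A x. x \<in> rpart A"] eop_rpart eop_self)
  then show "eop (\<lambda>A x. \<exists>u. pair (pair x u) 0 \<in> lpart (rpart A) \<and>
    (\<forall>y\<in>set_decode u. y \<in> graph_join (lpart A) (rpart (rpart A))))"
    by (intro eop_ex eop_conj eop_Ball eop_rpart[of "\<lambda>A x. pair x 0 \<in> lpart A", THEN eop_comp]
        eop_comp[of "\<lambda>A y. y \<in> graph_join (lpart A) (rpart (rpart A))" pi2]
        eop_rpart[of "\<lambda>A x. pair (pair (pi1 x) (pi2 x)) 0 \<in> lpart A"]
        eop_lpart eop_mem computable_intros)
  fix \<chi> assume "\<chi> \<in> Dsup \<A> (Darr \<A> \<B>)"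
  then obtain \<psi> W \<phi> where *: "\<psi> \<in> \<A>" "\<forall>\<psi>\<in>\<A>. \<exists>\<beta>\<in>\<B>. enum_app W (code_graph (pjoin \<psi> \<phi>)) = code_graph \<beta>"
    "\<chi> = pjoin \<psi> (pjoin (set_pfun W) \<phi>)"
    unfolding Dsup_def Darr_def by blast
  then have "{x. \<exists>u. pair (pair x u) 0 \<in> lpart (rpart (code_graph \<chi>)) \<and>
      (\<forall>y\<in>set_decode u. y \<in> graph_join (lpart (code_graph \<chi>)) (rpart (rpart (code_graph \<chi>))))} =
      enum_app W (code_graph (pjoin \<psi> \<phi>))"
    by (simp add: code_graph_pjoin mem_code_graph_set_pfun enum_app_def subset_eq)
  with * show "\<exists>\<phi>\<in>\<B>. {x. \<exists>u. pair (pair x u) 0 \<in> lpart (rpart (code_graph \<chi>)) \<and>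
      (\<forall>y\<in>set_decode u. y \<in> graph_join (lpart (code_graph \<chi>)) (rpart (rpart (code_graph \<chi>))))} =
      code_graph \<phi>"
    by simp
qed

text \<open>Residuation. From right to left, the axioms of the given operator form one fixed c.e.
  set, which an operator can put in front of every solution.\<close>

lemma Darr_le_iff: "Darr \<A> \<B> \<le>\<^sub>D \<C> \<longleftrightarrow> \<B> \<le>\<^sub>D Dsup \<A> \<C>"
proof
  show "\<B> \<le>\<^sub>D Dsup \<A> \<C>" if "Darr \<A> \<B> \<le>\<^sub>D \<C>"
    using D_le_trans[OF Darr_mp Dsup_mono[OF D_le_refl that]] .
next
  assume "\<B> \<le>\<^sub>D Dsup \<A> \<C>"
  then obtain P where "eop P" and "\<forall>\<psi>\<in>Dsup \<A> \<C>. \<exists>\<phi>\<in>\<B>. {x. P (code_graph \<psi>) x} = code_graph \<phi>"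
    unfolding D_le_iff by blast
  then obtain W where W: "ce W" "\<forall>\<psi>\<in>Dsup \<A> \<C>. \<exists>\<phi>\<in>\<B>. enum_app W (code_graph \<psi>) = code_graph \<phi>"
    unfolding eop_iff_enum_app by auto
  show "Darr \<A> \<B> \<le>\<^sub>D \<C>"
    unfolding D_le_iff
  proof (intro exI[of _ "\<lambda>A x. x \<in> graph_join {z. pi1 z \<in> W \<and> pi2 z = 0} A"] conjI ballI)
    have "sigma1 (\<lambda>z. pi1 z \<in> W \<and> pi2 z = 0)"
      using W(1) unfolding ce_iff_sigma1
      by (intro sigma1_conj[OF sigma1_comp[of "\<lambda>x. x \<in> W" pi1] sigma1_dec] dec_intros computable_intros)
    then show "eop (\<lambda>A x. x \<in> graph_join {z. pi1 z \<in> W \<and> pi2 z = 0} A)"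
      by (intro eop_graph_join eop_self) (auto intro: eop_sigma1)
    fix \<phi> assume "\<phi> \<in> \<C>"
    with W have "pjoin (set_pfun W) \<phi> \<in> Darr \<A> \<B>"
      unfolding Darr_def Dsup_def by blast
    moreover have "{x. x \<in> graph_join {z. pi1 z \<in> W \<and> pi2 z = 0} (code_graph \<phi>)} = code_graph (pjoin (set_pfun W) \<phi>)"
      by (simp add: code_graph_pjoin) (auto simp: set_eq_iff graph_join_def mem_code_graph_set_pfun)
    ultimately show "\<exists>\<chi>\<in>Darr \<A> \<B>. {x. x \<in> graph_join {z. pi1 z \<in> W \<and> pi2 z = 0} (code_graph \<phi>)} = code_graph \<chi>"
      by blast
  qed
qed

definition D0 :: mass_problem where
  "D0 = {\<phi>. partial_computable \<phi>}"

lemma D0_le: "D0 \<le>\<^sub>D \<A>"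
proof (rule D_leI)
  show "eop (\<lambda>A z. pi2 z = 0)" by (intro eop_dec dec_intros computable_intros)
  have "computes Zero [x] y \<longleftrightarrow> y = 0" for x y
    by (auto elim: computes.cases intro: computes.zero)
  then have "(\<lambda>x. Some 0) \<in> D0"
    unfolding D0_def partial_computable_def by (auto intro!: exI[of _ Zero])
  then show "\<exists>\<phi>\<in>D0. \<forall>x y. pi2 (pair x y) = 0 \<longleftrightarrow> \<phi> x = Some y" by (auto intro!: bexI)
qed

section \<open>The lattice of degrees below a mass problem\<close>

lemma equiv_D_equiv: "equiv UNIV D_equiv"
  by (rule equivI) (auto simp: refl_on_def sym_def trans_def D_equiv_def intro: D_le_trans)

lemma D_degree_eq_iff: "D_degree \<A> = D_degree \<B> \<longleftrightarrow> \<A> \<le>\<^sub>D \<B> \<and> \<B> \<le>\<^sub>D \<A>"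
  unfolding D_degree_def using eq_equiv_class_iff[OF equiv_D_equiv, of \<A> \<B>] by (simp add: D_equiv_def)

lemma mem_D_degree: "\<B> \<in> D_degree \<A> \<longleftrightarrow> \<A> \<le>\<^sub>D \<B> \<and> \<B> \<le>\<^sub>D \<A>"
  by (simp add: D_degree_def D_equiv_def)

lemma le_D_degree_iff: "D_degree \<A> \<sqsubseteq>\<^bsub>dyment_lattice\<^esub> D_degree \<B> \<longleftrightarrow> \<A> \<le>\<^sub>D \<B>"
proof
  show "D_degree \<A> \<sqsubseteq>\<^bsub>dyment_lattice\<^esub> D_degree \<B>" if "\<A> \<le>\<^sub>D \<B>"
    unfolding dyment_lattice_def gorder.simps
    by (rule bexI[of _ \<A>, OF bexI[of _ \<B>]]) (use that in \<open>simp_all add: mem_D_degree\<close>)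
qed (auto simp: dyment_lattice_def mem_D_degree, meson D_le_trans)

abbreviation below :: "mass_problem \<Rightarrow> mass_problem set gorder" where
  "below Z \<equiv> interval dyment_lattice zero_D (D_degree Z)"

lemma zero_D_eq: "zero_D = D_degree D0"
  by (simp add: zero_D_def D0_def)

lemma carrier_below: "carrier (below Z) = {D_degree \<A> | \<A>. \<A> \<le>\<^sub>D Z}"
proof -
  have "carrier dyment_lattice = range D_degree"
    by (auto simp: dyment_lattice_def quotient_def D_degree_def)
  then show ?thesis
    by (auto simp: interval_def at_least_at_most_def zero_D_eq le_D_degree_iff D0_le)
qed

lemma le_below_iff [simp]: "D_degree \<A> \<sqsubseteq>\<^bsub>below Z\<^esub> D_degree \<B> \<longleftrightarrow> \<A> \<le>\<^sub>D \<B>"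
  using le_D_degree_iff by (simp add: interval_def)

lemma D_degree_in_carrier [simp]: "D_degree \<A> \<in> carrier (below Z) \<longleftrightarrow> \<A> \<le>\<^sub>D Z"
proof
  show "D_degree \<A> \<in> carrier (below Z)" if "\<A> \<le>\<^sub>D Z" using that by (auto simp: carrier_below)
qed (auto simp: carrier_below D_degree_eq_iff intro: D_le_trans)

lemma carrier_belowE:
  assumes "x \<in> carrier (below Z)" obtains \<A> where "x = D_degree \<A>" "\<A> \<le>\<^sub>D Z"
  using assms by (auto simp: carrier_below)

lemma least_belowI:
  assumes "S \<subseteq> carrier (below Z)" "D_degree \<A> \<in> S"
    "\<And>\<B>. \<B> \<le>\<^sub>D Z \<Longrightarrow> D_degree \<B> \<in> S \<Longrightarrow> \<A> \<le>\<^sub>D \<B>"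
  shows "least (below Z) (D_degree \<A>) S"
  unfolding least_def
proof (intro conjI ballI)
  fix x assume "x \<in> S"
  then obtain \<B> where "x = D_degree \<B>" "\<B> \<le>\<^sub>D Z" using assms(1) by (auto simp: carrier_below)
  with assms(3) \<open>x \<in> S\<close> show "D_degree \<A> \<sqsubseteq>\<^bsub>below Z\<^esub> x" by simp
qed (fact assms)+

lemma greatest_belowI:
  assumes "S \<subseteq> carrier (below Z)" "D_degree \<A> \<in> S"
    "\<And>\<B>. \<B> \<le>\<^sub>D Z \<Longrightarrow> D_degree \<B> \<in> S \<Longrightarrow> \<B> \<le>\<^sub>D \<A>"
  shows "greatest (below Z) (D_degree \<A>) S"
  unfolding greatest_def
proof (intro conjI ballI)
  fix x assume "x \<in> S"
  then obtain \<B> where "x = D_degree \<B>" "\<B> \<le>\<^sub>D Z" using assms(1) by (auto simp: carrier_below)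
  with assms(3) \<open>x \<in> S\<close> show "x \<sqsubseteq>\<^bsub>below Z\<^esub> D_degree \<A>" by simp
qed (fact assms)+

lemma partial_order_below: "partial_order (below Z)"
proof
  show "(.=\<^bsub>below Z\<^esub>) = (=)" by (simp add: interval_def dyment_lattice_def)
  then show "x .=\<^bsub>below Z\<^esub> x" "x .=\<^bsub>below Z\<^esub> y \<Longrightarrow> y .=\<^bsub>below Z\<^esub> x"
    "x .=\<^bsub>below Z\<^esub> y \<Longrightarrow> y .=\<^bsub>below Z\<^esub> z \<Longrightarrow> x .=\<^bsub>below Z\<^esub> z"
    "x .=\<^bsub>below Z\<^esub> y \<Longrightarrow> z .=\<^bsub>below Z\<^esub> w \<Longrightarrow> (x \<sqsubseteq>\<^bsub>below Z\<^esub> z) = (y \<sqsubseteq>\<^bsub>below Z\<^esub> w)" for x y z w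
    by auto
  show "x .=\<^bsub>below Z\<^esub> y" if "x \<sqsubseteq>\<^bsub>below Z\<^esub> y" "y \<sqsubseteq>\<^bsub>below Z\<^esub> x" "x \<in> carrier (below Z)" "y \<in> carrier (below Z)" for x y
    using that \<open>(.=\<^bsub>below Z\<^esub>) = (=)\<close>
    by (elim carrier_belowE) (simp add: D_degree_eq_iff)
  show "x \<sqsubseteq>\<^bsub>below Z\<^esub> x" if "x \<in> carrier (below Z)" for x
    using that by (elim carrier_belowE) simp
  show "x \<sqsubseteq>\<^bsub>below Z\<^esub> z" if "x \<sqsubseteq>\<^bsub>below Z\<^esub> y" "y \<sqsubseteq>\<^bsub>below Z\<^esub> z"
    "x \<in> carrier (below Z)" "y \<in> carrier (below Z)" "z \<in> carrier (below Z)" for x y z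
    using that by (elim carrier_belowE) (simp, rule D_le_trans)
qed

lemma least_join_below:
  assumes "\<A> \<le>\<^sub>D Z" "\<B> \<le>\<^sub>D Z"
  shows "least (below Z) (D_degree (Dsup \<A> \<B>)) (Upper (below Z) {D_degree \<A>, D_degree \<B>})"
  by (rule least_belowI)
    (use assms in \<open>auto simp: Upper_def Int_Un_distrib2 intro: Dsup_ge1 Dsup_ge2 Dsup_least\<close>)

lemma greatest_meet_below:
  assumes "\<A> \<le>\<^sub>D Z" "\<B> \<le>\<^sub>D Z"
  shows "greatest (below Z) (D_degree (Dinf \<A> \<B>)) (Lower (below Z) {D_degree \<A>, D_degree \<B>})"
  by (rule greatest_belowI)
    (use assms D_le_trans[OF Dinf_le1] in \<open>auto simp: Lower_def intro: Dinf_le1 Dinf_le2 Dinf_greatest\<close>)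

lemma least_eqI: "partial_order L \<Longrightarrow> least L x S \<Longrightarrow> (SOME y. least L y S) = x"
  by (rule some_equality) (auto intro: partial_order.least_unique)

lemma greatest_eqI: "partial_order L \<Longrightarrow> greatest L x S \<Longrightarrow> (SOME y. greatest L y S) = x"
  by (rule some_equality) (auto intro: partial_order.greatest_unique)

lemma join_below:
  assumes "\<A> \<le>\<^sub>D Z" "\<B> \<le>\<^sub>D Z"
  shows "D_degree \<A> \<squnion>\<^bsub>below Z\<^esub> D_degree \<B> = D_degree (Dsup \<A> \<B>)"
  unfolding join_def sup_def
  by (rule least_eqI[OF partial_order_below least_join_below[OF assms]])

lemma meet_below:
  assumes "\<A> \<le>\<^sub>D Z" "\<B> \<le>\<^sub>D Z"
  shows "D_degree \<A> \<sqinter>\<^bsub>below Z\<^esub> D_degree \<B> = D_degree (Dinf \<A> \<B>)"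
  unfolding meet_def inf_def
  by (rule greatest_eqI[OF partial_order_below greatest_meet_below[OF assms]])

lemma Darr_le: "Darr \<A> \<B> \<le>\<^sub>D \<B>"
  by (simp add: Darr_le_iff Dsup_ge2)

lemma least_arrow_below:
  assumes "\<A> \<le>\<^sub>D Z" "\<B> \<le>\<^sub>D Z"
  shows "least (below Z) (D_degree (Darr \<A> \<B>))
    {c \<in> carrier (below Z). D_degree \<B> \<sqsubseteq>\<^bsub>below Z\<^esub> D_degree \<A> \<squnion>\<^bsub>below Z\<^esub> c}"
  by (rule least_belowI)
    (use assms D_le_trans[OF Darr_le] in \<open>auto simp: join_below Darr_mp Darr_le_iff\<close>)

lemma arrow_below:
  assumes "\<A> \<le>\<^sub>D Z" "\<B> \<le>\<^sub>D Z"
  shows "arrow (below Z) (D_degree \<A>) (D_degree \<B>) = D_degree (Darr \<A> \<B>)"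
  unfolding arrow_def by (rule least_eqI[OF partial_order_below least_arrow_below[OF assms]])

lemma least_bottom_below: "least (below Z) (D_degree D0) (carrier (below Z))"
  by (rule least_belowI) (auto simp: D0_le)

lemma greatest_top_below: "greatest (below Z) (D_degree Z) (carrier (below Z))"
  by (rule greatest_belowI) auto

lemma bottom_below: "\<bottom>\<^bsub>below Z\<^esub> = D_degree D0"
  unfolding bottom_def by (rule least_eqI[OF partial_order_below least_bottom_below])

lemma top_below: "\<top>\<^bsub>below Z\<^esub> = D_degree Z"
  unfolding top_def by (rule greatest_eqI[OF partial_order_below greatest_top_below])

lemma brouwer_algebra_below:
  assumes "\<not> Z \<le>\<^sub>D D0"
  shows "brouwer_algebra (below Z)"
proof -
  interpret partial_order "below Z" by (rule partial_order_below)
  show ?thesis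
  proof
    show "\<exists>s. least (below Z) s (Upper (below Z) {x, y})"
      "\<exists>s. greatest (below Z) s (Lower (below Z) {x, y})"
      "\<exists>c. least (below Z) c {c \<in> carrier (below Z). y \<sqsubseteq>\<^bsub>below Z\<^esub> x \<squnion>\<^bsub>below Z\<^esub> c}"
      if xy: "x \<in> carrier (below Z)" "y \<in> carrier (below Z)" for x y
    proof -
      obtain \<A> \<B> where "x = D_degree \<A>" "\<A> \<le>\<^sub>D Z" "y = D_degree \<B>" "\<B> \<le>\<^sub>D Z"
        using xy by (metis carrier_belowE)
      then show "\<exists>s. least (below Z) s (Upper (below Z) {x, y})"
        "\<exists>s. greatest (below Z) s (Lower (below Z) {x, y})"
        "\<exists>c. least (below Z) c {c \<in> carrier (below Z). y \<sqsubseteq>\<^bsub>below Z\<^esub> x \<squnion>\<^bsub>below Z\<^esub> c}"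
        using least_join_below greatest_meet_below least_arrow_below by blast+
    qed
    show "\<bottom>\<^bsub>below Z\<^esub> \<noteq> \<top>\<^bsub>below Z\<^esub>"
      using assms by (simp add: bottom_below top_below D_degree_eq_iff)
  qed (use least_bottom_below greatest_top_below in blast)+
qed

section \<open>Evaluation of formulas on representatives, and soundness\<close>

primrec mass_val :: "mass_problem \<Rightarrow> (nat \<Rightarrow> mass_problem) \<Rightarrow> form \<Rightarrow> mass_problem" where
  "mass_val Z V (Atom n) = V n"
| "mass_val Z V (Or p q) = Dinf (mass_val Z V p) (mass_val Z V q)"
| "mass_val Z V (And p q) = Dsup (mass_val Z V p) (mass_val Z V q)"
| "mass_val Z V (Imp p q) = Darr (mass_val Z V p) (mass_val Z V q)"
| "mass_val Z V (Neg p) = Darr (mass_val Z V p) Z"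

lemma mass_val_le: "(\<And>n. V n \<le>\<^sub>D Z) \<Longrightarrow> mass_val Z V p \<le>\<^sub>D Z"
  by (induction p) (auto intro: Dsup_least D_le_trans[OF Dinf_le1] D_le_trans[OF Darr_le] Darr_le)

lemma form_val_below:
  assumes "\<And>n. V n \<le>\<^sub>D Z"
  shows "form_val (below Z) (\<lambda>n. D_degree (V n)) p = D_degree (mass_val Z V p)"
  by (induction p) (simp_all add: join_below meet_below arrow_below top_below mass_val_le assms)

text \<open>Representatives can be chosen atom by atom, so from here on validity is a matter of
  \<open>D_le\<close> between mass problems.\<close>

lemma Th_below_iff: "p \<in> Th (below Z) \<longleftrightarrow> (\<forall>V. (\<forall>n. V n \<le>\<^sub>D Z) \<longrightarrow> mass_val Z V p \<le>\<^sub>D D0)"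
proof
  assume p: "p \<in> Th (below Z)"
  show "\<forall>V. (\<forall>n. V n \<le>\<^sub>D Z) \<longrightarrow> mass_val Z V p \<le>\<^sub>D D0"
  proof (intro allI impI)
    fix V :: "nat \<Rightarrow> mass_problem" assume V: "\<forall>n. V n \<le>\<^sub>D Z"
    with p have "form_val (below Z) (\<lambda>n. D_degree (V n)) p = D_degree D0"
      by (simp add: Th_def bottom_below)
    with V show "mass_val Z V p \<le>\<^sub>D D0" by (simp add: form_val_below D_degree_eq_iff)
  qed
next
  assume *: "\<forall>V. (\<forall>n. V n \<le>\<^sub>D Z) \<longrightarrow> mass_val Z V p \<le>\<^sub>D D0"
  show "p \<in> Th (below Z)"
    unfolding Th_def
  proof (intro CollectI allI impI)
    fix v :: "nat \<Rightarrow> mass_problem set" assume "\<forall>n. v n \<in> carrier (below Z)"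
    then have "\<forall>n. \<exists>\<A>. v n = D_degree \<A> \<and> \<A> \<le>\<^sub>D Z" by (auto simp: carrier_below)
    then obtain V where V: "\<And>n. v n = D_degree (V n)" "\<And>n. V n \<le>\<^sub>D Z"
      by metis
    then have "v = (\<lambda>n. D_degree (V n))" by auto
    with V * show "form_val (below Z) v p = \<bottom>\<^bsub>below Z\<^esub>"
      by (simp add: form_val_below bottom_below D_degree_eq_iff D0_le)
  qed
qed

lemma Darr_mpD: "Darr \<A> \<B> \<le>\<^sub>D \<C> \<Longrightarrow> \<A> \<le>\<^sub>D \<C> \<Longrightarrow> \<B> \<le>\<^sub>D \<C>"
  by (meson D_le_trans Darr_mp Dsup_least)

text \<open>The bound is an arbitrary problem, so that residuation can collect the antecedents of an
  axiom in front of it.\<close>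

lemma IPC_sound:
  assumes "p \<in> IPC" "\<And>n. V n \<le>\<^sub>D Z"
  shows "mass_val Z V p \<le>\<^sub>D \<X>"
  using assms(1)
proof (induction arbitrary: \<X> rule: IPC.induct)
  case (K p q)
  show ?case by (auto simp: Darr_le_iff intro: le_Dsup1 le_Dsup2 D_le_refl)
next
  case (S p q r)
  let ?p = "mass_val Z V p" and ?q = "mass_val Z V q" and ?r = "mass_val Z V r"
  let ?Y = "Dsup ?p (Dsup (Darr ?p ?q) (Dsup (Darr ?p (Darr ?q ?r)) \<X>))"
  have "?p \<le>\<^sub>D ?Y" "Darr ?p ?q \<le>\<^sub>D ?Y" "Darr ?p (Darr ?q ?r) \<le>\<^sub>D ?Y"
    by (auto intro: le_Dsup1 le_Dsup2 D_le_refl)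
  then have "?r \<le>\<^sub>D ?Y" by (meson Darr_mpD)
  then show ?case by (simp add: Darr_le_iff)
next
  case (or_elim p r q)
  let ?p = "mass_val Z V p" and ?q = "mass_val Z V q" and ?r = "mass_val Z V r"
  let ?Y = "Dsup (Darr ?q ?r) (Dsup (Darr ?p ?r) \<X>)"
  have "?r \<le>\<^sub>D Dsup ?Y ?p" "?r \<le>\<^sub>D Dsup ?Y ?q"
    by (rule Darr_mpD[of ?p] Darr_mpD[of ?q]; auto intro: le_Dsup1 le_Dsup2 D_le_refl)+
  \<comment> \<open>Distributivity by residuation: with \<open>?Y\<close> moved to the left, the two
    cases become lower bounds of \<open>?p\<close> and of \<open>?q\<close>, hence of their
    meet.\<close>
  then have "Darr ?Y ?r \<le>\<^sub>D Dinf ?p ?q"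
    by (intro Dinf_greatest) (simp_all add: Darr_le_iff)
  then have "?r \<le>\<^sub>D Dsup (Dinf ?p ?q) ?Y"
    by (rule Darr_mpD[OF D_le_trans[OF _ Dsup_ge1] Dsup_ge2])
  then show ?case by (simp add: Darr_le_iff)
next
  case (neg_intro p q)
  let ?p = "mass_val Z V p" and ?q = "mass_val Z V q"
  let ?Y = "Dsup ?p (Dsup (Darr ?p (Darr ?q Z)) (Dsup (Darr ?p ?q) \<X>))"
  have "?p \<le>\<^sub>D ?Y" "Darr ?p ?q \<le>\<^sub>D ?Y" "Darr ?p (Darr ?q Z) \<le>\<^sub>D ?Y"
    by (auto intro: le_Dsup1 le_Dsup2 D_le_refl)
  then have "Z \<le>\<^sub>D ?Y" by (meson Darr_mpD)
  then show ?case by (simp add: Darr_le_iff)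
next
  case (neg_elim p q)
  let ?p = "mass_val Z V p" and ?q = "mass_val Z V q"
  let ?Y = "Dsup ?p (Dsup (Darr ?p Z) \<X>)"
  have "?p \<le>\<^sub>D ?Y" "Darr ?p Z \<le>\<^sub>D ?Y" by (auto intro: le_Dsup1 le_Dsup2 D_le_refl)
  then have "Z \<le>\<^sub>D ?Y" by (meson Darr_mpD)
  with mass_val_le[of V Z q] assms(2) have "?q \<le>\<^sub>D ?Y" by (meson D_le_trans)
  then show ?case by (simp add: Darr_le_iff)
next
  case (mp p q)
  then show ?case by (auto intro: Darr_mpD)
qed (simp_all add: Darr_le_iff, auto intro: le_Dsup1 le_Dsup2 Dsup_least Dinf_le1 Dinf_le2 D_le_refl)

section \<open>Coding a set into joins\<close>

instance recf :: countable
  by countable_datatype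

text \<open>Supplies the list of operators against which the finite extension construction
  diagonalises.\<close>

lemma countable_ce: "countable {W. ce W}"
proof (rule countable_subset)
  show "{W. ce W} \<subseteq> range (\<lambda>f. {x. \<exists>y. computes f [x] y})"
    unfolding ce_def partial_computable_def dom_def by fastforce
qed simp

text \<open>Allows an operator with oracle \<open>B\<close> to quantify over finite sets of
  additional tokens.\<close>

lemma eop_extend:
  assumes "eop P" "finite F" "computable f" "computable h"
  shows "eop (\<lambda>B w. P (B \<oplus>\<^sub>e (F \<union> set_decode (f w))) (h w))"
proof -
  have "eop (\<lambda>B w. P {y. pi1 y = 0 \<and> pi2 y \<in> B \<or> pi1 y = 1 \<and> (pi2 y \<in> F \<or> pi2 y \<in> set_decode (f w))} (h w))"
    by (intro eop_subst[OF eop_comp[OF assms(1,4)]] eop_conj eop_disj eop_mem eop_dec dec_conj dec_disj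
        dec_eq dec_finite dec_set_decode assms computable_comp[OF assms(3)] computable_intros)
  moreover have "{y. pi1 y = 0 \<and> pi2 y \<in> B \<or> pi1 y = 1 \<and> (pi2 y \<in> F \<or> pi2 y \<in> set_decode u)} =
    B \<oplus>\<^sub>e (F \<union> set_decode u)" for B u
    by (auto simp: mem_osum_iff)
  ultimately show ?thesis by simp
qed

definition cone :: "nat set \<Rightarrow> nat set" where
  "cone s = {z. s \<subseteq> set_decode (pi1 z)}"

lemma cone_antimono: "s \<subseteq> s' \<Longrightarrow> cone s' \<subseteq> cone s"
  by (auto simp: cone_def)

lemma dec_cone:
  assumes "finite s" "computable f"
  shows "dec (\<lambda>x. f x \<in> cone s)"
proof -
  obtain u where u: "set_decode u = s" using finite_set_decode_ex[OF assms(1)] by blast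
  have "dec (\<lambda>x. \<forall>y\<in>set_decode u. y \<in> set_decode (pi1 (f x)))"
    by (intro dec_Ball_set_decode dec_set_decode computable_comp[OF assms(2)] computable_intros)
  then show ?thesis by (simp add: cone_def u subset_eq)
qed

text \<open>
  A token \<^term>\<open>pair t d\<close> announces that \<open>d\<close> belongs to the coded set \<open>\<Gamma>\<close> provided the finite set
  with index \<open>t\<close> is contained in the key \<open>K\<close>. A condition \<open>(F, s)\<close> consists of finitely many
  correct tokens and a finite \<open>s \<subseteq> K\<close>; all later tokens have to lie in \<^term>\<open>cone s\<close>.
\<close>

definition condition :: "nat set \<Rightarrow> nat set \<Rightarrow> nat set \<times> nat set \<Rightarrow> bool" where
  "condition K \<Gamma> c \<longleftrightarrow> finite (fst c) \<and> finite (snd c) \<and> snd c \<subseteq> K \<and>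
    (\<forall>z\<in>fst c. set_decode (pi1 z) \<subseteq> K \<longrightarrow> pi2 z \<in> \<Gamma>)"

definition extends :: "nat set \<times> nat set \<Rightarrow> nat set \<times> nat set \<Rightarrow> bool" where
  "extends c c' \<longleftrightarrow> fst c \<subseteq> fst c' \<and> snd c \<subseteq> snd c' \<and> fst c' - fst c \<subseteq> cone (snd c)"

definition compatible :: "nat set \<times> nat set \<Rightarrow> nat set \<Rightarrow> bool" where
  "compatible c A \<longleftrightarrow> fst c \<subseteq> A \<and> A - fst c \<subseteq> cone (snd c)"

lemma extends_trans: "extends a b \<Longrightarrow> extends b c \<Longrightarrow> extends a c"
  unfolding extends_def using cone_antimono[of "snd a" "snd b"] by blast

lemma extends_compatible: "extends c c' \<Longrightarrow> compatible c' A \<Longrightarrow> compatible c A"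
  unfolding extends_def compatible_def using cone_antimono[of "snd c" "snd c'"] by blast

definition total_graph :: "(nat \<Rightarrow> nat) \<Rightarrow> nat set" where
  "total_graph h = {z. pi2 z = h (pi1 z)}"

lemma pair_mem_total_graph [simp]: "pair x y \<in> total_graph h \<longleftrightarrow> y = h x"
  by (simp add: total_graph_def)

text \<open>
  Let \<open>U\<close> be the set of \<open>n\<close> for which tokens in \<^term>\<open>cone (insert n s)\<close> can make the operator
  multi-valued. As \<open>U\<close> is enumerable from \<open>H\<close> it differs from the key \<open>K\<close>. If \<open>n \<in> U - K\<close>, such
  tokens may be added, since they announce nothing. If \<open>n \<in> K - U\<close>, committing to \<open>n\<close> makes the
  operator compute a single-valued set that is enumerable from \<open>H\<close> alone.
\<close>

lemma diagonal_extension: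
  assumes K: "\<not> K \<preceq> H" and T: "\<not> total_graph h \<preceq> H" and P: "eop P" and c: "condition K \<Gamma> c"
  obtains c' where "condition K \<Gamma> c'" "extends c c'"
    "\<And>A. compatible c' A \<Longrightarrow> {x. P (H \<oplus>\<^sub>e A) x} \<noteq> total_graph h"
proof -
  obtain F s where Fs: "c = (F, s)" by (cases c)
  have fin: "finite F" "finite s" and s: "s \<subseteq> K"
    and leg: "\<And>z. z \<in> F \<Longrightarrow> set_decode (pi1 z) \<subseteq> K \<Longrightarrow> pi2 z \<in> \<Gamma>"
    using c by (auto simp: condition_def Fs)
  define Q where "Q B u = (\<exists>x y y'. y \<noteq> y' \<and> P (B \<oplus>\<^sub>e (F \<union> set_decode u)) (pair x y) \<and>
    P (B \<oplus>\<^sub>e (F \<union> set_decode u)) (pair x y'))" for B u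
  define U where "U = {n. \<exists>u. (\<forall>z\<in>set_decode u. z \<in> cone s \<and> n \<in> set_decode (pi1 z)) \<and> Q H u}"
  have "eop (\<lambda>B n. \<exists>u. (\<forall>z\<in>set_decode u. z \<in> cone s \<and> n \<in> set_decode (pi1 z)) \<and> Q B u)"
    unfolding Q_def
    by (intro eop_ex eop_conj eop_extend[OF P fin(1)] eop_dec dec_Ball_set_decode dec_conj dec_not
        dec_eq dec_cone dec_set_decode fin computable_intros)
  then have "U \<preceq> H" by (rule e_reducibleI) (simp add: U_def)
  with K have "U \<noteq> K" by blast
  then consider n where "n \<in> U" "n \<notin> K" | n where "n \<in> K" "n \<notin> U" by blast
  then show thesis
  proof cases
    case 1
    then obtain u where u: "\<And>z. z \<in> set_decode u \<Longrightarrow> z \<in> cone s \<and> n \<in> set_decode (pi1 z)" "Q H u"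
      unfolding U_def by blast
    show ?thesis
    proof (rule that)
      show "condition K \<Gamma> (F \<union> set_decode u, s)"
        using fin s leg u(1) 1(2) by (auto simp: condition_def)
      show "extends c (F \<union> set_decode u, s)"
        using u(1) by (auto simp: extends_def Fs)
      fix A assume A: "compatible (F \<union> set_decode u, s) A"
      obtain x y y' where *: "y \<noteq> y'" "P (H \<oplus>\<^sub>e (F \<union> set_decode u)) (pair x y)"
        "P (H \<oplus>\<^sub>e (F \<union> set_decode u)) (pair x y')"
        using u(2) unfolding Q_def by blast
      have "H \<oplus>\<^sub>e (F \<union> set_decode u) \<subseteq> H \<oplus>\<^sub>e A"
        using A by (intro osum_mono) (auto simp: compatible_def)
      then have "P (H \<oplus>\<^sub>e A) (pair x y)" "P (H \<oplus>\<^sub>e A) (pair x y')"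
        using * eop_mono[OF P] by blast+
      with *(1) show "{x. P (H \<oplus>\<^sub>e A) x} \<noteq> total_graph h"
        by (metis mem_Collect_eq pair_mem_total_graph)
    qed
  next
    case 2
    show ?thesis
    proof (rule that)
      show "condition K \<Gamma> (F, insert n s)"
        using fin s leg 2 by (auto simp: condition_def)
      show "extends c (F, insert n s)"
        by (auto simp: extends_def Fs)
      fix A assume A: "compatible (F, insert n s) A"
      show "{x. P (H \<oplus>\<^sub>e A) x} \<noteq> total_graph h"
      proof
        assume eq: "{x. P (H \<oplus>\<^sub>e A) x} = total_graph h"
        define S where "S = {z. \<exists>u. (\<forall>z\<in>set_decode u. z \<in> cone (insert n s)) \<and> P (H \<oplus>\<^sub>e (F \<union> set_decode u)) z}"
        have "eop (\<lambda>B z. \<exists>u. (\<forall>z\<in>set_decode u. z \<in> cone (insert n s)) \<and> P (B \<oplus>\<^sub>e (F \<union> set_decode u)) z)"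
          by (intro eop_ex eop_conj eop_extend[OF P fin(1)] eop_dec dec_Ball_set_decode dec_cone
              finite.insertI fin computable_intros)
        then have SH: "S \<preceq> H" by (rule e_reducibleI) (simp add: S_def)
        have TS: "\<exists>u. set_decode u \<subseteq> cone (insert n s) \<and> P (H \<oplus>\<^sub>e (F \<union> set_decode u)) z"
          if "z \<in> total_graph h" for z
        proof -
          have "P (H \<oplus>\<^sub>e A) z" using eq that by blast
          then obtain G where G: "G \<subseteq> H \<oplus>\<^sub>e A" "finite G" "P G z" using eop_finite[OF P] by blast
          \<comment> \<open>Only tokens of \<open>A\<close> outside \<open>F\<close> are collected.
            Elements used on the side of \<open>H\<close> that happen to lie in \<open>A - F\<close>
            come along harmlessly, being tokens of \<open>A\<close> as well.\<close>
          have "finite (pi2 ` G \<inter> (A - F))" using G(2) by blast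
          then obtain u where u: "set_decode u = pi2 ` G \<inter> (A - F)" using finite_set_decode_ex by blast
          have "G \<subseteq> H \<oplus>\<^sub>e (F \<union> set_decode u)"
          proof
            fix y assume "y \<in> G"
            then show "y \<in> H \<oplus>\<^sub>e (F \<union> set_decode u)"
              using G(1) unfolding u by (auto simp: mem_osum_iff subset_eq)
          qed
          with G(3) have "P (H \<oplus>\<^sub>e (F \<union> set_decode u)) z" using eop_mono[OF P] by blast
          moreover have "set_decode u \<subseteq> cone (insert n s)"
            using A u by (auto simp: compatible_def)
          ultimately show ?thesis by blast
        qed
        have "S = total_graph h"
        proof
          show "total_graph h \<subseteq> S" using TS unfolding S_def subset_eq by blast
          show "S \<subseteq> total_graph h"
          proof (rule ccontr)
            assume "\<not> S \<subseteq> total_graph h"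
            then obtain z where z: "z \<in> S" "pi2 z \<noteq> h (pi1 z)" by (auto simp: total_graph_def)
            obtain u where u: "set_decode u \<subseteq> cone (insert n s)" "P (H \<oplus>\<^sub>e (F \<union> set_decode u)) z"
              using z(1) unfolding S_def by blast
            obtain u' where u': "set_decode u' \<subseteq> cone (insert n s)"
              "P (H \<oplus>\<^sub>e (F \<union> set_decode u')) (pair (pi1 z) (h (pi1 z)))"
              using TS[of "pair (pi1 z) (h (pi1 z))"] by auto
            \<comment> \<open>By monotonicity both values survive over the union, so a wrong value
              in \<open>S\<close> makes the operator multi-valued inside
              \<open>cone (insert n s)\<close>.\<close>
            obtain w where w: "set_decode w = set_decode u \<union> set_decode u'"
              using finite_set_decode_ex[of "set_decode u \<union> set_decode u'"] by auto
            have "P (H \<oplus>\<^sub>e (F \<union> set_decode w)) (pair (pi1 z) (pi2 z))"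
              using eop_mono[OF P u(2) osum_mono[OF subset_refl]] by (auto simp: w)
            moreover have "P (H \<oplus>\<^sub>e (F \<union> set_decode w)) (pair (pi1 z) (h (pi1 z)))"
              using eop_mono[OF P u'(2) osum_mono[OF subset_refl]] by (auto simp: w)
            ultimately have "Q H w" using z(2) unfolding Q_def by blast
            moreover have "\<forall>z\<in>set_decode w. z \<in> cone s \<and> n \<in> set_decode (pi1 z)"
              using u(1) u'(1) by (auto simp: w cone_def)
            ultimately show False using 2(2) unfolding U_def by blast
          qed
        qed
        with SH T show False by simp
      qed
    qed
  qed
qed

text \<open>The guard of the new token is \<open>snd c\<close> itself: this puts the token into the
  required cone, and the guard is met because \<open>snd c\<close> is contained in
  \<open>K\<close>.\<close>

lemma data_extension:
  assumes "condition K \<Gamma> c" "d \<in> \<Gamma>"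
  obtains c' t where "condition K \<Gamma> c'" "extends c c'" "set_decode t \<subseteq> K" "pair t d \<in> fst c'"
proof
  let ?c' = "(insert (pair (set_encode (snd c)) d) (fst c), snd c)"
  have "finite (snd c)" using assms by (simp add: condition_def)
  then have [simp]: "set_decode (set_encode (snd c)) = snd c" by (rule set_encode_inverse)
  show "condition K \<Gamma> ?c'" using assms by (auto simp: condition_def)
  show "extends c ?c'" by (auto simp: extends_def cone_def)
  show "set_decode (set_encode (snd c)) \<subseteq> K" using assms by (simp add: condition_def)
qed simp

text \<open>\<open>H\<close> is the information already present, \<open>K\<close> the key, and the
  functions \<open>h j\<close> are to stay out of reach. Decoding asks only for membership in
  \<open>A\<close> and in \<open>K\<close>, as an enumeration operator must.\<close>

lemma exists_coding_set:
  fixes h :: "nat \<Rightarrow> nat \<Rightarrow> nat"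
  assumes K: "\<not> K \<preceq> H" and T: "\<And>j. j \<in> J \<Longrightarrow> \<not> total_graph (h j) \<preceq> H"
  obtains A where "\<Gamma> \<preceq> A \<oplus>\<^sub>e K" "\<And>j. j \<in> J \<Longrightarrow> \<not> total_graph (h j) \<preceq> H \<oplus>\<^sub>e A"
proof -
  define W where "W = from_nat_into {W. ce W}"
  have ce_empty: "ce {}"
    unfolding ce_iff_sigma1 by (intro sigma1_dec) (simp add: dec_const)
  have W: "ce (W i)" for i
    using from_nat_into[of "{W. ce W}" i] ce_empty unfolding W_def by blast
  have W_surj: "\<exists>i. W i = X" if "ce X" for X
    using from_nat_into_surj[OF countable_ce, of X] that unfolding W_def by simp
  \<comment> \<open>Every stage number serves twice: as a pair it names an operator and a function
    to diagonalise against, and as it stands it names a possible element of \<Gamma>.\<close>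
  define meets where "meets n c \<longleftrightarrow>
    (pi2 n \<in> J \<longrightarrow> (\<forall>A. compatible c A \<longrightarrow> enum_app (W (pi1 n)) (H \<oplus>\<^sub>e A) \<noteq> total_graph (h (pi2 n)))) \<and>
    (n \<in> \<Gamma> \<longrightarrow> (\<exists>t. set_decode t \<subseteq> K \<and> pair t n \<in> fst c))" for n c
  have "\<exists>C. \<forall>n. condition K \<Gamma> (C n) \<and> extends (C n) (C (Suc n)) \<and> meets n (C (Suc n))"
  proof (rule dependent_nat_choice)
    show "\<exists>c. condition K \<Gamma> c" by (intro exI[of _ "({}, {})"]) (simp add: condition_def)
  next
    fix c n assume c: "condition K \<Gamma> c"
    obtain c1 where c1: "condition K \<Gamma> c1" "extends c c1"
      "pi2 n \<in> J \<Longrightarrow> compatible c1 A \<Longrightarrow> enum_app (W (pi1 n)) (H \<oplus>\<^sub>e A) \<noteq> total_graph (h (pi2 n))" for A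
    proof (cases "pi2 n \<in> J")
      case True
      obtain P where P: "eop P" "\<And>A. {x. P A x} = enum_app (W (pi1 n)) A"
        using W[of "pi1 n"] eop_iff_enum_app[of "\<lambda>A x. x \<in> enum_app (W (pi1 n)) A"] by auto
      show ?thesis
        using diagonal_extension[OF K T[OF True] P(1) c] that unfolding P(2) by metis
    next
      case False
      show ?thesis by (rule that[OF c]) (use False in \<open>auto simp: extends_def\<close>)
    qed
    obtain c2 where c2: "condition K \<Gamma> c2" "extends c1 c2"
      "n \<in> \<Gamma> \<Longrightarrow> \<exists>t. set_decode t \<subseteq> K \<and> pair t n \<in> fst c2"
    proof (cases "n \<in> \<Gamma>")
      case True
      show ?thesis using data_extension[OF c1(1) True] that by metis
    next
      case False
      show ?thesis by (rule that[OF c1(1)]) (use False in \<open>auto simp: extends_def\<close>)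
    qed
    have "meets n c2"
      unfolding meets_def using c1(3) c2(3) extends_compatible[OF c2(2)] by blast
    with c2 extends_trans[OF c1(2) c2(2)]
    show "\<exists>c'. condition K \<Gamma> c' \<and> extends c c' \<and> meets n c'" by blast
  qed
  then obtain C where C: "\<And>n. condition K \<Gamma> (C n)" "\<And>n. extends (C n) (C (Suc n))" "\<And>n. meets n (C (Suc n))"
    by blast
  have ext: "extends (C n) (C m)" if "n \<le> m" for n m
    using that
  proof (induction m rule: dec_induct)
    case base
    show ?case by (simp add: extends_def)
  next
    case (step m)
    then show ?case using extends_trans C(2) by blast
  qed
  define A where "A = (\<Union>n. fst (C n))"
  have compat: "compatible (C n) A" for n
    unfolding compatible_def
  proof
    show "fst (C n) \<subseteq> A" by (auto simp: A_def)
    show "A - fst (C n) \<subseteq> cone (snd (C n))"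
    proof
      fix z assume "z \<in> A - fst (C n)"
      then obtain m where m: "z \<in> fst (C m)" "z \<notin> fst (C n)" by (auto simp: A_def)
      show "z \<in> cone (snd (C n))"
        using m ext[of n m] ext[of m n] by (cases "n \<le> m") (auto simp: extends_def)
    qed
  qed
  show thesis
  proof
    have "eop (\<lambda>B d. \<exists>t. pair 0 (pair t d) \<in> B \<and> (\<forall>y\<in>set_decode t. pair 1 y \<in> B))"
      by (intro eop_ex eop_conj eop_Ball eop_mem computable_intros)
    then show "\<Gamma> \<preceq> A \<oplus>\<^sub>e K"
    proof (rule e_reducibleI)
      fix d
      have "(\<exists>t. pair t d \<in> A \<and> set_decode t \<subseteq> K) \<longleftrightarrow> d \<in> \<Gamma>"
      proof
        assume "\<exists>t. pair t d \<in> A \<and> set_decode t \<subseteq> K"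
        then obtain t n where "pair t d \<in> fst (C n)" "set_decode t \<subseteq> K" by (auto simp: A_def)
        then show "d \<in> \<Gamma>" using C(1)[of n] unfolding condition_def by (metis pi1_pair pi2_pair)
      next
        assume "d \<in> \<Gamma>"
        then show "\<exists>t. pair t d \<in> A \<and> set_decode t \<subseteq> K"
          using C(3)[of d] unfolding meets_def A_def by blast
      qed
      then show "d \<in> \<Gamma> \<longleftrightarrow> (\<exists>t. pair 0 (pair t d) \<in> A \<oplus>\<^sub>e K \<and> (\<forall>y\<in>set_decode t. pair 1 y \<in> A \<oplus>\<^sub>e K))"
        by (simp add: subset_eq)
    qed
    fix j assume j: "j \<in> J"
    show "\<not> total_graph (h j) \<preceq> H \<oplus>\<^sub>e A"
    proof
      assume "total_graph (h j) \<preceq> H \<oplus>\<^sub>e A"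
      then obtain X where "ce X" "total_graph (h j) = enum_app X (H \<oplus>\<^sub>e A)"
        unfolding e_reducible_iff eop_iff_enum_app by metis
      with W_surj obtain i where "total_graph (h j) = enum_app (W i) (H \<oplus>\<^sub>e A)" by blast
      with C(3)[of "pair i j"] j compat show False unfolding meets_def by auto
    qed
  qed
qed

text \<open>The keys are treated one at a time, over the information built so far. All of
  \<open>D\<close> is kept out of reach at every step, because each later key must still be new when
  its turn comes.\<close>

lemma exists_coding_set_all_keys:
  fixes h :: "nat \<Rightarrow> nat \<Rightarrow> nat"
  assumes "finite D" "\<And>j. j \<in> D \<Longrightarrow> \<not> total_graph (h j) \<preceq> H"
  obtains f where "H \<preceq> f" "\<And>j. j \<in> D \<Longrightarrow> \<not> total_graph (h j) \<preceq> f"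
    "\<And>j. j \<in> D \<Longrightarrow> \<Gamma> \<preceq> f \<oplus>\<^sub>e total_graph (h j)"
proof -
  have "\<exists>f. H \<preceq> f \<and> (\<forall>j\<in>D. \<not> total_graph (h j) \<preceq> f) \<and> (\<forall>j\<in>E. \<Gamma> \<preceq> f \<oplus>\<^sub>e total_graph (h j))"
    if "finite E" "E \<subseteq> D" for E
    using that
  proof (induction E rule: finite_induct)
    case empty
    show ?case by (intro exI[of _ H]) (use assms in auto)
  next
    case (insert i E)
    then obtain f where f: "H \<preceq> f" "\<And>j. j \<in> D \<Longrightarrow> \<not> total_graph (h j) \<preceq> f"
      "\<And>j. j \<in> E \<Longrightarrow> \<Gamma> \<preceq> f \<oplus>\<^sub>e total_graph (h j)" by auto
    obtain A where A: "\<Gamma> \<preceq> A \<oplus>\<^sub>e total_graph (h i)" "\<And>j. j \<in> D \<Longrightarrow> \<not> total_graph (h j) \<preceq> f \<oplus>\<^sub>e A"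
      using exists_coding_set[of "total_graph (h i)" f D h \<Gamma>] f(2) insert.prems by auto
    have mono: "X \<preceq> f \<oplus>\<^sub>e A \<Longrightarrow> X \<oplus>\<^sub>e Y \<preceq> (f \<oplus>\<^sub>e A) \<oplus>\<^sub>e Y" for X Y
      by (meson osum_least e_reducible_trans e_reducible_osum1 e_reducible_osum2)
    show ?case
    proof (intro exI[of _ "f \<oplus>\<^sub>e A"] conjI ballI)
      show "H \<preceq> f \<oplus>\<^sub>e A" by (rule e_reducible_trans[OF f(1) e_reducible_osum1])
      fix j assume "j \<in> insert i E"
      then consider "j = i" | "j \<in> E" by blast
      then show "\<Gamma> \<preceq> (f \<oplus>\<^sub>e A) \<oplus>\<^sub>e total_graph (h j)"
      proof cases
        case 1
        show ?thesis unfolding 1 by (rule e_reducible_trans[OF A(1) mono[OF e_reducible_osum2]])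
      next
        case 2
        show ?thesis by (rule e_reducible_trans[OF f(3)[OF 2] mono[OF e_reducible_osum1]])
      qed
    qed (use A(2) in blast)
  qed
  from this[OF assms(1) subset_refl] obtain f where "H \<preceq> f"
    "\<forall>j\<in>D. \<not> total_graph (h j) \<preceq> f" "\<forall>j\<in>D. \<Gamma> \<preceq> f \<oplus>\<^sub>e total_graph (h j)" by auto
  then show thesis by (intro that[of f]) auto
qed

section \<open>Tagged unions of upward closed classes\<close>

definition upclosed :: "nat set set \<Rightarrow> bool" where
  "upclosed U \<longleftrightarrow> (\<forall>A B. A \<in> U \<longrightarrow> A \<preceq> B \<longrightarrow> B \<in> U)"

lemma upclosedD: "upclosed U \<Longrightarrow> A \<in> U \<Longrightarrow> A \<preceq> B \<Longrightarrow> B \<in> U"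
  unfolding upclosed_def by blast

definition plain :: "nat set set \<Rightarrow> mass_problem" where
  "plain U = {\<psi>. code_graph \<psi> \<in> U}"

text \<open>\<open>Z\<close> has this form, the tag being the column index, and so have all problems
  of the refuting valuation.\<close>

definition tagged :: "nat set \<Rightarrow> (nat \<Rightarrow> nat set set) \<Rightarrow> mass_problem" where
  "tagged S T = {prepend n \<psi> | n \<psi>. n \<in> S \<and> code_graph \<psi> \<in> T n}"

lemma tagged_mono: "S \<subseteq> S' \<Longrightarrow> tagged S T \<subseteq> tagged S' T"
  unfolding tagged_def by blast

lemma e_reducible_graph_join1: "A \<preceq> graph_join A B"
  by (rule e_reducibleI[OF eop_lpart[OF eop_self]]) simp

lemma e_reducible_graph_join2: "B \<preceq> graph_join A B"
  by (rule e_reducibleI[OF eop_rpart[OF eop_self]]) simp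

lemma e_reducible_prepend: "A \<preceq> graph_prepend n A"
  by (rule e_reducibleI[OF eop_graph_tail[OF eop_self]]) simp

lemma graph_join_least:
  assumes "A \<preceq> C" "B \<preceq> C" shows "graph_join A B \<preceq> C"
proof -
  obtain P Q where "eop P" "A = {x. P C x}" "eop Q" "B = {x. Q C x}"
    using assms unfolding e_reducible_iff by blast
  then show ?thesis
    by (intro e_reducibleI[of "\<lambda>A x. x \<in> graph_join {x. P A x} {x. Q A x}"] eop_graph_join) auto
qed

lemma e_reducible_set_pfun: "X \<preceq> code_graph (set_pfun X)"
  by (rule e_reducibleI[of "\<lambda>A x. pair x 0 \<in> A"])
    (auto simp: mem_code_graph_set_pfun intro!: eop_mem computable_intros)

lemma set_pfun_e_reducible: "code_graph (set_pfun X) \<preceq> X"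
proof (rule e_reducibleI)
  show "eop (\<lambda>A z. pi1 z \<in> A \<and> pi2 z = 0)"
    by (intro eop_conj eop_mem eop_dec dec_intros computable_intros)
qed (simp add: mem_code_graph_set_pfun)

text \<open>The input itself is kept as solution, so only the tag has to be computed; upward closure
  of the classes makes this possible in the applications.\<close>

lemma tagged_leI:
  assumes P: "eop P"
    and tag: "\<And>\<chi>. \<chi> \<in> \<X> \<Longrightarrow> \<exists>n\<in>S. (\<forall>y. P (code_graph \<chi>) y \<longleftrightarrow> y = n) \<and> code_graph \<chi> \<in> T n"
  shows "tagged S T \<le>\<^sub>D \<X>"
  unfolding D_le_iff
proof (intro exI[of _ "\<lambda>A z. pi1 z = 0 \<and> P A (pi2 z) \<or> 0 < pi1 z \<and> pair (pi1 z - 1) (pi2 z) \<in> A"] conjI ballI)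
  show "eop (\<lambda>A z. pi1 z = 0 \<and> P A (pi2 z) \<or> 0 < pi1 z \<and> pair (pi1 z - 1) (pi2 z) \<in> A)"
    by (intro eop_conj eop_disj eop_mem eop_comp[OF P] eop_dec dec_eq dec_less computable_intros)
  fix \<chi> assume "\<chi> \<in> \<X>"
  then obtain n where n: "n \<in> S" "\<And>y. P (code_graph \<chi>) y \<longleftrightarrow> y = n" "code_graph \<chi> \<in> T n"
    using tag by blast
  then have "prepend n \<chi> \<in> tagged S T" unfolding tagged_def by blast
  then show "\<exists>\<phi>\<in>tagged S T. {z. pi1 z = 0 \<and> P (code_graph \<chi>) (pi2 z) \<or>
      0 < pi1 z \<and> pair (pi1 z - 1) (pi2 z) \<in> code_graph \<chi>} = code_graph \<phi>"
    by (intro bexI[of _ "prepend n \<chi>"]) (simp_all add: code_graph_prepend graph_prepend_def n(2))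
qed

lemma tagged_reindex:
  assumes "computable t" "\<And>n. n \<in> S' \<Longrightarrow> t n \<in> S \<and> T' n \<subseteq> T (t n)" "\<And>n. upclosed (T' n)"
  shows "tagged S T \<le>\<^sub>D tagged S' T'"
proof (rule tagged_leI)
  show "eop (\<lambda>A y. \<exists>a. pair 0 a \<in> A \<and> y = t a)"
    by (intro eop_ex eop_conj eop_mem eop_dec dec_eq computable_comp[OF assms(1)] computable_intros)
  fix \<chi> assume "\<chi> \<in> tagged S' T'"
  then obtain n \<psi> where "\<chi> = prepend n \<psi>" "n \<in> S'" "code_graph \<psi> \<in> T' n"
    unfolding tagged_def by blast
  then show "\<exists>n\<in>S. (\<forall>y. (\<exists>a. pair 0 a \<in> code_graph \<chi> \<and> y = t a) \<longleftrightarrow> y = n) \<and> code_graph \<chi> \<in> T n"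
    using assms(2)[of n] upclosedD[OF assms(3)[of n] _ e_reducible_prepend[of "code_graph \<psi>" n]]
    by (intro bexI[of _ "t n"]) (auto simp: code_graph_prepend)
qed

text \<open>A joint solution computes both components and so lies in both classes; only the two tags
  have to be merged, which \<open>t\<close> does.\<close>

lemma tagged_join_le:
  assumes "computable t" "\<And>a b. a \<in> S1 \<Longrightarrow> b \<in> S2 \<Longrightarrow> t (pair a b) \<in> S \<and> T1 a \<inter> T2 b \<subseteq> T (t (pair a b))"
    "\<And>n. upclosed (T1 n)" "\<And>n. upclosed (T2 n)"
  shows "tagged S T \<le>\<^sub>D Dsup (tagged S1 T1) (tagged S2 T2)"
proof (rule tagged_leI)
  show "eop (\<lambda>A y. \<exists>a b. pair (pair 0 0) a \<in> A \<and> pair (pair 1 0) b \<in> A \<and> y = t (pair a b))"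
    by (intro eop_ex eop_conj eop_mem eop_dec dec_eq computable_comp[OF assms(1)] computable_intros)
  fix \<chi> assume "\<chi> \<in> Dsup (tagged S1 T1) (tagged S2 T2)"
  then obtain a \<phi> b \<psi> where *: "\<chi> = pjoin (prepend a \<phi>) (prepend b \<psi>)"
    "a \<in> S1" "code_graph \<phi> \<in> T1 a" "b \<in> S2" "code_graph \<psi> \<in> T2 b"
    unfolding tagged_def Dsup_def by blast
  have cg: "code_graph \<chi> = graph_join (graph_prepend a (code_graph \<phi>)) (graph_prepend b (code_graph \<psi>))"
    by (simp add: * code_graph_pjoin code_graph_prepend)
  have "code_graph \<chi> \<in> T1 a" "code_graph \<chi> \<in> T2 b"
    unfolding cg
    using upclosedD[OF assms(3) *(3) e_reducible_trans[OF e_reducible_prepend e_reducible_graph_join1]]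
      upclosedD[OF assms(4) *(5) e_reducible_trans[OF e_reducible_prepend e_reducible_graph_join2]] by blast+
  moreover have "pair (pair 0 0) y \<in> code_graph \<chi> \<longleftrightarrow> y = a" "pair (pair 1 0) y \<in> code_graph \<chi> \<longleftrightarrow> y = b" for y
    by (simp_all add: cg graph_join_def)
  ultimately show "\<exists>n\<in>S. (\<forall>y. (\<exists>a b. pair (pair 0 0) a \<in> code_graph \<chi> \<and> pair (pair 1 0) b \<in> code_graph \<chi> \<and> y = t (pair a b))
      \<longleftrightarrow> y = n) \<and> code_graph \<chi> \<in> T n"
    using assms(2)[OF *(2,4)] by (intro bexI[of _ "t (pair a b)"]) auto
qed

lemma tagged_join_plain:
  assumes "\<And>n. upclosed (T n)" "upclosed U"
  shows "tagged S (\<lambda>n. T n \<inter> U) \<le>\<^sub>D Dsup (tagged S T) (plain U)"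
proof (rule tagged_leI)
  show "eop (\<lambda>A y. pair (pair 0 0) y \<in> A)" by (intro eop_mem computable_intros)
  fix \<chi> assume "\<chi> \<in> Dsup (tagged S T) (plain U)"
  then obtain a \<phi> \<psi> where *: "\<chi> = pjoin (prepend a \<phi>) \<psi>" "a \<in> S" "code_graph \<phi> \<in> T a" "code_graph \<psi> \<in> U"
    unfolding tagged_def Dsup_def plain_def by blast
  have cg: "code_graph \<chi> = graph_join (graph_prepend a (code_graph \<phi>)) (code_graph \<psi>)"
    by (simp add: * code_graph_pjoin code_graph_prepend)
  have "code_graph \<chi> \<in> T a" "code_graph \<chi> \<in> U"
    unfolding cg
    using upclosedD[OF assms(1) *(3) e_reducible_trans[OF e_reducible_prepend e_reducible_graph_join1]]
      upclosedD[OF assms(2) *(4) e_reducible_graph_join2] by blast+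
  then show "\<exists>n\<in>S. (\<forall>y. pair (pair 0 0) y \<in> code_graph \<chi> \<longleftrightarrow> y = n) \<and> code_graph \<chi> \<in> T n \<inter> U"
    using *(2) by (intro bexI[of _ a]) (simp_all add: cg graph_join_def)
qed

lemma tagged_le_plain:
  assumes "n \<in> S" "U \<subseteq> T n" shows "tagged S T \<le>\<^sub>D plain U"
proof (rule tagged_leI)
  show "eop (\<lambda>A y. y = n)" by (intro eop_dec dec_eq computable_intros)
qed (use assms in \<open>auto simp: plain_def\<close>)

text \<open>
  An upward closed class contains with \<open>B\<close> every \<^term>\<open>B \<union> F\<close> with \<open>F\<close> finite, and any two of the
  partial functions \<^term>\<open>set_pfun B\<close> are compatible. Hence the tag produced from \<open>\<chi>\<close> and
  \<^term>\<open>set_pfun B\<close> does not depend on \<open>B\<close>, and it is the one produced from \<^term>\<open>set_pfun UNIV\<close>.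
\<close>

lemma tagged_le_Dsup_plain:
  assumes le: "tagged S T \<le>\<^sub>D Dsup (plain U) \<X>" and U: "upclosed U" "U \<noteq> {}" and T: "\<And>n. upclosed (T n)"
  shows "tagged S (\<lambda>n. {C. \<forall>B\<in>U. B \<oplus>\<^sub>e C \<in> T n}) \<le>\<^sub>D \<X>"
proof -
  obtain P where P: "eop P"
    "\<And>\<psi>. \<psi> \<in> Dsup (plain U) \<X> \<Longrightarrow> \<exists>\<phi>\<in>tagged S T. {x. P (code_graph \<psi>) x} = code_graph \<phi>"
    using le unfolding D_le_iff by blast
  let ?J = "\<lambda>B A. graph_join (code_graph (set_pfun B)) A"
  have UNIV: "code_graph (set_pfun UNIV) = {z. pi2 z = 0}"
    by (auto simp: mem_code_graph_set_pfun)
  have tag: "\<exists>n\<in>S. (\<forall>y. P (?J B (code_graph \<chi>)) (pair 0 y) \<longleftrightarrow> y = n) \<and> B \<oplus>\<^sub>e code_graph \<chi> \<in> T n"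
    if "B \<in> U" "\<chi> \<in> \<X>" for B \<chi>
  proof -
    have "pjoin (set_pfun B) \<chi> \<in> Dsup (plain U) \<X>"
      using that upclosedD[OF U(1) _ e_reducible_set_pfun] unfolding Dsup_def plain_def by blast
    from P(2)[OF this] obtain n \<zeta> where n: "n \<in> S" "code_graph \<zeta> \<in> T n"
      "{x. P (?J B (code_graph \<chi>)) x} = graph_prepend n (code_graph \<zeta>)"
      unfolding tagged_def by (auto simp: code_graph_pjoin code_graph_prepend)
    have "P (?J B (code_graph \<chi>)) (pair 0 y) \<longleftrightarrow> y = n" for y
      using n(3) pair_0_graph_prepend[of y n] by blast
    moreover have "code_graph \<zeta> \<preceq> B \<oplus>\<^sub>e code_graph \<chi>"
    proof -
      have "code_graph \<zeta> \<preceq> {x. P (?J B (code_graph \<chi>)) x}" unfolding n(3) by (rule e_reducible_prepend)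
      also have "\<dots> \<preceq> ?J B (code_graph \<chi>)" by (rule e_reducible_eop[OF e_reducible_refl P(1)])
      also have "\<dots> \<preceq> B \<oplus>\<^sub>e code_graph \<chi>"
        by (rule graph_join_least[OF e_reducible_trans[OF set_pfun_e_reducible e_reducible_osum1] e_reducible_osum2])
      finally show ?thesis .
    qed
    ultimately show ?thesis using n(1,2) upclosedD[OF T] by blast
  qed
  have mono: "?J B A \<subseteq> ?J B' A" if "B \<subseteq> B'" for B B' A
    using that by (intro graph_join_mono) (auto simp: mem_code_graph_set_pfun)
  show ?thesis
  proof (rule tagged_leI)
    have "eop (\<lambda>A x. x \<in> graph_join (code_graph (set_pfun UNIV)) A)"
      unfolding UNIV by (intro eop_graph_join eop_self) (simp add: eop_dec dec_eq computable_intros)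
    moreover have "eop (\<lambda>B y. P B (pair 0 y))"
      by (rule eop_comp[OF P(1)]) (intro computable_intros)
    ultimately show "eop (\<lambda>A y. P (?J UNIV A) (pair 0 y))"
      by (rule eop_compose_set[rotated])
    fix \<chi> assume \<chi>: "\<chi> \<in> \<X>"
    obtain B0 where B0: "B0 \<in> U" using U(2) by blast
    obtain n where n: "n \<in> S" "\<And>y. P (?J B0 (code_graph \<chi>)) (pair 0 y) \<longleftrightarrow> y = n"
      using tag[OF B0 \<chi>] by blast
    have uniq: "P (?J UNIV (code_graph \<chi>)) (pair 0 y) \<longleftrightarrow> y = n" for y
    proof
      assume "y = n"
      then show "P (?J UNIV (code_graph \<chi>)) (pair 0 y)"
        using n(2) eop_mono[OF P(1) _ mono[OF subset_UNIV]] by blast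
    next
      assume "P (?J UNIV (code_graph \<chi>)) (pair 0 y)"
      then obtain G where G: "G \<subseteq> ?J UNIV (code_graph \<chi>)" "finite G" "P G (pair 0 y)"
        using eop_finite[OF P(1)] by blast
      \<comment> \<open>Adding to \<open>B0\<close> the finitely many arguments used in
        \<open>G\<close> carries the computation from \<open>UNIV\<close> over to \<open>B\<close>,
        while \<open>B\<close> stays in \<open>U\<close>. The unique tag for \<open>B\<close> is
        then both \<open>y\<close> and \<open>n\<close>.\<close>
      define B where "B = B0 \<union> (\<lambda>z. pi2 (pi1 z)) ` G"
      have "B \<in> U"
        using upclosedD[OF U(1) B0 e_reducible_Un_finite] G(2) unfolding B_def by blast
      then obtain k where k: "\<And>y. P (?J B (code_graph \<chi>)) (pair 0 y) \<longleftrightarrow> y = k"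
        using tag[OF _ \<chi>] by blast
      have "G \<subseteq> ?J B (code_graph \<chi>)"
        using G(1) by (auto simp: graph_join_def mem_code_graph_set_pfun B_def)
      then have "y = k" using eop_mono[OF P(1) G(3)] k by blast
      moreover have "n = k"
        using n(2) eop_mono[OF P(1) _ mono[of B0 B]] k unfolding B_def by blast
      ultimately show "y = n" by simp
    qed
    have "B \<oplus>\<^sub>e code_graph \<chi> \<in> T n" if B: "B \<in> U" for B
    proof -
      obtain k where k: "\<And>y. P (?J B (code_graph \<chi>)) (pair 0 y) \<longleftrightarrow> y = k" "B \<oplus>\<^sub>e code_graph \<chi> \<in> T k"
        using tag[OF B \<chi>] by blast
      then have "k = n" using uniq eop_mono[OF P(1) _ mono[OF subset_UNIV]] by blast
      with k(2) show ?thesis by simp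
    qed
    with n(1) uniq
    show "\<exists>n\<in>S. (\<forall>y. P (?J UNIV (code_graph \<chi>)) (pair 0 y) \<longleftrightarrow> y = n) \<and>
      code_graph \<chi> \<in> {C. \<forall>B\<in>U. B \<oplus>\<^sub>e C \<in> T n}" by blast
  qed
qed

text \<open>From a constant function, whose graph is decidable, the reduction produces a solution
  enumerable from every set.\<close>

lemma tagged_le_D0D:
  assumes "tagged S T \<le>\<^sub>D D0"
  obtains n A where "n \<in> S" "A \<in> T n" "\<forall>B. A \<preceq> B"
proof -
  have "tagged S T \<le>\<^sub>D {\<lambda>x. Some 0}" using assms D0_le[of "{\<lambda>x. Some 0}"] by (rule D_le_trans)
  then obtain P \<phi> where P: "eop P" "\<phi> \<in> tagged S T" "{x. P (code_graph (\<lambda>x. Some 0)) x} = code_graph \<phi>"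
    unfolding D_le_iff by auto
  obtain n \<psi> where n: "\<phi> = prepend n \<psi>" "n \<in> S" "code_graph \<psi> \<in> T n"
    using P(2) unfolding tagged_def by blast
  have "code_graph \<psi> \<preceq> B" for B
  proof -
    have "code_graph \<psi> \<preceq> {x. P (code_graph (\<lambda>x. Some 0)) x}"
      by (simp add: P(3) n(1) code_graph_prepend e_reducible_prepend)
    also have "\<dots> \<preceq> code_graph (\<lambda>x. Some 0)" by (rule e_reducible_eop[OF e_reducible_refl P(1)])
    also have "\<dots> \<preceq> B"
      by (intro e_reducible_sigma1 sigma1_dec) (simp add: mem_code_graph dec_eq eq_commute[of 0] computable_intros)
    finally show ?thesis .
  qed
  with n that show thesis by blast
qed

text \<open>Irreducibility: the tag is chosen once for the whole class. It follows from
  \<open>tagged_le_Dsup_plain\<close> with \<open>D0\<close> as side problem, since a solution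
  enumerable from every set adds nothing to \<open>B\<close>.\<close>

lemma tagged_le_plainD:
  assumes "tagged S T \<le>\<^sub>D plain U" and U: "upclosed U" "U \<noteq> {}" and T: "\<And>n. upclosed (T n)"
  shows "\<exists>n\<in>S. U \<subseteq> T n"
proof -
  have le: "tagged S T \<le>\<^sub>D Dsup (plain U) D0" using D_le_trans[OF assms(1) Dsup_ge1] .
  obtain n A where n: "n \<in> S" "A \<in> {C. \<forall>B\<in>U. B \<oplus>\<^sub>e C \<in> T n}" "\<forall>B. A \<preceq> B"
    using tagged_le_D0D[OF tagged_le_Dsup_plain[OF le U T]] by blast
  have "B \<in> T n" if "B \<in> U" for B
    using n(2) that by (blast intro: upclosedD[OF T _ osum_least[OF e_reducible_refl n(3)[rule_format]]])
  with n(1) show ?thesis by blast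
qed

section \<open>Upward closed classes from independent columns\<close>

lemma column_sum_eq:
  "column_sum I F n = (if pi1 n \<in> I then F (pi1 n) (pi2 n) else Some 0)"
  by (simp add: column_sum_def pi1_def pi2_def split: prod.split)

locale independent_columns =
  fixes g :: "nat \<Rightarrow> nat"
  assumes independent: "computably_e_independent (\<lambda>x. Some (g x))"
begin

definition col :: "nat \<Rightarrow> nat set" where
  "col i = total_graph (\<lambda>x. g (pair i x))"

definition all_cols :: "nat set" where
  "all_cols = total_graph g"

lemma code_graph_column: "code_graph (column (\<lambda>x. Some (g x)) i) = col i"
  by (auto simp: mem_code_graph column_def col_def total_graph_def pair_def)

lemma col_all_cols: "col i \<preceq> all_cols"
  by (rule e_reducibleI[OF eop_mem, of "\<lambda>z. pair (pair i (pi1 z)) (pi2 z)"])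
    (auto simp: col_def all_cols_def total_graph_def intro!: computable_intros)

text \<open>\<open>H\<close> collects the columns outside \<open>D\<close>; over it,
  \<open>all_cols\<close> is coded with each column in \<open>D\<close> as a key.\<close>

lemma exists_coded:
  assumes "finite D"
  obtains f where "\<And>i. i \<notin> D \<Longrightarrow> col i \<preceq> f" "\<And>i. i \<in> D \<Longrightarrow> \<not> col i \<preceq> f"
    "\<And>i. i \<in> D \<Longrightarrow> all_cols \<preceq> f \<oplus>\<^sub>e col i"
proof -
  define H where "H = all_cols \<inter> {z. pi1 (pi1 z) \<notin> D}"
  have dec: "dec (\<lambda>z. pi1 (pi1 z) \<notin> D)"
    by (intro dec_not dec_finite assms computable_intros)
  have col_H: "col i \<preceq> H" if "i \<notin> D" for i
    by (rule e_reducibleI[OF eop_mem, of "\<lambda>z. pair (pair i (pi1 z)) (pi2 z)"])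
      (use that in \<open>auto simp: col_def all_cols_def total_graph_def H_def intro!: computable_intros\<close>)
  have not_H: "\<not> col i \<preceq> H" if i: "i \<in> D" for i
  proof
    assume "col i \<preceq> H"
    let ?C = "code_graph (column_sum {j. j \<noteq> i} (column (\<lambda>x. Some (g x))))"
    have C: "z \<in> ?C \<longleftrightarrow> pi2 z = (if pi1 (pi1 z) = i then 0 else g (pi1 z))" for z
      by (auto simp: mem_code_graph column_sum_eq column_def pair_def[symmetric])
    \<comment> \<open>As \<open>i\<close> is in \<open>D\<close>, the set \<open>H\<close> omits
      column \<open>i\<close> and is a decidable part of the column sum without \<open>i\<close>, to
      which independence applies.\<close>
    have "H = ?C \<inter> {z. pi1 (pi1 z) \<notin> D}"
      unfolding set_eq_iff Int_iff C using i by (auto simp: H_def all_cols_def total_graph_def)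
    then have "H \<preceq> ?C" using e_reducible_Int_dec[of "{z. pi1 (pi1 z) \<notin> D}" ?C] dec by simp
    with \<open>col i \<preceq> H\<close> have "col i \<preceq> ?C" by (rule e_reducible_trans)
    with independent show False
      unfolding computably_e_independent_def pfun_e_le_def code_graph_column by blast
  qed
  obtain f where f: "H \<preceq> f" "\<And>j. j \<in> D \<Longrightarrow> \<not> col j \<preceq> f" "\<And>j. j \<in> D \<Longrightarrow> all_cols \<preceq> f \<oplus>\<^sub>e col j"
    using exists_coding_set_all_keys[OF assms, of "\<lambda>i x. g (pair i x)" H all_cols] not_H
    unfolding col_def by metis
  show thesis
    by (rule that[of f]) (use f col_H e_reducible_trans in blast)+
qed

definition above :: "nat \<Rightarrow> nat set set" where
  "above i = {B. col i \<preceq> B}"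

lemma upclosed_above: "upclosed (above i)"
  unfolding upclosed_def above_def using e_reducible_trans by blast

end

text \<open>\<open>D v\<close> holds the columns that vertex \<open>v\<close> misses. Nonemptiness
  keeps the vertex strictly below \<open>all_cols\<close>; injectivity makes any two vertices
  jointly compute it.\<close>

locale vertices = independent_columns +
  fixes D :: "nat \<Rightarrow> nat set"
  assumes finite_D: "finite (D v)" and D_nonempty: "D v \<noteq> {}" and inj_D: "inj D"
begin

definition vert :: "nat \<Rightarrow> nat set" where
  "vert v = (SOME f. (\<forall>i. i \<notin> D v \<longrightarrow> col i \<preceq> f) \<and>
    (\<forall>i\<in>D v. \<not> col i \<preceq> f \<and> all_cols \<preceq> f \<oplus>\<^sub>e col i))"

lemma vert: "i \<notin> D v \<Longrightarrow> col i \<preceq> vert v"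
  "i \<in> D v \<Longrightarrow> \<not> col i \<preceq> vert v" "i \<in> D v \<Longrightarrow> all_cols \<preceq> vert v \<oplus>\<^sub>e col i"
proof -
  have "\<exists>f. (\<forall>i. i \<notin> D v \<longrightarrow> col i \<preceq> f) \<and> (\<forall>i\<in>D v. \<not> col i \<preceq> f \<and> all_cols \<preceq> f \<oplus>\<^sub>e col i)"
    using exists_coded[OF finite_D[of v]] by metis
  from someI_ex[OF this, folded vert_def]
  show "i \<notin> D v \<Longrightarrow> col i \<preceq> vert v" "i \<in> D v \<Longrightarrow> \<not> col i \<preceq> vert v"
    "i \<in> D v \<Longrightarrow> all_cols \<preceq> vert v \<oplus>\<^sub>e col i" by blast+
qed

lemma all_cols_le: "i \<in> D v \<Longrightarrow> vert v \<preceq> B \<Longrightarrow> col i \<preceq> B \<Longrightarrow> all_cols \<preceq> B"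
  using e_reducible_trans[OF vert(3) osum_least] by blast

text \<open>A column in the symmetric difference of \<open>D v\<close> and \<open>D w\<close> is
  computed by one of the vertices and is a key for the other.\<close>

lemma all_cols_le_if_two:
  assumes "v \<noteq> w" "vert v \<preceq> B" "vert w \<preceq> B"
  shows "all_cols \<preceq> B"
proof -
  have "D v \<noteq> D w" using assms(1) inj_D by (auto dest: injD)
  then obtain i where "i \<in> D v \<and> i \<notin> D w \<or> i \<in> D w \<and> i \<notin> D v" by blast
  then show ?thesis
    using assms(2,3) all_cols_le e_reducible_trans[OF vert(1)] by metis
qed

lemma not_all_cols_le_vert: "\<not> all_cols \<preceq> vert v"
  using D_nonempty[of v] vert(2) e_reducible_trans[OF col_all_cols] by blast

text \<open>Sets above \<open>all_cols\<close> belong to every class: two distinct vertices together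
  reach exactly these, which makes \<open>cls\<close> commute with intersection.\<close>

definition cls :: "nat set \<Rightarrow> nat set set" where
  "cls X = {B. all_cols \<preceq> B \<or> (\<exists>v\<in>X. vert v \<preceq> B)}"

lemma upclosed_cls: "upclosed (cls X)"
  unfolding upclosed_def cls_def using e_reducible_trans by blast

lemma cls_nonempty: "cls X \<noteq> {}"
  unfolding cls_def using e_reducible_refl by blast

lemma cls_mono: "X \<subseteq> Y \<Longrightarrow> cls X \<subseteq> cls Y"
  unfolding cls_def by blast

lemma cls_Int: "cls X \<inter> cls Y = cls (X \<inter> Y)"
proof
  show "cls X \<inter> cls Y \<subseteq> cls (X \<inter> Y)"
  proof
    fix B assume B: "B \<in> cls X \<inter> cls Y"
    show "B \<in> cls (X \<inter> Y)"
    proof (cases "all_cols \<preceq> B")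
      case False
      with B obtain v w where "v \<in> X" "vert v \<preceq> B" "w \<in> Y" "vert w \<preceq> B" by (auto simp: cls_def)
      with False show ?thesis using all_cols_le_if_two[of v w B] by (auto simp: cls_def)
    qed (simp add: cls_def)
  qed
qed (simp add: cls_mono)

lemma cls_subset_above: "(\<And>v. v \<in> X \<Longrightarrow> i \<notin> D v) \<Longrightarrow> cls X \<subseteq> above i"
  unfolding cls_def above_def using e_reducible_trans col_all_cols vert(1) by blast

lemma vert_in_cls_iff: "vert v \<in> cls X \<longleftrightarrow> v \<in> X"
  unfolding cls_def using not_all_cols_le_vert all_cols_le_if_two[of v _ "vert v"] by fastforce

lemma cls_subsetD: "cls X \<subseteq> cls Y \<Longrightarrow> X \<subseteq> Y"
  using vert_in_cls_iff by blast

lemma cls_subset_aboveD: "cls X \<subseteq> above i \<Longrightarrow> v \<in> X \<Longrightarrow> i \<notin> D v"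
  using vert_in_cls_iff vert(2) unfolding above_def by blast

lemma osum_self: "B \<oplus>\<^sub>e B \<preceq> B"
  by (simp add: osum_least)

text \<open>The Boolean implication: if \<open>C\<close> is in \<open>cls X\<close>, take
  \<open>B = C\<close>; otherwise \<open>C\<close> computes a vertex outside
  \<open>X\<close>.\<close>

lemma cls_imp_cls:
  assumes "C \<in> cls UNIV" "\<And>B. B \<in> cls X \<Longrightarrow> B \<oplus>\<^sub>e C \<in> cls Y"
  shows "C \<in> cls (Y \<union> - X)"
proof (cases "C \<in> cls X")
  case True
  with assms(2) have "C \<in> cls Y" using upclosedD[OF upclosed_cls _ osum_self] by blast
  then show ?thesis using cls_mono[of Y] by blast
qed (use assms(1) in \<open>auto simp: cls_def\<close>)

text \<open>If \<open>C\<close> computes column \<open>i\<close> and a vertex, then either the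
  vertex does not miss \<open>i\<close>, or the column acts as its key and \<open>C\<close> computes
  \<open>all_cols\<close>.\<close>

lemma cls_imp_above:
  assumes "C \<in> cls UNIV" "\<And>B. B \<in> cls X \<Longrightarrow> B \<oplus>\<^sub>e C \<in> above i"
  shows "C \<in> cls ({v. i \<notin> D v} \<union> - X)"
proof (cases "C \<in> cls X")
  case True
  with assms(2) have "C \<in> above i" using upclosedD[OF upclosed_above _ osum_self] by blast
  then show ?thesis using assms(1) all_cols_le unfolding cls_def above_def by blast
qed (use assms(1) in \<open>auto simp: cls_def\<close>)

end

section \<open>Finite countermodels\<close>

inductive der :: "form set \<Rightarrow> form \<Rightarrow> bool" for \<Gamma> where
  hyp: "p \<in> \<Gamma> \<Longrightarrow> der \<Gamma> p"
| axiom: "p \<in> IPC \<Longrightarrow> der \<Gamma> p"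
| der_mp: "der \<Gamma> (Imp p q) \<Longrightarrow> der \<Gamma> p \<Longrightarrow> der \<Gamma> q"

lemma der_empty: "der {} p \<Longrightarrow> p \<in> IPC"
  by (induction rule: der.induct) (auto intro: IPC.mp)

lemma der_thm_mp: "Imp p q \<in> IPC \<Longrightarrow> der \<Gamma> p \<Longrightarrow> der \<Gamma> q"
  by (blast intro: der.intros)

lemma deduction: "der (insert a \<Gamma>) q \<Longrightarrow> der \<Gamma> (Imp a q)"
proof (induction rule: der.induct)
  case (hyp p)
  show ?case
  proof (cases "p = a")
    case True
    have "Imp a a \<in> IPC" using IPC.mp[OF IPC.mp[OF IPC.S IPC.K] IPC.K[of a a]] .
    then show ?thesis unfolding True by (rule der.axiom)
  next
    case False
    with hyp show ?thesis by (blast intro: der_thm_mp[OF IPC.K] der.hyp)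
  qed
next
  case (axiom p)
  then show ?case by (blast intro: der_thm_mp[OF IPC.K] der.axiom)
next
  case (der_mp p q)
  then show ?case by (blast intro: der_thm_mp[OF IPC.S] der.der_mp)
qed

lemma der_cut: "der (insert a \<Gamma>) q \<Longrightarrow> der \<Gamma> a \<Longrightarrow> der \<Gamma> q"
  using deduction der.der_mp by blast

lemma der_Neg: "der \<Gamma> (Neg p) \<Longrightarrow> der \<Gamma> p \<Longrightarrow> der \<Gamma> q"
  by (blast intro: der.intros IPC.neg_elim)

lemma der_Or:
  assumes "der (insert a \<Gamma>) q" "der (insert b \<Gamma>) q" "der \<Gamma> (Or a b)"
  shows "der \<Gamma> q"
  using assms(3) deduction[OF assms(1)] deduction[OF assms(2)]
  by (blast intro: der.intros IPC.or_elim)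

primrec subs :: "form \<Rightarrow> form set" where
  "subs (Atom n) = {Atom n}"
| "subs (Or p q) = insert (Or p q) (subs p \<union> subs q)"
| "subs (And p q) = insert (And p q) (subs p \<union> subs q)"
| "subs (Imp p q) = insert (Imp p q) (subs p \<union> subs q)"
| "subs (Neg p) = insert (Neg p) (subs p)"

lemma finite_subs: "finite (subs p)"
  by (induction p) auto

lemma subs_refl: "p \<in> subs p"
  by (cases p) auto

lemma subs_trans: "q \<in> subs p \<Longrightarrow> r \<in> subs q \<Longrightarrow> r \<in> subs p"
  by (induction p) auto

lemma subs_closed:
  "Or a b \<in> subs p \<Longrightarrow> a \<in> subs p" "Or a b \<in> subs p \<Longrightarrow> b \<in> subs p"
  "And a b \<in> subs p \<Longrightarrow> a \<in> subs p" "And a b \<in> subs p \<Longrightarrow> b \<in> subs p"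
  "Imp a b \<in> subs p \<Longrightarrow> a \<in> subs p" "Imp a b \<in> subs p \<Longrightarrow> b \<in> subs p"
  "Neg a \<in> subs p \<Longrightarrow> a \<in> subs p"
  by (erule subs_trans; simp add: subs_refl)+

text \<open>Prime theories relative to \<open>S\<close>. Formulas have no falsity constant, so
  consistency is the existence of an underivable formula.\<close>

definition world :: "form set \<Rightarrow> form set \<Rightarrow> bool" where
  "world S w \<longleftrightarrow> w \<subseteq> S \<and> (\<forall>q\<in>S. der w q \<longrightarrow> q \<in> w) \<and>
    (\<forall>a b. Or a b \<in> w \<longrightarrow> a \<in> w \<or> b \<in> w) \<and> (\<exists>q. \<not> der w q)"

text \<open>A maximal subset of \<open>S\<close> not deriving \<open>q\<close> is prime, since
  otherwise both disjuncts would derive \<open>q\<close>; finiteness of \<open>S\<close> provides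
  it.\<close>

lemma exists_world:
  assumes "finite S" "\<Gamma> \<subseteq> S" "\<not> der \<Gamma> q" and closed: "\<And>a b. Or a b \<in> S \<Longrightarrow> a \<in> S \<and> b \<in> S"
  obtains w where "world S w" "\<Gamma> \<subseteq> w" "\<not> der w q"
proof -
  let ?X = "{w. w \<subseteq> S \<and> \<Gamma> \<subseteq> w \<and> \<not> der w q}"
  have "?X \<subseteq> Pow S" by blast
  from finite_subset[OF this] have fin: "finite ?X" using assms(1) by simp
  have mem: "\<Gamma> \<in> ?X" using assms(2,3) by simp
  obtain w where "w \<in> ?X" "\<Gamma> \<subseteq> w \<and> (\<forall>v\<in>?X. w \<le> v \<longrightarrow> w = v)"
    by (rule bexE[OF finite_has_maximal2[OF fin mem]])
  then have m: "\<forall>v\<in>?X. w \<le> v \<longrightarrow> w = v" and w: "w \<subseteq> S" "\<Gamma> \<subseteq> w" "\<not> der w q" by simp_all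
  have max: "a \<in> w" if "a \<in> S" "\<not> der (insert a w) q" for a
    using m[rule_format, of "insert a w"] w that by auto
  have "world S w"
    unfolding world_def
  proof (intro conjI ballI allI impI)
    show "\<exists>q. \<not> der w q" "w \<subseteq> S" using w by blast+
    show "a \<in> w" if "a \<in> S" "der w a" for a
      using max[OF that(1)] der_cut[OF _ that(2)] w(3) by blast
    show "a \<in> w \<or> b \<in> w" if "Or a b \<in> w" for a b
      using max[of a] max[of b] closed[of a b] der_Or[of a w q b] der.hyp[OF that] w(1,3) that by blast
  qed
  with w(2,3) that show thesis by blast
qed

text \<open>
  Kripke forcing over the subsets of \<open>{..<N}\<close> ordered by inclusion, where the sets satisfying \<open>X\<close>
  are exploding: they force every formula.
\<close>

primrec sat :: "nat \<Rightarrow> (nat set \<Rightarrow> bool) \<Rightarrow> (nat \<Rightarrow> nat set \<Rightarrow> bool) \<Rightarrow> form \<Rightarrow> nat set \<Rightarrow> bool" where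
  "sat N X V (Atom n) G \<longleftrightarrow> V n G"
| "sat N X V (Or p q) G \<longleftrightarrow> sat N X V p G \<or> sat N X V q G"
| "sat N X V (And p q) G \<longleftrightarrow> sat N X V p G \<and> sat N X V q G"
| "sat N X V (Imp p q) G \<longleftrightarrow> (\<forall>C\<subseteq>{..<N}. G \<subseteq> C \<longrightarrow> sat N X V p C \<longrightarrow> sat N X V q C)"
| "sat N X V (Neg p) G \<longleftrightarrow> (\<forall>C\<subseteq>{..<N}. G \<subseteq> C \<longrightarrow> sat N X V p C \<longrightarrow> X C)"

text \<open>\<open>X_V\<close> and monotonicity make exploding sets force every formula.
  \<open>X_0\<close> yields the exploding sets that separate the vertices, and
  \<open>not_X_empty\<close> leaves every column missing at some vertex.\<close>

locale exploding_model =
  fixes N :: nat and X :: "nat set \<Rightarrow> bool" and V :: "nat \<Rightarrow> nat set \<Rightarrow> bool"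
  assumes N_pos: "0 < N"
    and X_mono: "G \<subseteq> H \<Longrightarrow> X G \<Longrightarrow> X H"
    and V_mono: "G \<subseteq> H \<Longrightarrow> V n G \<Longrightarrow> V n H"
    and X_V: "X G \<Longrightarrow> V n G"
    and X_0: "X {0}"
    and not_X_empty: "\<not> X {}"

text \<open>
  The nerve of a finite rooted Kripke frame: a chain of worlds different from the root is mapped to
  its largest element and the empty chain to the root; all other sets of worlds explode.
\<close>

theorem exploding_countermodel:
  assumes "p \<notin> IPC"
  obtains N X V where "exploding_model N X V" "\<not> sat N X V p {}"
proof -
  have "\<not> der {} p" using assms der_empty by blast
  have lindenbaum: "\<exists>w. world (subs p) w \<and> \<Gamma> \<subseteq> w \<and> \<not> der w q"
    if "\<Gamma> \<subseteq> subs p" "\<not> der \<Gamma> q" for \<Gamma> q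
    by (rule exists_world[OF finite_subs that]) (auto dest: subs_closed(1,2))
  from lindenbaum[OF empty_subsetI \<open>\<not> der {} p\<close>]
  obtain r where r: "world (subs p) r" "\<not> der r p" by blast
  define W where "W = {w. world (subs p) w \<and> r \<subseteq> w}"
  have "W \<subseteq> Pow (subs p)" by (auto simp: W_def world_def)
  then have "finite W" using finite_subs finite_subset by blast
  then obtain M and e0 :: "nat \<Rightarrow> form set" where e0: "W = e0 ` {i. i < M}"
    unfolding finite_conv_nat_seg_image by blast
  have "r \<in> W" using r(1) by (simp add: W_def)
  \<comment> \<open>Index 0 is an extra name of the root, reserved for exploding, which yields
    \<open>X {0}\<close>; the root may have further, positive indices.\<close>
  define N where "N = Suc M"
  define e where "e = case_nat r e0"
  have e: "e ` {..<N} = W"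
    unfolding N_def lessThan_Suc_eq_insert_0 image_insert image_image
    using \<open>r \<in> W\<close> by (auto simp: e_def e0)
  have e_0: "e 0 = r" by (simp add: e_def)
  have eW: "e x \<in> W" if "x < N" for x
    using e that by blast
  define X where "X G \<longleftrightarrow> 0 \<in> G \<or> (\<exists>x\<in>G. \<exists>y\<in>G. \<not> e x \<subseteq> e y \<and> \<not> e y \<subseteq> e x)" for G
  define f where "f G = r \<union> \<Union> (e ` G)" for G
  define V where "V n G \<longleftrightarrow> X G \<or> Atom n \<in> f G" for n G
  have f_mono: "f G \<subseteq> f H" if "G \<subseteq> H" for G H using that by (auto simp: f_def)
  have X_mono: "X H" if "G \<subseteq> H" "X G" for G H using that unfolding X_def by blast
  have fW: "f G \<in> W" if G: "G \<subseteq> {..<N}" "\<not> X G" for G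
  proof (cases "G = {}")
    case True
    then show ?thesis using \<open>r \<in> W\<close> by (simp add: f_def)
  next
    case False
    have "finite (e ` G)" using G(1) finite_subset by blast
    then obtain x where x: "x \<in> G" "\<And>y. y \<in> G \<Longrightarrow> e x \<subseteq> e y \<Longrightarrow> e y = e x"
      using finite_has_maximal[of "e ` G"] False by (metis (no_types, opaque_lifting) image_iff image_is_empty)
    have "e y \<subseteq> e x" if "y \<in> G" for y
      using x that G(2) unfolding X_def by blast
    moreover have "r \<subseteq> e x" using eW[of x] x(1) G(1) by (auto simp: W_def)
    ultimately have "f G = e x" using x(1) by (auto simp: f_def)
    then show ?thesis using eW[of x] x(1) G(1) by auto
  qed
  \<comment> \<open>The back condition for the map \<open>f\<close>: adding one index of
    \<open>y\<close> suffices, because all members of \<open>G\<close> name worlds below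
    \<open>y\<close> and the set stays a chain.\<close>
  have step: "\<exists>C\<subseteq>{..<N}. G \<subseteq> C \<and> \<not> X C \<and> f C = y"
    if G: "G \<subseteq> {..<N}" "\<not> X G" and y: "y \<in> W" "f G \<subseteq> y" for G y
  proof (cases "y = f G")
    case True
    then show ?thesis using G by blast
  next
    case False
    obtain x where x: "x < N" "e x = y" using e y(1) by blast
    have le: "e z \<subseteq> y" if "z \<in> G" for z using y(2) that by (auto simp: f_def)
    have "x \<noteq> 0" using False y(2) x(2) by (auto simp: e_0 f_def)
    then have "\<not> X (insert x G)" using G(2) le by (auto simp: X_def x(2))
    moreover have "f (insert x G) = y" using y(2) x(2) by (auto simp: f_def)
    ultimately show ?thesis using G(1) x(1) by (intro exI[of _ "insert x G"]) auto
  qed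
  have wd: "world (subs p) w" if "w \<in> W" for w using that by (simp add: W_def)
  have in_world: "q \<in> w" if "w \<in> W" "q \<in> subs p" "der w q" for w q
    using wd[OF that(1)] that(2,3) by (simp add: world_def)
  have extend: "\<exists>y\<in>W. insert a w \<subseteq> y \<and> b \<notin> y"
    if w: "w \<in> W" "a \<in> subs p" "\<not> der (insert a w) b" for w a b
  proof -
    have "insert a w \<subseteq> subs p" using wd[OF w(1)] w(2) by (auto simp: world_def)
    then obtain y where "world (subs p) y" "insert a w \<subseteq> y" "\<not> der y b"
      using lindenbaum[OF _ w(3)] by blast
    then show ?thesis using w(1) der.hyp by (intro bexI[of _ y]) (auto simp: W_def)
  qed
  have truth: "sat N X V q G \<longleftrightarrow> X G \<or> q \<in> f G" if "q \<in> subs p" "G \<subseteq> {..<N}" for q G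
    using that
  proof (induction q arbitrary: G)
    case (Atom n)
    then show ?case by (simp add: V_def)
  next
    case (Or a b)
    have ab: "a \<in> subs p" "b \<in> subs p" using subs_closed Or.prems(1) by blast+
    have "Or a b \<in> f G \<longleftrightarrow> a \<in> f G \<or> b \<in> f G" if "\<not> X G"
    proof -
      have w: "f G \<in> W" using fW that Or.prems(2) by blast
      then have "Or a b \<in> f G \<Longrightarrow> a \<in> f G \<or> b \<in> f G" using wd[OF w] unfolding world_def by blast
      moreover have "der (f G) (Or a b)" if "a \<in> f G \<or> b \<in> f G"
        using that der.hyp der_thm_mp[OF IPC.or_intro1] der_thm_mp[OF IPC.or_intro2] by blast
      ultimately show ?thesis using in_world[OF w Or.prems(1)] by blast
    qed
    then show ?case using Or.IH(1)[OF ab(1) Or.prems(2)] Or.IH(2)[OF ab(2) Or.prems(2)] by auto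
  next
    case (And a b)
    have ab: "a \<in> subs p" "b \<in> subs p" using subs_closed And.prems(1) by blast+
    have "And a b \<in> f G \<longleftrightarrow> a \<in> f G \<and> b \<in> f G" if "\<not> X G"
    proof -
      have w: "f G \<in> W" using fW that And.prems(2) by blast
      have "der (f G) a \<and> der (f G) b" if "And a b \<in> f G"
        using der.hyp[OF that] der_thm_mp[OF IPC.and_elim1] der_thm_mp[OF IPC.and_elim2] by blast
      moreover have "der (f G) (And a b)" if "a \<in> f G" "b \<in> f G"
        using der.der_mp[OF der_thm_mp[OF IPC.and_intro der.hyp[OF that(1)]] der.hyp[OF that(2)]] .
      ultimately show ?thesis using in_world[OF w] ab And.prems(1) by blast
    qed
    then show ?case using And.IH(1)[OF ab(1) And.prems(2)] And.IH(2)[OF ab(2) And.prems(2)] by auto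
  next
    case (Imp a b)
    have ab: "a \<in> subs p" "b \<in> subs p" using subs_closed Imp.prems(1) by blast+
    show ?case
    proof
      assume sat: "sat N X V (Imp a b) G"
      show "X G \<or> Imp a b \<in> f G"
      proof (rule ccontr)
        assume "\<not> (X G \<or> Imp a b \<in> f G)"
        then have G: "\<not> X G" "Imp a b \<notin> f G" by auto
        have w: "f G \<in> W" by (rule fW[OF Imp.prems(2) G(1)])
        have "\<not> der (insert a (f G)) b" using in_world[OF w Imp.prems(1)] deduction G(2) by blast
        then obtain y where y: "y \<in> W" "insert a (f G) \<subseteq> y" "b \<notin> y" using extend[OF w ab(1)] by blast
        then obtain C where C: "C \<subseteq> {..<N}" "G \<subseteq> C" "\<not> X C" "f C = y"
          using step[OF Imp.prems(2) G(1) y(1)] by blast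
        then have "sat N X V a C" using Imp.IH(1)[OF ab(1) C(1)] y(2) by blast
        then have "sat N X V b C" using sat C(1,2) by simp
        then show False using Imp.IH(2)[OF ab(2) C(1)] C(3,4) y(3) by blast
      qed
    next
      assume G: "X G \<or> Imp a b \<in> f G"
      show "sat N X V (Imp a b) G"
        unfolding sat.simps
      proof (intro allI impI)
        fix C assume C: "C \<subseteq> {..<N}" "G \<subseteq> C" "sat N X V a C"
        show "sat N X V b C"
        proof (cases "X C")
          case False
          have w: "f C \<in> W" by (rule fW[OF C(1) False])
          have "a \<in> f C" using C(3) Imp.IH(1)[OF ab(1) C(1)] False by blast
          moreover have "Imp a b \<in> f C" using G X_mono[OF C(2)] f_mono[OF C(2)] False by blast
          ultimately have "der (f C) b" by (blast intro: der.intros)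
          then show ?thesis using in_world[OF w ab(2)] Imp.IH(2)[OF ab(2) C(1)] by blast
        qed (use Imp.IH(2)[OF ab(2) C(1)] in blast)
      qed
    qed
  next
    case (Neg a)
    have a: "a \<in> subs p" using subs_closed Neg.prems(1) by blast
    show ?case
    proof
      assume sat: "sat N X V (Neg a) G"
      show "X G \<or> Neg a \<in> f G"
      proof (rule ccontr)
        assume "\<not> (X G \<or> Neg a \<in> f G)"
        then have G: "\<not> X G" "Neg a \<notin> f G" by auto
        have w: "f G \<in> W" by (rule fW[OF Neg.prems(2) G(1)])
        \<comment> \<open>An underivable \<open>b\<close> stands in for falsity; if there were none,
          \<open>neg_intro\<close> applied to \<open>Imp a a\<close> and
          \<open>Imp a (Neg a)\<close> would yield \<open>Neg a\<close>.\<close>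
        have "\<exists>b. \<not> der (insert a (f G)) b"
        proof (rule ccontr)
          assume "\<not> ?thesis"
          then have "der (f G) (Imp a a)" "der (f G) (Imp a (Neg a))" using deduction by blast+
          then have "der (f G) (Neg a)" by (blast intro: der.intros IPC.neg_intro)
          then show False using in_world[OF w Neg.prems(1)] G(2) by blast
        qed
        then obtain b where "\<not> der (insert a (f G)) b" by blast
        then obtain y where y: "y \<in> W" "insert a (f G) \<subseteq> y" using extend[OF w a] by blast
        then obtain C where C: "C \<subseteq> {..<N}" "G \<subseteq> C" "\<not> X C" "f C = y"
          using step[OF Neg.prems(2) G(1) y(1)] by blast
        then have "sat N X V a C" using Neg.IH[OF a C(1)] y(2) by blast
        then show False using sat C(1,2,3) by simp
      qed
    next
      assume G: "X G \<or> Neg a \<in> f G"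
      show "sat N X V (Neg a) G"
        unfolding sat.simps
      proof (intro allI impI)
        fix C assume C: "C \<subseteq> {..<N}" "G \<subseteq> C" "sat N X V a C"
        show "X C"
        proof (rule ccontr)
          assume nX: "\<not> X C"
          have "a \<in> f C" using C(3) Neg.IH[OF a C(1)] nX by blast
          moreover have "Neg a \<in> f C" using G X_mono[OF C(2)] f_mono[OF C(2)] nX by blast
          ultimately have "der (f C) q" for q by (blast intro: der_Neg der.hyp)
          then show False using wd[OF fW[OF C(1) nX]] unfolding world_def by blast
        qed
      qed
    qed
  qed
  show thesis
  proof
    show "exploding_model N X V"
    proof
      show "V n H" if "G \<subseteq> H" "V n G" for G H n
        using that X_mono f_mono unfolding V_def by blast
      show "X H" if "G \<subseteq> H" "X G" for G H by (rule X_mono[OF that])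
    qed (simp_all add: N_def V_def X_def)
    have "f {} = r" "\<not> X {}" by (simp_all add: f_def X_def)
    then show "\<not> sat N X V p {}"
      using truth[OF subs_refl, of "{}"] r(2) der.hyp by auto
  qed
qed

section \<open>The refuting valuation\<close>

text \<open>Translations of finitely many tags may thus be chosen non-constructively.\<close>

lemma computable_finite_table:
  "finite S \<Longrightarrow> computable f \<Longrightarrow> computable (\<lambda>x. if x \<in> S then t x else f x)"
proof (induction S rule: finite_induct)
  case (insert a S)
  have "computable (\<lambda>x. if x = a then t a else if x \<in> S then t x else f x)"
    by (intro computable_If dec_eq computable_intros insert.IH insert.prems)
  moreover have "(if x = a then t a else if x \<in> S then t x else f x) = (if x \<in> insert a S then t x else f x)" for x
    by simp
  ultimately show ?case by simp
qed simp

lemma less_exp_if_set_decode: "set_decode n \<subseteq> {..<N} \<Longrightarrow> n < 2 ^ N"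
proof (rule ccontr)
  assume N: "set_decode n \<subseteq> {..<N}" and "\<not> n < 2 ^ N"
  have "n = (\<Sum>i\<in>set_decode n. 2 ^ i)"
    using set_decode_inverse[of n] by (simp add: set_encode_def)
  also have "\<dots> \<le> (\<Sum>i<N. 2 ^ i)" using N by (intro sum_mono2) auto
  also have "\<dots> < 2 ^ N" by (induction N) auto
  finally show False using \<open>\<not> n < 2 ^ N\<close> by simp
qed

lemma set_decode_subset: "n < 2 ^ N \<Longrightarrow> set_decode n \<subseteq> {..<N}"
proof
  fix x assume "n < 2 ^ N" "x \<in> set_decode n"
  then have "n div 2 ^ x \<noteq> 0" using odd_pos[of "n div 2 ^ x"] by (simp add: set_decode_def)
  then have "2 ^ x \<le> n" by (metis div_less not_le)
  then have "(2::nat) ^ x < 2 ^ N" using \<open>n < 2 ^ N\<close> by linarith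
  then show "x \<in> {..<N}" by simp
qed

lemma set_encode_less: "G \<subseteq> {..<N} \<Longrightarrow> set_encode G < 2 ^ N"
  by (rule less_exp_if_set_decode) (metis finite_lessThan finite_subset set_encode_inverse)

locale refutation = independent_columns g + exploding_model N X V
  for g :: "nat \<Rightarrow> nat" and N X V
begin

text \<open>
  Column \<open>j < 2 ^ N\<close> is solved exactly by the vertices outside the exploding set \<open>blocker j\<close>, column
  \<open>i \<ge> 2 ^ N\<close> by all vertices but \<open>N + (i - 2 ^ N)\<close>.
\<close>

definition blocker :: "nat \<Rightarrow> nat set" where
  "blocker j = (if X (set_decode j) then set_decode j else {0})"

definition missing :: "nat \<Rightarrow> nat set" where
  "missing v = (if v < N then {j. j < 2 ^ N \<and> v \<in> blocker j} else {2 ^ N + (v - N)})"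

lemma X_blocker: "X (blocker j)"
  by (simp add: blocker_def X_0)

lemma blocker_nonempty: "blocker j \<noteq> {}"
  using X_blocker[of j] not_X_empty by metis

lemma blocker_subset: "j < 2 ^ N \<Longrightarrow> blocker j \<subseteq> {..<N}"
  using set_decode_subset[of j N] N_pos by (auto simp: blocker_def)

text \<open>An exploding set is the blocker of its own canonical index; indices of other sets
  receive the default \<open>{0}\<close>, which explodes by \<open>X_0\<close>.\<close>

lemma exists_blocker:
  assumes "X G" "G \<subseteq> {..<N}" obtains j where "j < 2 ^ N" "blocker j = G"
proof -
  have "finite G" using assms(2) finite_subset by blast
  then show thesis
    using that[of "set_encode G"] assms set_encode_less by (simp add: blocker_def)
qed

lemma missing_iff:
  "i < 2 ^ N \<Longrightarrow> i \<in> missing v \<longleftrightarrow> v \<in> blocker i"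
  "2 ^ N \<le> i \<Longrightarrow> i \<in> missing v \<longleftrightarrow> v = N + (i - 2 ^ N)"
  using blocker_subset[of i] by (auto simp: missing_def)

sublocale vertices g missing
proof
  show "finite (missing v)" for v
    by (auto simp: missing_def intro: finite_subset[of _ "{..<2 ^ N}"])
  \<comment> \<open>The set \<open>{0, v}\<close> explodes and contains, apart from 0, only
    \<open>v\<close>; its column therefore separates \<open>v\<close> from every other vertex
    \<open>w\<close> except 0.\<close>
  have ex: "\<exists>j<2 ^ N. v \<in> blocker j \<and> (w = v \<or> w \<notin> blocker j)" if vw: "v < N" "w \<noteq> 0 \<or> v = 0" for v w
  proof -
    have "X {0, v}" by (rule X_mono[OF _ X_0]) simp
    moreover have "{0, v} \<subseteq> {..<N}" using vw N_pos by simp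
    ultimately obtain j where j: "j < 2 ^ N" "blocker j = {0, v}" by (rule exists_blocker)
    show ?thesis using vw(2) by (intro exI[of _ j] conjI j(1)) (auto simp: j(2))
  qed
  show "missing v \<noteq> {}" for v
    using ex[of v v] ex[of 0 0] N_pos by (cases "v = 0") (auto simp: missing_def)
  have neq: "missing v \<noteq> missing w" if "v \<noteq> w" for v w
  proof (cases "v < N \<and> w < N")
    case True
    have *: "missing v \<noteq> missing w" if vw: "v \<noteq> w" "v < N" "w \<noteq> 0" for v w
    proof -
      obtain j where "j < 2 ^ N" "v \<in> blocker j" "w \<notin> blocker j" using ex[of v w] vw by blast
      then have "j \<in> missing v" "j \<notin> missing w" by (auto simp: missing_iff)
      then show ?thesis by blast
    qed
    show ?thesis using *[of v w] *[of w v] True that by (cases "w = 0") auto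
  next
    case False
    \<comment> \<open>The larger vertex is at least \<open>N\<close>, and its private column is
      missing nowhere else.\<close>
    define u where "u = max v w"
    have u: "N \<le> u" using False by (auto simp: u_def)
    then have "2 ^ N + (u - N) \<in> missing x \<longleftrightarrow> x = u" for x
      by (subst missing_iff(2)) auto
    then show ?thesis using that unfolding u_def by (metis max_def)
  qed
  show "inj missing" unfolding inj_def using neq by blast
qed

text \<open>
  Tags \<open>n < 2 ^ N\<close> stand for subsets of \<open>{..<N}\<close>, the remaining tags for the columns of \<open>g\<close>.
\<close>

definition tag_cls :: "nat \<Rightarrow> nat set set" where
  "tag_cls n = (if n < 2 ^ N then cls (- set_decode n) else above (n - 2 ^ N))"

definition prob :: "(nat set \<Rightarrow> bool) \<Rightarrow> mass_problem" where
  "prob h = tagged {n. n < 2 ^ N \<longrightarrow> h (set_decode n)} tag_cls"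

text \<open>This is \<open>Z\<close>; as the greatest element of the interval it interprets
  falsity.\<close>

definition bot :: mass_problem where
  "bot = tagged UNIV above"

text \<open>Implications between classes are Boolean only inside \<open>cls UNIV\<close>, so values
  of formulas will be compared modulo this problem.\<close>

definition truth :: mass_problem where
  "truth = plain (cls UNIV)"

definition increasing :: "(nat set \<Rightarrow> bool) \<Rightarrow> bool" where
  "increasing h \<longleftrightarrow> (\<forall>G H. G \<subseteq> H \<longrightarrow> H \<subseteq> {..<N} \<longrightarrow> h G \<longrightarrow> h H)"

lemma increasingD: "increasing h \<Longrightarrow> G \<subseteq> H \<Longrightarrow> H \<subseteq> {..<N} \<Longrightarrow> h G \<Longrightarrow> h H"
  unfolding increasing_def by blast

section \<open>The connectives on the problems \<open>prob h\<close>\<close>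

lemma upclosed_tag_cls: "upclosed (tag_cls n)"
  by (simp add: tag_cls_def upclosed_cls upclosed_above)

lemma prob_mono: "(\<And>G. G \<subseteq> {..<N} \<Longrightarrow> h G \<Longrightarrow> k G) \<Longrightarrow> prob k \<le>\<^sub>D prob h"
  unfolding prob_def by (intro D_le_superset tagged_mono) (auto dest: set_decode_subset)

lemma prob_le_bot: "prob h \<le>\<^sub>D bot"
  unfolding prob_def bot_def
proof (rule tagged_reindex)
  show "computable (\<lambda>n. n + 2 ^ N)" by (intro computable_intros)
qed (auto simp: tag_cls_def upclosed_above)

text \<open>The tag of an exploding set is replaced by a column whose blocker is this set: all
  vertices outside the set compute that column.\<close>

lemma bot_le_prob_X: "bot \<le>\<^sub>D prob X"
proof -
  define t where "t n = (if n \<in> {..<2 ^ N} then (SOME j. j < 2 ^ N \<and> blocker j = set_decode n) else n - 2 ^ N)" for n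
  show ?thesis
    unfolding prob_def bot_def
  proof (rule tagged_reindex)
    show "computable t"
      unfolding t_def by (intro computable_finite_table computable_intros) simp
    fix n assume n: "n \<in> {n. n < 2 ^ N \<longrightarrow> X (set_decode n)}"
    have "tag_cls n \<subseteq> above (t n)"
    proof (cases "n < 2 ^ N")
      case True
      with n obtain j where "j < 2 ^ N" "blocker j = set_decode n"
        using exists_blocker[OF _ set_decode_subset[OF True]] by simp metis
      then have "\<exists>j. j < 2 ^ N \<and> blocker j = set_decode n" by blast
      from someI_ex[OF this] have "t n < 2 ^ N" "blocker (t n) = set_decode n"
        using True by (simp_all add: t_def)
      then show ?thesis
        using True cls_subset_above[of "- set_decode n" "t n"] by (simp add: tag_cls_def missing_iff)
    qed (simp add: tag_cls_def t_def)
    then show "t n \<in> UNIV \<and> tag_cls n \<subseteq> above (t n)" by simp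
  qed (rule upclosed_tag_cls)
qed

text \<open>Intersecting two classes unites the coded sets, and \<open>h\<close> and
  \<open>k\<close> persist to the union. If one tag is a column, a column is kept.\<close>

lemma prob_conj:
  assumes "increasing h" "increasing k"
  shows "prob (\<lambda>G. h G \<and> k G) \<le>\<^sub>D Dsup (prob h) (prob k)"
proof -
  define t where "t z = (if z \<in> (\<lambda>(a, b). pair a b) ` ({..<2 ^ N} \<times> {..<2 ^ N})
    then set_encode (set_decode (pi1 z) \<union> set_decode (pi2 z))
    else if pi1 z < 2 ^ N then pi2 z else pi1 z)" for z
  have t_eq: "t (pair a b) = (if a < 2 ^ N \<and> b < 2 ^ N then set_encode (set_decode a \<union> set_decode b)
    else if a < 2 ^ N then b else a)" for a b
    by (auto simp: t_def image_iff)
  show ?thesis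
    unfolding prob_def
  proof (rule tagged_join_le)
    show "computable t"
      unfolding t_def by (intro computable_finite_table computable_If dec_less computable_intros) simp
    fix a b assume ab: "a \<in> {n. n < 2 ^ N \<longrightarrow> h (set_decode n)}" "b \<in> {n. n < 2 ^ N \<longrightarrow> k (set_decode n)}"
    show "t (pair a b) \<in> {n. n < 2 ^ N \<longrightarrow> h (set_decode n) \<and> k (set_decode n)} \<and>
      tag_cls a \<inter> tag_cls b \<subseteq> tag_cls (t (pair a b))"
    proof (cases "a < 2 ^ N \<and> b < 2 ^ N")
      case True
      let ?u = "set_decode a \<union> set_decode b"
      have u: "?u \<subseteq> {..<N}" using True set_decode_subset by blast
      have "h ?u" "k ?u"
        using ab True by (auto intro: increasingD[OF assms(1) Un_upper1 u] increasingD[OF assms(2) Un_upper2 u])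
      moreover have "set_encode ?u < 2 ^ N" by (rule set_encode_less[OF u])
      ultimately show ?thesis
        using True cls_Int[of "- set_decode a" "- set_decode b"]
        by (simp add: t_eq tag_cls_def set_encode_inverse)
    next
      case False
      then show ?thesis by (auto simp: t_eq)
    qed
  qed (rule upclosed_tag_cls)+
qed

text \<open>Only finitely many tags fail \<open>h\<close>, so the side can be decided from the tag;
  column tags go left.\<close>

lemma prob_disj: "Dinf (prob h) (prob k) \<le>\<^sub>D prob (\<lambda>G. h G \<or> k G)"
proof -
  define S where "S = {n. n < 2 ^ N \<and> \<not> h (set_decode n)}"
  have S: "finite S" by (simp add: S_def)
  define P where "P A z \<longleftrightarrow> pi1 z = 0 \<and> (\<exists>n. pair 0 n \<in> A \<and> (n \<notin> S \<and> pi2 z = 0 \<or> n \<in> S \<and> pi2 z = 1)) \<or>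
    0 < pi1 z \<and> pair (pi1 z - 1) (pi2 z) \<in> A" for A z
  show ?thesis
    unfolding D_le_iff
  proof (intro exI[of _ P] conjI ballI)
    show "eop P"
      unfolding P_def[abs_def]
      by (intro eop_conj eop_disj eop_ex eop_mem eop_dec dec_conj dec_disj dec_not dec_eq dec_less
          dec_finite S computable_intros)
    fix \<chi> assume "\<chi> \<in> prob (\<lambda>G. h G \<or> k G)"
    then obtain n \<psi> where n: "\<chi> = prepend n \<psi>" "n < 2 ^ N \<longrightarrow> h (set_decode n) \<or> k (set_decode n)"
      "code_graph \<psi> \<in> tag_cls n"
      unfolding prob_def tagged_def by blast
    have P_eq: "{z. P (code_graph \<chi>) z} = code_graph (prepend (if n \<in> S then 1 else 0) \<chi>)"
      by (auto simp: P_def n(1) code_graph_prepend graph_prepend_def)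
    have "\<chi> \<in> prob h" if "n \<notin> S" using that n unfolding prob_def tagged_def S_def by blast
    moreover have "\<chi> \<in> prob k" if "n \<in> S" using that n unfolding prob_def tagged_def S_def by blast
    ultimately have "prepend (if n \<in> S then 1 else 0) \<chi> \<in> Dinf (prob h) (prob k)"
      by (auto simp: Dinf_def)
    with P_eq show "\<exists>\<phi>\<in>Dinf (prob h) (prob k). {z. P (code_graph \<chi>) z} = code_graph \<phi>" by blast
  qed
qed

text \<open>Stripping off \<open>plain (cls (- C))\<close> replaces each class by its implication
  from \<open>cls (- C)\<close>. Within \<open>cls UNIV\<close>, for a set \<open>G\<close> this is
  contained in the class of \<open>G - C\<close>, and for a column \<open>i < 2 ^ N\<close> in that
  of \<open>blocker i - C\<close>, where \<open>h\<close> holds because blockers explode.\<close>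

lemma prob_imp_step:
  assumes h: "increasing h" "\<And>G. G \<subseteq> {..<N} \<Longrightarrow> X G \<Longrightarrow> h G" and C: "C \<subseteq> {..<N}"
    and le: "prob h \<le>\<^sub>D Dsup (plain (cls (- C))) \<X>" and truth: "truth \<le>\<^sub>D \<X>"
  shows "prob (\<lambda>G. h (G \<union> C)) \<le>\<^sub>D \<X>"
proof -
  let ?S = "{n. n < 2 ^ N \<longrightarrow> h (set_decode n)}"
  let ?T = "\<lambda>n. {B. \<forall>A\<in>cls (- C). A \<oplus>\<^sub>e B \<in> tag_cls n}"
  have upT: "upclosed (?T n)" for n
    unfolding upclosed_def
    using upclosedD[OF upclosed_tag_cls _ osum_least[OF e_reducible_osum1 e_reducible_trans[OF _ e_reducible_osum2]]]
    by blast
  \<comment> \<open>Column tags \<open>2 ^ N + i\<close> with \<open>i < 2 ^ N\<close> turn into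
    sets, hence the table of length \<open>2 * 2 ^ N\<close>; later tags keep their column.\<close>
  define t where "t n = (if n \<in> {..<2 * 2 ^ N} then if n < 2 ^ N then set_encode (set_decode n - C)
    else set_encode (blocker (n - 2 ^ N) - C) else n)" for n
  have "prob (\<lambda>G. h (G \<union> C)) \<le>\<^sub>D tagged ?S (\<lambda>n. ?T n \<inter> cls UNIV)"
    unfolding prob_def
  proof (rule tagged_reindex)
    show "computable t"
      unfolding t_def by (intro computable_finite_table computable_intros) simp
    show "upclosed (?T n \<inter> cls UNIV)" for n
      using upT[of n] upclosed_cls[of UNIV] unfolding upclosed_def by blast
    have new: "set_encode (G - C) \<in> {n. n < 2 ^ N \<longrightarrow> h (set_decode n \<union> C)} \<and>
        tag_cls (set_encode (G - C)) = cls (- G \<union> C)" if "G \<subseteq> {..<N}" "h (G \<union> C)" for G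
    proof -
      have "finite (G - C)" using that(1) finite_subset by blast
      moreover have "- (G - C) = - G \<union> C" by blast
      moreover have "set_encode (G - C) < 2 ^ N" using that(1) by (intro set_encode_less) blast
      ultimately show ?thesis using that(2) by (simp add: tag_cls_def set_encode_inverse)
    qed
    fix n assume n: "n \<in> ?S"
    consider "n < 2 ^ N" | "2 ^ N \<le> n" "n - 2 ^ N < 2 ^ N" | "2 ^ N \<le> n" "2 ^ N \<le> n - 2 ^ N" by linarith
    then show "t n \<in> {n. n < 2 ^ N \<longrightarrow> h (set_decode n \<union> C)} \<and> ?T n \<inter> cls UNIV \<subseteq> tag_cls (t n)"
    proof cases
      case 1
      have G: "set_decode n \<subseteq> {..<N}" using 1 by (rule set_decode_subset)
      have "h (set_decode n \<union> C)" using n 1 G C by (intro increasingD[OF h(1) Un_upper1]) auto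
      moreover have "?T n \<inter> cls UNIV \<subseteq> cls (- set_decode n \<union> C)"
        using cls_imp_cls[of _ "- C" "- set_decode n"] 1 by (auto simp: tag_cls_def)
      ultimately show ?thesis using new[OF G] 1 by (simp add: t_def)
    next
      case 2
      let ?i = "n - 2 ^ N"
      have G: "blocker ?i \<subseteq> {..<N}" by (rule blocker_subset[OF 2(2)])
      have "h (blocker ?i \<union> C)"
        using G C by (intro h(2) X_mono[OF Un_upper1 X_blocker]) simp
      moreover have "{v. ?i \<notin> missing v} = - blocker ?i" using 2(2) by (auto simp: missing_iff)
      then have "?T n \<inter> cls UNIV \<subseteq> cls (- blocker ?i \<union> C)"
        using cls_imp_above[of _ "- C" ?i] 2(1) by (auto simp: tag_cls_def)
      moreover have "n < 2 * 2 ^ N" using 2 by linarith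
      ultimately show ?thesis using new[OF G] 2 by (simp add: t_def)
    next
      case 3
      let ?i = "n - 2 ^ N"
      \<comment> \<open>The only vertex missing this column is at least \<open>N\<close>, hence
        outside \<open>C\<close>, so solving the implication already solves the column.\<close>
      have "cls ({v. ?i \<notin> missing v} \<union> C) \<subseteq> above ?i"
        using C 3(2) by (intro cls_subset_above) (auto simp: missing_iff)
      then have "?T n \<inter> cls UNIV \<subseteq> above ?i"
        using cls_imp_above[of _ "- C" ?i] 3(1) by (auto simp: tag_cls_def)
      moreover have "\<not> n < 2 * 2 ^ N" using 3 by linarith
      ultimately show ?thesis using 3 by (simp add: t_def tag_cls_def)
    qed
  qed
  also have "\<dots> \<le>\<^sub>D Dsup (tagged ?S ?T) truth"
    unfolding truth_def by (rule tagged_join_plain[OF upT upclosed_cls])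
  also have "\<dots> \<le>\<^sub>D \<X>"
    by (rule Dsup_least[OF tagged_le_Dsup_plain[OF le[unfolded prob_def] upclosed_cls cls_nonempty upclosed_tag_cls] truth])
  finally show ?thesis .
qed

text \<open>Each \<open>C\<close> with \<open>k C\<close> puts \<open>plain (cls (- C))\<close>
  above \<open>prob k\<close>, so \<open>prob_imp_step\<close> applies to it. The finitely many
  results are joined by \<open>prob_conj\<close>, and \<open>G \<union> C\<close> is
  \<open>C\<close> whenever \<open>G \<subseteq> C\<close>.\<close>

lemma prob_imp:
  assumes h: "increasing h" "\<And>G. G \<subseteq> {..<N} \<Longrightarrow> X G \<Longrightarrow> h G"
    and le: "prob h \<le>\<^sub>D Dsup (prob k) \<X>" and truth: "truth \<le>\<^sub>D \<X>"
  shows "prob (\<lambda>G. \<forall>C\<subseteq>{..<N}. G \<subseteq> C \<longrightarrow> k C \<longrightarrow> h C) \<le>\<^sub>D \<X>"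
proof -
  have step: "prob (\<lambda>G. h (G \<union> C)) \<le>\<^sub>D \<X>" if C: "C \<subseteq> {..<N}" "k C" for C
  proof (rule prob_imp_step[OF h C(1) _ truth])
    have "finite C" using C(1) finite_subset by blast
    then have "prob k \<le>\<^sub>D plain (cls (- C))"
      unfolding prob_def using C(2) set_encode_less[OF C(1)]
      by (intro tagged_le_plain[of "set_encode C"]) (simp_all add: tag_cls_def set_encode_inverse)
    then show "prob h \<le>\<^sub>D Dsup (plain (cls (- C))) \<X>"
      using D_le_trans[OF le Dsup_mono[OF _ D_le_refl]] by blast
  qed
  have "prob (\<lambda>G. \<forall>C\<in>\<C>. h (G \<union> C)) \<le>\<^sub>D \<X>" if "finite \<C>" "\<C> \<subseteq> {C. C \<subseteq> {..<N} \<and> k C}" for \<C>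
    using that
  proof (induction \<C> rule: finite_induct)
    case empty
    \<comment> \<open>Tag 0 codes the empty set, whose class is \<open>cls UNIV\<close>.\<close>
    have "prob (\<lambda>G. \<forall>C\<in>{}. h (G \<union> C)) \<le>\<^sub>D truth"
      unfolding prob_def truth_def by (rule tagged_le_plain[of 0]) (auto simp: tag_cls_def)
    then show ?case using truth by (rule D_le_trans)
  next
    case (insert C \<C>)
    have inc: "increasing (\<lambda>G. h (G \<union> C'))" if "C' \<subseteq> {..<N}" for C'
      using h(1) that unfolding increasing_def by (meson Un_mono Un_subset_iff order_refl)
    have "prob (\<lambda>G. h (G \<union> C) \<and> (\<forall>C\<in>\<C>. h (G \<union> C))) \<le>\<^sub>D
      Dsup (prob (\<lambda>G. h (G \<union> C))) (prob (\<lambda>G. \<forall>C\<in>\<C>. h (G \<union> C)))"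
    proof (rule prob_conj)
      show "increasing (\<lambda>G. h (G \<union> C))" using inc insert.prems by blast
      show "increasing (\<lambda>G. \<forall>C\<in>\<C>. h (G \<union> C))" using inc insert.prems unfolding increasing_def by blast
    qed
    also have "\<dots> \<le>\<^sub>D \<X>" using step insert by (intro Dsup_least) auto
    finally show ?case by simp
  qed
  from this[of "{C. C \<subseteq> {..<N} \<and> k C}"]
  have "prob (\<lambda>G. \<forall>C\<in>{C. C \<subseteq> {..<N} \<and> k C}. h (G \<union> C)) \<le>\<^sub>D \<X>" by simp
  with prob_mono show ?thesis
    by (rule D_le_trans) (auto simp: sup_absorb2)
qed

section \<open>Comparison of the valuation with forcing\<close>

abbreviation forces :: "form \<Rightarrow> nat set \<Rightarrow> bool" where
  "forces \<equiv> sat N X V"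

lemma forces_connectives:
  "forces (Atom n) = V n"
  "forces (Or p q) = (\<lambda>G. forces p G \<or> forces q G)"
  "forces (And p q) = (\<lambda>G. forces p G \<and> forces q G)"
  "forces (Imp p q) = (\<lambda>G. \<forall>C\<subseteq>{..<N}. G \<subseteq> C \<longrightarrow> forces p C \<longrightarrow> forces q C)"
  "forces (Neg p) = (\<lambda>G. \<forall>C\<subseteq>{..<N}. G \<subseteq> C \<longrightarrow> forces p C \<longrightarrow> X C)"
  by (rule ext, simp)+

lemma increasing_forces: "increasing (forces q)"
  unfolding increasing_def
proof (intro allI impI)
  fix G H assume "G \<subseteq> H" "H \<subseteq> {..<N}" "forces q G"
  then show "forces q H" by (induction q arbitrary: G) (auto dest: V_mono)
qed

lemma forces_if_X: "X G \<Longrightarrow> forces q G"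
  by (induction q arbitrary: G) (auto intro: X_V X_mono)

definition valuation :: "nat \<Rightarrow> mass_problem" where
  "valuation n = prob (V n)"

text \<open>Agreement is modulo \<open>truth\<close>, which \<open>prob_imp\<close> requires. The
  two inequalities need a joint induction, since an implication uses the opposite one for its
  antecedent.\<close>

lemma mass_val_forces:
  "mass_val bot valuation q \<le>\<^sub>D Dsup (prob (forces q)) truth \<and>
   prob (forces q) \<le>\<^sub>D Dsup (mass_val bot valuation q) truth"
proof (induction q)
  case (Atom n)
  show ?case by (simp add: forces_connectives valuation_def Dsup_ge1 del: sat.simps)
next
  case (Or p q)
  let ?p = "mass_val bot valuation p" and ?q = "mass_val bot valuation q"
  \<comment> \<open>Moving \<open>truth\<close> to the left by residuation leaves plain lower
    bounds, to which \<open>Dinf_greatest\<close> applies.\<close>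
  have "Darr truth (Dinf ?p ?q) \<le>\<^sub>D prob (forces p)" "Darr truth (Dinf ?p ?q) \<le>\<^sub>D prob (forces q)"
    unfolding Darr_le_iff
    using D_le_trans[OF Dinf_le1 conjunct1[OF Or.IH(1)]] D_le_trans[OF Dinf_le2 conjunct1[OF Or.IH(2)]]
    by (blast intro: D_le_trans Dsup_least Dsup_ge1 Dsup_ge2)+
  then have "Darr truth (Dinf ?p ?q) \<le>\<^sub>D prob (forces (Or p q))"
    unfolding forces_connectives by (rule D_le_trans[OF Dinf_greatest prob_disj])
  moreover have "Darr truth (prob (forces (Or p q))) \<le>\<^sub>D ?p" "Darr truth (prob (forces (Or p q))) \<le>\<^sub>D ?q"
    unfolding Darr_le_iff
    using D_le_trans[OF prob_mono conjunct2[OF Or.IH(1)], of "forces (Or p q)"]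
      D_le_trans[OF prob_mono conjunct2[OF Or.IH(2)], of "forces (Or p q)"]
    by (auto intro: D_le_trans Dsup_least Dsup_ge1 Dsup_ge2)
  then have "Darr truth (prob (forces (Or p q))) \<le>\<^sub>D Dinf ?p ?q" by (rule Dinf_greatest)
  ultimately show ?case
    unfolding mass_val.simps Darr_le_iff using D_le_trans[OF _ Dsup_commute] by blast
next
  case (And p q)
  let ?p = "mass_val bot valuation p" and ?q = "mass_val bot valuation q"
  have "prob (forces p) \<le>\<^sub>D prob (forces (And p q))" "prob (forces q) \<le>\<^sub>D prob (forces (And p q))"
    by (rule prob_mono; simp)+
  then have le: "?p \<le>\<^sub>D Dsup (prob (forces (And p q))) truth" "?q \<le>\<^sub>D Dsup (prob (forces (And p q))) truth"
    using And.IH D_le_trans Dsup_mono[OF _ D_le_refl] by blast+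
  have "prob (forces (And p q)) \<le>\<^sub>D Dsup (prob (forces p)) (prob (forces q))"
    unfolding forces_connectives by (rule prob_conj[OF increasing_forces increasing_forces])
  moreover have "prob (forces p) \<le>\<^sub>D Dsup (Dsup ?p ?q) truth" "prob (forces q) \<le>\<^sub>D Dsup (Dsup ?p ?q) truth"
    using And.IH D_le_trans Dsup_mono[OF Dsup_ge1 D_le_refl] Dsup_mono[OF Dsup_ge2 D_le_refl] by blast+
  ultimately have "prob (forces (And p q)) \<le>\<^sub>D Dsup (Dsup ?p ?q) truth"
    using D_le_trans Dsup_least by meson
  then show ?case unfolding mass_val.simps using le Dsup_least by blast
next
  case (Imp p q)
  let ?p = "mass_val bot valuation p" and ?q = "mass_val bot valuation q"
  have "Darr ?p ?q \<le>\<^sub>D Dsup (prob (forces (Imp p q))) truth"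
    unfolding Darr_le_iff
  proof -
    let ?R = "Dsup ?p (Dsup (prob (forces (Imp p q))) truth)"
    have t: "truth \<le>\<^sub>D ?R" by (intro le_Dsup2 D_le_refl)
    have "prob (forces p) \<le>\<^sub>D ?R"
      using D_le_trans[OF conjunct2[OF Imp.IH(1)] Dsup_least[OF Dsup_ge1 t]] .
    moreover have "prob (forces (Imp p q)) \<le>\<^sub>D ?R" by (intro le_Dsup2 le_Dsup1 D_le_refl)
    moreover have "prob (forces q) \<le>\<^sub>D Dsup (prob (forces p)) (prob (forces (Imp p q)))"
      by (rule D_le_trans[OF prob_mono prob_conj[OF increasing_forces increasing_forces]]) auto
    ultimately have "prob (forces q) \<le>\<^sub>D ?R" using D_le_trans Dsup_least by blast
    then show "?q \<le>\<^sub>D ?R"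
      using D_le_trans[OF conjunct1[OF Imp.IH(2)] Dsup_least[OF _ t]] by blast
  qed
  moreover have "prob (forces (Imp p q)) \<le>\<^sub>D Dsup (Darr ?p ?q) truth"
    unfolding forces_connectives
  proof (rule prob_imp[OF increasing_forces forces_if_X _ Dsup_ge2])
    let ?R = "Dsup (prob (forces p)) (Dsup (Darr ?p ?q) truth)"
    have t: "truth \<le>\<^sub>D ?R" by (intro le_Dsup2 D_le_refl)
    have "?p \<le>\<^sub>D ?R" using D_le_trans[OF conjunct1[OF Imp.IH(1)] Dsup_least[OF Dsup_ge1 t]] .
    moreover have "Darr ?p ?q \<le>\<^sub>D ?R" by (intro le_Dsup2 le_Dsup1 D_le_refl)
    ultimately have "?q \<le>\<^sub>D ?R" by (meson Darr_mpD)
    then show "prob (forces q) \<le>\<^sub>D ?R"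
      using D_le_trans[OF conjunct2[OF Imp.IH(2)] Dsup_least[OF _ t]] by blast
  qed
  ultimately show ?case unfolding mass_val.simps by (rule conjI)
next
  case (Neg p)
  let ?p = "mass_val bot valuation p"
  have "Darr ?p bot \<le>\<^sub>D Dsup (prob (forces (Neg p))) truth"
    unfolding Darr_le_iff
  proof -
    let ?R = "Dsup ?p (Dsup (prob (forces (Neg p))) truth)"
    have t: "truth \<le>\<^sub>D ?R" by (intro le_Dsup2 D_le_refl)
    have "prob (forces p) \<le>\<^sub>D ?R"
      using D_le_trans[OF conjunct2[OF Neg.IH] Dsup_least[OF Dsup_ge1 t]] .
    moreover have "prob (forces (Neg p)) \<le>\<^sub>D ?R" by (intro le_Dsup2 le_Dsup1 D_le_refl)
    moreover have "prob X \<le>\<^sub>D Dsup (prob (forces p)) (prob (forces (Neg p)))"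
      by (rule D_le_trans[OF prob_mono prob_conj[OF increasing_forces increasing_forces]]) auto
    ultimately have "prob X \<le>\<^sub>D ?R" using D_le_trans Dsup_least by blast
    with bot_le_prob_X show "bot \<le>\<^sub>D ?R" by (rule D_le_trans)
  qed
  moreover have "prob (forces (Neg p)) \<le>\<^sub>D Dsup (Darr ?p bot) truth"
    unfolding forces_connectives
  proof (rule prob_imp[OF _ _ _ Dsup_ge2])
    show "increasing X" unfolding increasing_def using X_mono by blast
    let ?R = "Dsup (prob (forces p)) (Dsup (Darr ?p bot) truth)"
    have t: "truth \<le>\<^sub>D ?R" by (intro le_Dsup2 D_le_refl)
    have "?p \<le>\<^sub>D ?R" using D_le_trans[OF conjunct1[OF Neg.IH] Dsup_least[OF Dsup_ge1 t]] .
    moreover have "Darr ?p bot \<le>\<^sub>D ?R" by (intro le_Dsup2 le_Dsup1 D_le_refl)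
    ultimately have "bot \<le>\<^sub>D ?R" by (meson Darr_mpD)
    with prob_le_bot show "prob X \<le>\<^sub>D ?R" by (rule D_le_trans)
  qed
  ultimately show ?case unfolding mass_val.simps by (rule conjI)
qed

text \<open>Irreducibility provides one tag for all of \<open>cls UNIV\<close>. It is not a column,
  as every column is missing at some vertex; and a set whose complement contains all vertices is
  empty.\<close>

lemma forces_empty_if_valid:
  assumes "mass_val bot valuation q \<le>\<^sub>D D0"
  shows "forces q {}"
proof -
  have "prob (forces q) \<le>\<^sub>D Dsup (mass_val bot valuation q) truth"
    using mass_val_forces by blast
  also have "\<dots> \<le>\<^sub>D truth" using D_le_trans[OF assms D0_le] by (rule Dsup_least) simp
  finally have le: "prob (forces q) \<le>\<^sub>D truth" .
  obtain n where n: "n < 2 ^ N \<longrightarrow> forces q (set_decode n)" "cls UNIV \<subseteq> tag_cls n"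
    using tagged_le_plainD[OF le[unfolded prob_def truth_def] upclosed_cls cls_nonempty upclosed_tag_cls]
    by auto
  have "n < 2 ^ N"
  proof (rule ccontr)
    assume "\<not> n < 2 ^ N"
    then have "cls UNIV \<subseteq> above (n - 2 ^ N)" using n(2) by (simp add: tag_cls_def)
    then have no: "n - 2 ^ N \<notin> missing v" for v using cls_subset_aboveD by blast
    show False
    proof (cases "n - 2 ^ N < 2 ^ N")
      case True
      then show ?thesis using no blocker_nonempty by (auto simp: missing_iff)
    next
      case False
      then show ?thesis using no[of "N + (n - 2 ^ N - 2 ^ N)"] by (simp add: missing_iff)
    qed
  qed
  moreover from this have "set_decode n = {}"
    using n(2) cls_subsetD[of UNIV "- set_decode n"] by (auto simp: tag_cls_def)
  ultimately show ?thesis using n(1) by simp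
qed

end

section \<open>The theory of the interval\<close>

context independent_columns
begin

text \<open>A reduction would make some column enumerable from every set, but
  \<open>exists_coded\<close> yields a set that misses it.\<close>

lemma not_tagged_above_le_D0: "\<not> tagged UNIV above \<le>\<^sub>D D0"
proof
  assume "tagged UNIV above \<le>\<^sub>D D0"
  then obtain n A where A: "A \<in> above n" "\<forall>B. A \<preceq> B" by (rule tagged_le_D0D)
  obtain f where "\<not> col n \<preceq> f" by (rule exists_coded[of "{n}"]) simp_all
  with A show False unfolding above_def using e_reducible_trans by blast
qed

lemma Th_below_tagged_above: "Th (below (tagged UNIV above)) = IPC"
proof
  show "IPC \<subseteq> Th (below (tagged UNIV above))"
    by (auto simp: Th_below_iff intro!: IPC_sound)
  show "Th (below (tagged UNIV above)) \<subseteq> IPC"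
  proof
    fix p assume p: "p \<in> Th (below (tagged UNIV above))"
    show "p \<in> IPC"
    proof (rule ccontr)
      assume "p \<notin> IPC"
      then obtain N X V where *: "exploding_model N X V" "\<not> sat N X V p {}"
        by (rule exploding_countermodel)
      then interpret exploding_model N X V by simp
      interpret refutation g N X V ..
      have "\<forall>n. valuation n \<le>\<^sub>D bot" by (simp add: valuation_def prob_le_bot)
      then have "mass_val bot valuation p \<le>\<^sub>D D0"
        using p unfolding Th_below_iff bot_def by blast
      then show False using forces_empty_if_valid *(2) by blast
    qed
  qed
qed

end

theorem theorem4p19:
  fixes g :: "nat \<Rightarrow> nat"
    and G :: pfun
    and Z :: mass_problem
  defines "G \<equiv> (\<lambda>x. Some (g x))"
    and "Z \<equiv> {prepend i \<phi> | i \<phi>. column G i \<le>\<^sub>e \<phi>}"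
  assumes "computably_e_independent G"
  shows "brouwer_algebra (interval dyment_lattice zero_D (D_degree Z)) \<and>
         Th (interval dyment_lattice zero_D (D_degree Z)) = IPC"
proof -
  interpret independent_columns g
    using assms(3) by unfold_locales (simp add: G_def)
  have "Z = tagged UNIV above"
    by (auto simp: Z_def G_def tagged_def pfun_e_le_def code_graph_column above_def)
  then show ?thesis
    using brouwer_algebra_below[OF not_tagged_above_le_D0] Th_below_tagged_above by simp
qed

end
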